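(* Let $(G,\mu)$ be a pmp discrete groupoid with unit space $X$, and let $Y\subset X$ be a Borel subset such that for $\mu$-a.e. $x\in X$ there is at least one $g\in G$ with $s(g)=x$ and $r(g)\in Y$. Then: (1) $C_\mu(G)-1=C_\mu(G|_Y)-\mu(Y)$; (2) $G$ is treeable if and only if $G|_Y$ is treeable.
   Context: A discrete Borel groupoid $G$ with unit space $X\subset G$ is a groupoid that is a standard Borel space, with Borel source and range maps $s,r:G\to X$, Borel product ($g_1g_2$ is defined iff $s(g_1)=r(g_2)$) and Borel inverse, such that $s,r$ are countable-to-one. A Borel set $E\subset G$ is one-sheeted if $s|_E$ and $r|_E$ are injective; then $\varphi_E:=(r|_E)\circ(s|_E)^{-1}:s(E)\to r(E)$; $\mathcal{G}_G$ is the set of one-sheeted sets. $(G,\mu)$ is a pmp discrete groupoid if $\mu$ is a probability measure on $X$ invariant under all $\varphi_E$, $E\in\mathcal G_G$. Put $\mu^G(B)=\int_X\#(s^{-1}(x)\cap B)\,\mu(dx)$. For an at most countable family $\mathcal{E}\subset\mathcal{G}_G$, a reduced word in $\mathcal{E}$ is a non-empty product $E_1^{\epsilon_1}\cdots E_n^{\epsilon_n}$ ($n\ge1$, $E_i\in\mathcal{E}$, $\epsilon_i\in\{1,-1\}$) such that $E_i=E_{i+1}$ implies $\epsilon_i=\epsilon_{i+1}$; $\mathrm{Wr}(\mathcal{E})$ is the set of reduced words. $\mathcal{E}$ is a graphing of $G$ if $\mu^G(G\setminus(X\cup\bigcup_{W\in\mathrm{Wr}(\mathcal{E})}W))=0$.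 Its cost is $C_\mu(\mathcal{E})=\sum_{E\in\mathcal{E}}\mu^G(E)$, and $C_\mu(G)=\inf\{C_\mu(\mathcal{E}):\mathcal{E}\text{ a graphing of }G\}\in[0,\infty]$. $\mathcal{E}$ is a treeing if $\mu^G(W\cap X)=0$ for every reduced word $W$ in $\mathcal{E}$; $G$ is treeable if it has a treeing which is also a graphing. The restriction is $G|_Y=s^{-1}(Y)\cap r^{-1}(Y)$, a discrete groupoid with unit space $Y$ equipped with the (non-normalized) finite measure $\mu|_Y$; its graphings, treeings and cost $C_\mu(G|_Y)$ are defined by the same formulas using $\mu|_Y$. *)

theory Defs
  imports "HOL-Probability.Probability_Measure"
begin

definition standard_borel :: "'a measure \<Rightarrow> bool" where
  "standard_borel M \<longleftrightarrow>
     (\<exists>T. topspace T = space M \<and> completely_metrizable_space T \<and> second_countable T \<and>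
          sets M = sigma_sets (space M) {U. openin T U})"

text \<open>The field \<open>arrows\<close> carries the groupoid together with its Borel structure; its measure
  component plays no role.  The total function \<open>mult\<close> is only meaningful on composable pairs.\<close>

record 'a groupoid_data =
  arrows :: "'a measure"
  units :: "'a set"
  src :: "'a \<Rightarrow> 'a"
  rng :: "'a \<Rightarrow> 'a"
  mult :: "'a \<Rightarrow> 'a \<Rightarrow> 'a"
  inverse_of :: "'a \<Rightarrow> 'a"

definition composable :: "'a groupoid_data \<Rightarrow> ('a \<times> 'a) set" where
  "composable G =
     {(g, h). g \<in> space (arrows G) \<and> h \<in> space (arrows G) \<and> src G g = rng G h}"

locale groupoid =
  fixes G :: "'a groupoid_data"
  assumes units_subset: "units G \<subseteq> space (arrows G)"
    and src_closed: "g \<in> space (arrows G) \<Longrightarrow> src G g \<in> units G"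
    and rng_closed: "g \<in> space (arrows G) \<Longrightarrow> rng G g \<in> units G"
    and src_unit: "x \<in> units G \<Longrightarrow> src G x = x"
    and rng_unit: "x \<in> units G \<Longrightarrow> rng G x = x"
    and mult_closed: "(g, h) \<in> composable G \<Longrightarrow> mult G g h \<in> space (arrows G)"
    and src_mult: "(g, h) \<in> composable G \<Longrightarrow> src G (mult G g h) = src G h"
    and rng_mult: "(g, h) \<in> composable G \<Longrightarrow> rng G (mult G g h) = rng G g"
    and mult_assoc: "(g, h) \<in> composable G \<Longrightarrow> (h, k) \<in> composable G \<Longrightarrow>
          mult G (mult G g h) k = mult G g (mult G h k)"
    and mult_src: "g \<in> space (arrows G) \<Longrightarrow> mult G g (src G g) = g"
    and mult_rng: "g \<in> space (arrows G) \<Longrightarrow> mult G (rng G g) g = g"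
    and inverse_closed: "g \<in> space (arrows G) \<Longrightarrow> inverse_of G g \<in> space (arrows G)"
    and src_inverse: "g \<in> space (arrows G) \<Longrightarrow> src G (inverse_of G g) = rng G g"
    and rng_inverse: "g \<in> space (arrows G) \<Longrightarrow> rng G (inverse_of G g) = src G g"
    and inverse_mult: "g \<in> space (arrows G) \<Longrightarrow> mult G (inverse_of G g) g = src G g"
    and mult_inverse: "g \<in> space (arrows G) \<Longrightarrow> mult G g (inverse_of G g) = rng G g"

abbreviation unit_space :: "'a groupoid_data \<Rightarrow> 'a measure" where
  "unit_space G \<equiv> restrict_space (arrows G) (units G)"

locale discrete_borel_groupoid = groupoid G for G :: "'a groupoid_data" +
  assumes standard_borel: "standard_borel (arrows G)"
    and units_borel: "units G \<in> sets (arrows G)"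
    and src_borel: "src G \<in> arrows G \<rightarrow>\<^sub>M unit_space G"
    and rng_borel: "rng G \<in> arrows G \<rightarrow>\<^sub>M unit_space G"
    and mult_borel: "(\<lambda>(g, h). mult G g h)
          \<in> restrict_space (arrows G \<Otimes>\<^sub>M arrows G) (composable G) \<rightarrow>\<^sub>M arrows G"
    and inverse_borel: "inverse_of G \<in> arrows G \<rightarrow>\<^sub>M arrows G"
    and countable_src: "x \<in> units G \<Longrightarrow> countable {g \<in> space (arrows G). src G g = x}"
    and countable_rng: "x \<in> units G \<Longrightarrow> countable {g \<in> space (arrows G). rng G g = x}"

definition one_sheeted :: "'a groupoid_data \<Rightarrow> 'a set set" where
  "one_sheeted G = {E \<in> sets (arrows G). inj_on (src G) E \<and> inj_on (rng G) E}"

definition sheet_map :: "'a groupoid_data \<Rightarrow> 'a set \<Rightarrow> 'a \<Rightarrow> 'a" where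
  "sheet_map G E = rng G \<circ> the_inv_into E (src G)"

text \<open>In the invariance condition the image of \<open>A\<close> under \<open>sheet_map G E\<close> is automatically Borel:
  by the Lusin--Souslin theorem injective Borel maps between standard Borel spaces send Borel
  sets to Borel sets.\<close>

locale pmp_discrete_groupoid = discrete_borel_groupoid G + prob_space mu
  for G :: "'a groupoid_data" and mu :: "'a measure" +
  assumes sets_mu: "sets mu = sets (unit_space G)"
    and invariant: "E \<in> one_sheeted G \<Longrightarrow> A \<in> sets mu \<Longrightarrow> A \<subseteq> src G ` E \<Longrightarrow>
          emeasure mu (sheet_map G E ` A) = emeasure mu A"

text \<open>The integrand below is Borel for Borel \<open>B\<close> in a discrete Borel groupoid (Lusin--Novikov), so
  \<open>nn_integral\<close> is then the genuine integral.\<close>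

definition groupoid_measure :: "'a groupoid_data \<Rightarrow> 'a measure \<Rightarrow> 'a set \<Rightarrow> ennreal" where
  "groupoid_measure G mu B =
     (\<integral>\<^sup>+ x. emeasure (count_space UNIV) ({g \<in> space (arrows G). src G g = x} \<inter> B) \<partial>mu)"

definition set_mult :: "'a groupoid_data \<Rightarrow> 'a set \<Rightarrow> 'a set \<Rightarrow> 'a set" where
  "set_mult G A B = {mult G g h | g h. g \<in> A \<and> h \<in> B \<and> (g, h) \<in> composable G}"

definition set_power :: "'a groupoid_data \<Rightarrow> 'a set \<times> int \<Rightarrow> 'a set" where
  "set_power G = (\<lambda>(E, e). if e = 1 then E else inverse_of G ` E)"

definition reduced_words :: "'a set set \<Rightarrow> ('a set \<times> int) list set" where
  "reduced_words \<E> =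
     {w. w \<noteq> [] \<and> set w \<subseteq> \<E> \<times> {1, -1} \<and>
         (\<forall>i. Suc i < length w \<longrightarrow> fst (w ! i) = fst (w ! Suc i) \<longrightarrow>
              snd (w ! i) = snd (w ! Suc i))}"

text \<open>The unit space is a neutral element for \<open>set_mult G\<close> on subsets of \<open>G\<close>, so it can serve as
  the empty product.\<close>

definition word_set :: "'a groupoid_data \<Rightarrow> ('a set \<times> int) list \<Rightarrow> 'a set" where
  "word_set G w = foldr (\<lambda>p. set_mult G (set_power G p)) w (units G)"

definition Wr :: "'a groupoid_data \<Rightarrow> 'a set set \<Rightarrow> 'a set set" where
  "Wr G \<E> = word_set G ` reduced_words \<E>"

definition sheet_family :: "'a groupoid_data \<Rightarrow> 'a set set \<Rightarrow> bool" where
  "sheet_family G \<E> \<longleftrightarrow> countable \<E> \<and> \<E> \<subseteq> one_sheeted G"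

definition graphing :: "'a groupoid_data \<Rightarrow> 'a measure \<Rightarrow> 'a set set \<Rightarrow> bool" where
  "graphing G mu \<E> \<longleftrightarrow> sheet_family G \<E> \<and>
     groupoid_measure G mu (space (arrows G) - (units G \<union> \<Union> (Wr G \<E>))) = 0"

definition treeing :: "'a groupoid_data \<Rightarrow> 'a measure \<Rightarrow> 'a set set \<Rightarrow> bool" where
  "treeing G mu \<E> \<longleftrightarrow> sheet_family G \<E> \<and>
     (\<forall>W \<in> Wr G \<E>. groupoid_measure G mu (W \<inter> units G) = 0)"

definition treeable :: "'a groupoid_data \<Rightarrow> 'a measure \<Rightarrow> bool" where
  "treeable G mu \<longleftrightarrow> (\<exists>\<E>. treeing G mu \<E> \<and> graphing G mu \<E>)"

definition family_cost :: "'a groupoid_data \<Rightarrow> 'a measure \<Rightarrow> 'a set set \<Rightarrow> ennreal" where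
  "family_cost G mu \<E> = (\<Sum>\<^sub>\<infinity>E\<in>\<E>. groupoid_measure G mu E)"

definition cost :: "'a groupoid_data \<Rightarrow> 'a measure \<Rightarrow> ennreal" where
  "cost G mu = Inf {family_cost G mu \<E> | \<E>. graphing G mu \<E>}"

definition groupoid_restrict :: "'a groupoid_data \<Rightarrow> 'a set \<Rightarrow> 'a groupoid_data" where
  "groupoid_restrict G Y =
     G\<lparr>arrows := restrict_space (arrows G)
                   {g \<in> space (arrows G). src G g \<in> Y \<and> rng G g \<in> Y},
       units := Y\<rparr>"

end

theory Submission
  imports Defs
begin

text \<open>Graphings are moved between \<open>G\<close> and \<open>G|\<^sub>Y\<close> with a change of cost of exactly
  \<open>\<mu>(X - Y)\<close>, preserving treeings. From \<open>G|\<^sub>Y\<close> to \<open>G\<close>, add one arrow into \<open>Y\<close> from almost every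
  point outside \<open>Y\<close>. From \<open>G\<close> to \<open>G|\<^sub>Y\<close>, let every point outside \<open>Y\<close> choose an edge of the graphing
  that brings it closer to \<open>Y\<close>. The chosen edges form a forest rooted in \<open>Y\<close>, of total cost
  \<open>\<mu>(X - Y)\<close>, which yields an arrow \<open>d(x)\<close> from \<open>x\<close> into \<open>Y\<close>; every other edge \<open>e\<close> is replaced by
  \<open>d(r(e)) e d(s(e))\<^sup>-\<^sup>1\<close>. A relation between the new edges expands to one between the old edges, and
  deleting the forest edges from it recovers the original reduced word, so it does not cancel.

  Measurability rests on the theorems of Lusin--Souslin and Lusin--Novikov. The latter is proved by
  a Cantor scheme: a countable-to-one Borel map that is not a countable union of injective pieces
  would have a perfect set in some fibre.\<close>

section \<open>Lusin--Souslin and Lusin--Novikov theorems\<close>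

definition baire :: "(nat \<Rightarrow> nat) measure" where
  "baire = PiM UNIV (\<lambda>_. count_space UNIV)"

lemma space_baire [simp]: "space baire = UNIV"
  by (simp add: baire_def space_PiM PiE_UNIV_domain)

lemma measurable_baire_coord:
  "f \<in> M \<rightarrow>\<^sub>M baire \<Longrightarrow> (\<lambda>x. f x n) \<in> M \<rightarrow>\<^sub>M count_space UNIV"
  unfolding baire_def by (rule measurable_compose[OF _ measurable_component_singleton]) auto

lemma measurable_baire_proj [measurable]: "(\<lambda>a. a n) \<in> baire \<rightarrow>\<^sub>M count_space UNIV"
  unfolding baire_def by (rule measurable_component_singleton) auto

lemma measurable_baire_I:
  "(\<And>n. (\<lambda>x. f x n) \<in> M \<rightarrow>\<^sub>M count_space UNIV) \<Longrightarrow> f \<in> M \<rightarrow>\<^sub>M baire"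
  unfolding baire_def by (rule measurable_PiM_single'[where f="\<lambda>n x. f x n"]) auto

lemma measurable_baire_iff:
  "f \<in> M \<rightarrow>\<^sub>M baire \<longleftrightarrow> (\<forall>n k. {x \<in> space M. f x n = k} \<in> sets M)"
proof
  assume f: "f \<in> M \<rightarrow>\<^sub>M baire"
  from measurable_sets[OF measurable_baire_coord[OF f], of "{k}" for k]
  show "\<forall>n k. {x \<in> space M. f x n = k} \<in> sets M"
    by (auto simp: vimage_def Int_def conj_commute)
next
  assume *: "\<forall>n k. {x \<in> space M. f x n = k} \<in> sets M"
  have "(\<lambda>x. f x n) \<in> M \<rightarrow>\<^sub>M count_space UNIV" for n
  proof (rule measurableI)
    fix A :: "nat set"
    have "(\<lambda>x. f x n) -` A \<inter> space M = (\<Union>k\<in>A. {x \<in> space M. f x n = k})" by auto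
    then show "(\<lambda>x. f x n) -` A \<inter> space M \<in> sets M" using * by auto
  qed auto
  then show "f \<in> M \<rightarrow>\<^sub>M baire"
    by (rule measurable_baire_I)
qed

lemma pred_baire_eq:
  assumes f: "f \<in> M \<rightarrow>\<^sub>M baire" and g: "g \<in> M \<rightarrow>\<^sub>M baire"
  shows "Measurable.pred M (\<lambda>x. f x = g x)"
proof -
  have "Measurable.pred M (\<lambda>x. f x n = g x n)" for n
  proof -
    have "{x \<in> space M. f x n = g x n} = (\<Union>k. {x \<in> space M. f x n = k} \<inter> {x \<in> space M. g x n = k})"
      by auto
    also have "\<dots> \<in> sets M" using f g unfolding measurable_baire_iff by blast
    finally show ?thesis by (simp add: pred_def)
  qed
  then have "Measurable.pred M (\<lambda>x. \<forall>n. f x n = g x n)" by (rule pred_intros_countable)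
  then show ?thesis by (simp add: fun_eq_iff)
qed

definition even_part :: "(nat \<Rightarrow> nat) \<Rightarrow> nat \<Rightarrow> nat" where "even_part a n = a (2 * n)"
definition odd_part :: "(nat \<Rightarrow> nat) \<Rightarrow> nat \<Rightarrow> nat" where "odd_part a n = a (2 * n + 1)"
definition interleave :: "(nat \<Rightarrow> nat) \<Rightarrow> (nat \<Rightarrow> nat) \<Rightarrow> nat \<Rightarrow> nat" where
  "interleave a b n = (if even n then a (n div 2) else b (n div 2))"
definition slice :: "nat \<Rightarrow> (nat \<Rightarrow> nat) \<Rightarrow> nat \<Rightarrow> nat" where "slice i a n = a (prod_encode (i, n))"

lemma even_part_interleave [simp]: "even_part (interleave a b) = a" and odd_part_interleave [simp]: "odd_part (interleave a b) = b"
  by (auto simp: even_part_def odd_part_def interleave_def)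

lemma interleave_even_part_odd_part [simp]: "interleave (even_part a) (odd_part a) = a"
  by (rule ext) (auto simp: even_part_def odd_part_def interleave_def)

lemma measurable_even_part [measurable]: "even_part \<in> baire \<rightarrow>\<^sub>M baire"
  and measurable_odd_part [measurable]: "odd_part \<in> baire \<rightarrow>\<^sub>M baire"
  and measurable_slice [measurable]: "slice i \<in> baire \<rightarrow>\<^sub>M baire"
  by (rule measurable_baire_I, simp add: even_part_def odd_part_def slice_def measurable_baire_proj)+

lemma slice_unslice: "slice i (\<lambda>n. case_prod F (prod_decode n)) = F i"
  by (auto simp: slice_def)

text \<open>Closed sets and continuous maps of the Baire space are described by initial segments of
  sequences.\<close>

definition cylinder :: "nat list \<Rightarrow> (nat \<Rightarrow> nat) set" where
  "cylinder t = {a. \<forall>i<length t. a i = t ! i}"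

definition init_seg :: "nat \<Rightarrow> (nat \<Rightarrow> nat) \<Rightarrow> nat list" where "init_seg n a = map a [0..<n]"

lemma length_init_seg [simp]: "length (init_seg n a) = n" by (simp add: init_seg_def)
lemma init_seg_0 [simp]: "init_seg 0 a = []" by (simp add: init_seg_def)
lemma nth_init_seg [simp]: "i < n \<Longrightarrow> init_seg n a ! i = a i" by (simp add: init_seg_def)
lemma in_cylinder_init_seg: "b \<in> cylinder (init_seg n a) \<longleftrightarrow> (\<forall>i<n. b i = a i)" by (auto simp: cylinder_def)
lemma in_cylinder_init_seg_self [simp]: "a \<in> cylinder (init_seg n a)" by (auto simp: cylinder_def)
lemma in_cylinder_iff_init_seg: "a \<in> cylinder t \<longleftrightarrow> init_seg (length t) a = t"
  by (auto simp: cylinder_def list_eq_iff_nth_eq)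
lemma cylinder_Nil [simp]: "cylinder [] = UNIV" by (auto simp: cylinder_def)

lemma cylinder_split: "cylinder t = (\<Union>k. cylinder (t @ [k]))"
  by (auto simp: cylinder_def nth_append less_Suc_eq)

lemma sets_cylinder [measurable]: "cylinder t \<in> sets baire"
proof -
  have "{a \<in> space baire. \<forall>i<length t. a i = t ! i} \<in> sets baire" by measurable
  then show ?thesis by (simp add: cylinder_def)
qed

definition baire_closed :: "(nat \<Rightarrow> nat) set \<Rightarrow> bool" where
  "baire_closed C \<longleftrightarrow> (\<forall>a. (\<forall>n. C \<inter> cylinder (init_seg n a) \<noteq> {}) \<longrightarrow> a \<in> C)"

definition baire_cont :: "(nat \<Rightarrow> nat) set \<Rightarrow> ((nat \<Rightarrow> nat) \<Rightarrow> (nat \<Rightarrow> nat)) \<Rightarrow> bool" where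
  "baire_cont C f \<longleftrightarrow> (\<forall>a\<in>C. \<forall>k. \<exists>m. \<forall>b \<in> C \<inter> cylinder (init_seg m a). f b k = f a k)"

lemma baire_contD: "baire_cont C f \<Longrightarrow> a \<in> C \<Longrightarrow> \<exists>m. \<forall>n\<ge>m. \<forall>b \<in> C \<inter> cylinder (init_seg n a). f b k = f a k"
proof -
  assume "baire_cont C f" "a \<in> C"
  then obtain m where m: "\<forall>b \<in> C \<inter> cylinder (init_seg m a). f b k = f a k" unfolding baire_cont_def by blast
  moreover have "cylinder (init_seg n a) \<subseteq> cylinder (init_seg m a)" if "m \<le> n" for n
    using that by (auto simp: in_cylinder_init_seg)
  ultimately show ?thesis by blast
qed

lemma baire_closed_Int_cylinder: "baire_closed C \<Longrightarrow> baire_closed (C \<inter> cylinder t)"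
  unfolding baire_closed_def
proof (intro allI impI)
  fix a assume *: "\<forall>a. (\<forall>n. C \<inter> cylinder (init_seg n a) \<noteq> {}) \<longrightarrow> a \<in> C"
    and **: "\<forall>n. C \<inter> cylinder t \<inter> cylinder (init_seg n a) \<noteq> {}"
  from ** have "a \<in> C" by (intro *[rule_format]) blast
  moreover obtain b where "b \<in> cylinder t" "b \<in> cylinder (init_seg (length t) a)"
    using **[rule_format, of "length t"] by auto
  then have "a \<in> cylinder t" by (auto simp: cylinder_def)
  ultimately show "a \<in> C \<inter> cylinder t" by simp
qed

lemma baire_closed_sets: "baire_closed C \<Longrightarrow> C \<in> sets baire"
proof -
  assume C: "baire_closed C"
  have "C = (\<Inter>n. \<Union>t\<in>{t. length t = n \<and> C \<inter> cylinder t \<noteq> {}}. cylinder t)" (is "_ = ?R")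
  proof
    show "C \<subseteq> ?R"
    proof (intro subsetI INT_I)
      fix a n assume "a \<in> C"
      then show "a \<in> (\<Union>t\<in>{t. length t = n \<and> C \<inter> cylinder t \<noteq> {}}. cylinder t)"
        by (intro UN_I[of "init_seg n a"]) (auto intro!: exI[of _ a] simp: disjoint_iff)
    qed
    show "?R \<subseteq> C"
    proof
      fix a assume a: "a \<in> ?R"
      have "C \<inter> cylinder (init_seg n a) \<noteq> {}" for n
        using a in_cylinder_iff_init_seg by fastforce
      then show "a \<in> C" using C by (auto simp: baire_closed_def)
    qed
  qed
  also have "\<dots> \<in> sets baire" by (intro sets.countable_INT' sets.countable_UN') auto
  finally show ?thesis .
qed

lemma baire_closed_ex_branch:
  assumes "baire_closed C" "\<And>n. C \<inter> cylinder (T n) \<noteq> {}" "\<And>n. \<exists>k. T (Suc n) = T n @ k" "\<And>n. n \<le> length (T n)"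
  obtains a where "a \<in> C" "\<And>n. a \<in> cylinder (T n)"
proof -
  have ext: "\<exists>k. T m = T n @ k" if "n \<le> m" for n m
    using that
  proof (induction m rule: dec_induct)
    case (step m)
    then show ?case using assms(3)[of m] by auto
  qed simp
  define a where "a = (\<lambda>i. T (Suc i) ! i)"
  have a: "a \<in> cylinder (T n)" for n
  proof -
    have "T (Suc i) ! i = T n ! i" if "i < length (T n)" for i
    proof (cases "n \<le> Suc i")
      case True then show ?thesis using ext[OF True] that by (auto simp: nth_append)
    next
      case False
      then obtain k where "T n = T (Suc i) @ k" using ext[of "Suc i" n] by auto
      moreover have "i < length (T (Suc i))" using assms(4)[of "Suc i"] by simp
      ultimately show ?thesis by (auto simp: nth_append)
    qed
    then show ?thesis by (auto simp: cylinder_def a_def)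
  qed
  have "C \<inter> cylinder (init_seg n a) \<noteq> {}" for n
  proof -
    have "cylinder (T n) \<subseteq> cylinder (init_seg n a)" using a[of n] assms(4)[of n] by (auto simp: cylinder_def)
    then show ?thesis using assms(2)[of n] by blast
  qed
  then have "a \<in> C" using assms(1) by (auto simp: baire_closed_def)
  with a show ?thesis using that by blast
qed

definition inj_analytic :: "(nat \<Rightarrow> nat) set \<Rightarrow> bool" where
  "inj_analytic A \<longleftrightarrow> (\<exists>C f. baire_closed C \<and> baire_cont C f \<and> inj_on f C \<and> A = f ` C)"

lemma inj_analytic_baire_closed: "baire_closed C \<Longrightarrow> inj_analytic C"
proof -
  have "baire_cont C (\<lambda>x. x)"
    unfolding baire_cont_def
  proof (intro ballI allI)
    fix a k
    show "\<exists>m. \<forall>b\<in>C \<inter> cylinder (init_seg m a). b k = a k"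
      by (rule exI[of _ "Suc k"]) (auto simp: in_cylinder_init_seg)
  qed
  then show "baire_closed C \<Longrightarrow> inj_analytic C"
    unfolding inj_analytic_def by (intro exI[of _ C] exI[of _ "\<lambda>x. x"]) auto
qed

lemma inj_analytic_Inter:
  assumes "\<And>i::nat. inj_analytic (A i)"
  shows "inj_analytic (\<Inter>i. A i)"
proof -
  from assms obtain C f where C: "\<And>i. baire_closed (C i)" and f: "\<And>i. baire_cont (C i) (f i)"
    and inj: "\<And>i. inj_on (f i) (C i)" and A: "\<And>i. A i = f i ` C i"
    unfolding inj_analytic_def by metis
  define D where "D = {a. \<forall>i. slice i a \<in> C i \<and> f i (slice i a) = f 0 (slice 0 a)}"
  have slice_init_seg: "\<exists>N. \<forall>b\<in>cylinder (init_seg N a). slice i b \<in> cylinder (init_seg n (slice i a))" for a i n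
  proof -
    have "finite ((\<lambda>j. prod_encode (i, j)) ` {..<n})" by simp
    then obtain N where "\<forall>k\<in>(\<lambda>j. prod_encode (i, j)) ` {..<n}. k < N"
      using finite_nat_set_iff_bounded by blast
    then have "\<forall>b\<in>cylinder (init_seg N a). slice i b \<in> cylinder (init_seg n (slice i a))"
      by (auto simp: in_cylinder_init_seg slice_def)
    then show ?thesis ..
  qed
  have close: "\<exists>b\<in>D. \<forall>i\<in>{i,0}. slice i b \<in> cylinder (init_seg n (slice i a))"
    if *: "\<forall>n. D \<inter> cylinder (init_seg n a) \<noteq> {}" for a i n
  proof -
    obtain N1 N2 where N: "\<forall>b\<in>cylinder (init_seg N1 a). slice i b \<in> cylinder (init_seg n (slice i a))"
       "\<forall>b\<in>cylinder (init_seg N2 a). slice 0 b \<in> cylinder (init_seg n (slice 0 a))"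
      using slice_init_seg by meson
    obtain b where b: "b \<in> D" "b \<in> cylinder (init_seg (max N1 N2) a)" using * by blast
    then have "b \<in> cylinder (init_seg N1 a)" "b \<in> cylinder (init_seg N2 a)" by (auto simp: in_cylinder_init_seg)
    then show ?thesis using N b by blast
  qed
  have "baire_closed D"
    unfolding baire_closed_def
  proof (intro allI impI)
    fix a assume *: "\<forall>n. D \<inter> cylinder (init_seg n a) \<noteq> {}"
    have rC: "slice i a \<in> C i" for i
    proof -
      have "C i \<inter> cylinder (init_seg n (slice i a)) \<noteq> {}" for n
        using close[OF *, of i n] by (auto simp: D_def)
      then show ?thesis using C[of i] by (auto simp: baire_closed_def)
    qed
    moreover have "f i (slice i a) = f 0 (slice 0 a)" for i
    proof
      fix k
      obtain m1 m2 where m: "\<forall>n\<ge>m1. \<forall>b \<in> C i \<inter> cylinder (init_seg n (slice i a)). f i b k = f i (slice i a) k"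
        "\<forall>n\<ge>m2. \<forall>b \<in> C 0 \<inter> cylinder (init_seg n (slice 0 a)). f 0 b k = f 0 (slice 0 a) k"
        using baire_contD[OF f rC] by meson
      obtain b where "b \<in> D" "\<forall>i\<in>{i,0}. slice i b \<in> cylinder (init_seg (max m1 m2) (slice i a))"
        using close[OF *, of i "max m1 m2"] by auto
      then have "f i (slice i b) k = f i (slice i a) k" "f 0 (slice 0 b) k = f 0 (slice 0 a) k"
        "f i (slice i b) = f 0 (slice 0 b)"
        using m(1)[rule_format, of "max m1 m2" "slice i b"] m(2)[rule_format, of "max m1 m2" "slice 0 b"]
        by (simp_all add: D_def)
      then show "f i (slice i a) k = f 0 (slice 0 a) k" by simp
    qed
    ultimately show "a \<in> D" by (auto simp: D_def)
  qed
  moreover have "baire_cont D (\<lambda>a. f 0 (slice 0 a))"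
    unfolding baire_cont_def
  proof (intro ballI allI)
    fix a k assume a: "a \<in> D"
    then have "slice 0 a \<in> C 0" by (auto simp: D_def)
    from baire_contD[OF f this] obtain m where
      m: "\<forall>n\<ge>m. \<forall>b \<in> C 0 \<inter> cylinder (init_seg n (slice 0 a)). f 0 b k = f 0 (slice 0 a) k" by blast
    obtain N where "\<forall>b\<in>cylinder (init_seg N a). slice 0 b \<in> cylinder (init_seg m (slice 0 a))" using slice_init_seg by meson
    then show "\<exists>m. \<forall>b\<in>D \<inter> cylinder (init_seg m a). f 0 (slice 0 b) k = f 0 (slice 0 a) k"
      using m by (intro exI[of _ N]) (auto simp: D_def)
  qed
  moreover have "inj_on (\<lambda>a. f 0 (slice 0 a)) D"
  proof (rule inj_onI)
    fix a b assume "a \<in> D" "b \<in> D" "f 0 (slice 0 a) = f 0 (slice 0 b)"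
    then have "slice i a = slice i b" for i
      using inj[of i] unfolding D_def inj_on_def by (metis (mono_tags, lifting) mem_Collect_eq)
    then have "a (prod_encode (i, n)) = b (prod_encode (i, n))" for i n
      unfolding slice_def by metis
    then show "a = b" by (metis ext prod_decode_inverse surj_pair)
  qed
  moreover have "(\<Inter>i. A i) = (\<lambda>a. f 0 (slice 0 a)) ` D"
  proof
    show "(\<lambda>a. f 0 (slice 0 a)) ` D \<subseteq> (\<Inter>i. A i)"
      unfolding D_def A by (auto) (metis image_eqI)
    show "(\<Inter>i. A i) \<subseteq> (\<lambda>a. f 0 (slice 0 a)) ` D"
    proof
      fix x assume "x \<in> (\<Inter>i. A i)"
      then have "\<forall>i. \<exists>c. c \<in> C i \<and> x = f i c" unfolding A by auto
      then obtain c where c: "\<And>i. c i \<in> C i" "\<And>i. x = f i (c i)" by metis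
      define a where "a = (\<lambda>n. case_prod c (prod_decode n))"
      have "slice i a = c i" for i unfolding a_def by (rule slice_unslice)
      then show "x \<in> (\<lambda>a. f 0 (slice 0 a)) ` D"
        using c by (intro image_eqI[of _ _ a]) (auto simp: D_def)
    qed
  qed
  ultimately show ?thesis unfolding inj_analytic_def by blast
qed

lemma inj_analytic_disjoint_UN:
  assumes "\<And>i::nat. inj_analytic (A i)" and disj: "disjoint_family A"
  shows "inj_analytic (\<Union>i. A i)"
proof -
  from assms obtain C f where C: "\<And>i. baire_closed (C i)" and f: "\<And>i. baire_cont (C i) (f i)"
    and inj: "\<And>i. inj_on (f i) (C i)" and A: "\<And>i. A i = f i ` C i"
    unfolding inj_analytic_def by metis
  define tl where "tl = (\<lambda>(a::nat\<Rightarrow>nat) n. a (Suc n))"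
  define D where "D = {a. tl a \<in> C (a 0)}"
  define g where "g = (\<lambda>a. f (a 0) (tl a))"
  have tl_init_seg: "a \<in> cylinder (init_seg (Suc n) b) \<longleftrightarrow> a 0 = b 0 \<and> tl a \<in> cylinder (init_seg n (tl b))" for a b n
    by (auto simp: in_cylinder_init_seg tl_def less_Suc_eq_0_disj)
  have "baire_closed D"
    unfolding baire_closed_def
  proof (intro allI impI)
    fix a assume *: "\<forall>n. D \<inter> cylinder (init_seg n a) \<noteq> {}"
    have "C (a 0) \<inter> cylinder (init_seg n (tl a)) \<noteq> {}" for n
      using *[rule_format, of "Suc n"] by (auto simp: tl_init_seg D_def)
    then show "a \<in> D" using C[of "a 0"] by (auto simp: baire_closed_def D_def)
  qed
  moreover have "baire_cont D g"
    unfolding baire_cont_def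
  proof (intro ballI allI)
    fix a k assume a: "a \<in> D"
    then have "tl a \<in> C (a 0)" by (auto simp: D_def)
    from baire_contD[OF f this] obtain m where
      m: "\<forall>n\<ge>m. \<forall>b \<in> C (a 0) \<inter> cylinder (init_seg n (tl a)). f (a 0) b k = f (a 0) (tl a) k" by blast
    then show "\<exists>m. \<forall>b\<in>D \<inter> cylinder (init_seg m a). g b k = g a k"
      by (intro exI[of _ "Suc m"]) (auto simp: tl_init_seg D_def g_def)
  qed
  moreover have "inj_on g D"
  proof (rule inj_onI)
    fix a b assume ab: "a \<in> D" "b \<in> D" "g a = g b"
    have *: "g c \<in> A (c 0)" if "c \<in> D" for c using that unfolding A g_def D_def by simp
    have 0: "a 0 = b 0" using disj ab(3) *[OF ab(1)] *[OF ab(2)] unfolding disjoint_family_on_def by (metis UNIV_I disjoint_iff)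
    then have "tl a = tl b" using ab inj[of "a 0"] by (auto simp: D_def g_def inj_on_def)
    then have "a (Suc n) = b (Suc n)" for n unfolding tl_def by metis
    with 0 show "a = b" by (metis ext not0_implies_Suc)
  qed
  moreover have "(\<Union>i. A i) = g ` D"
  proof
    show "g ` D \<subseteq> (\<Union>i. A i)" by (auto simp: A g_def D_def)
    show "(\<Union>i. A i) \<subseteq> g ` D"
    proof
      fix x assume "x \<in> (\<Union>i. A i)"
      then obtain i c where c: "c \<in> C i" "x = f i c" by (auto simp: A)
      have "tl (case_nat i c) = c" by (auto simp: tl_def)
      then show "x \<in> g ` D" using c by (intro image_eqI[of _ _ "case_nat i c"]) (auto simp: D_def g_def)
    qed
  qed
  ultimately show ?thesis unfolding inj_analytic_def by blast
qed

lemma inj_analytic_UNIV: "inj_analytic UNIV"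
  by (rule inj_analytic_baire_closed) (auto simp: baire_closed_def)

lemma sets_baire_inj_analytic:
  assumes "A \<in> sets baire"
  shows "inj_analytic A"
proof -
  have "A \<in> sigma_sets UNIV {{a. a n = k} | n k. True}"
  proof -
    have "sets baire \<subseteq> sigma_sets UNIV {{a. a n = k} | n k. True}"
    proof -
      define S where "S = sigma UNIV {{a::nat\<Rightarrow>nat. a n = k} | n k. True}"
      have sS: "sets S = sigma_sets UNIV {{a. a n = k} | n k. True}" "space S = UNIV"
        by (auto simp: S_def)
      have "(\<lambda>x. x) \<in> S \<rightarrow>\<^sub>M baire"
        unfolding measurable_baire_iff sS by auto
      from measurable_sets[OF this] show ?thesis using sS by auto
    qed
    then show ?thesis using assms by auto
  qed
  then have "inj_analytic A \<and> inj_analytic (-A)"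
  proof induction
    case (Basic a)
    then obtain n k where a: "a = {a. a n = k}" by auto
    have "baire_closed a" "baire_closed (-a)" unfolding a baire_closed_def
      by (intro allI impI; drule spec[of _ "Suc n"]; auto simp: in_cylinder_init_seg)+
    then show ?case by (auto intro: inj_analytic_baire_closed)
  next
    case Empty
    have "inj_analytic {}" by (rule inj_analytic_baire_closed) (auto simp: baire_closed_def)
    then show ?case using inj_analytic_UNIV by simp
  next
    case (Compl a) then show ?case by (auto simp: Compl_eq_Diff_UNIV[symmetric])
  next
    case (Union A)
    have 1: "inj_analytic (- (\<Union>i. A i))"
      using inj_analytic_Inter[of "\<lambda>i. - A i"] Union by (simp add: Compl_UN)
    have "inj_analytic (disjointed A i)" for i
    proof -
      have "disjointed A i = (\<Inter>m. if m < i then - A m else A i)"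
      proof (intro set_eqI iffI)
        fix x assume x: "x \<in> (\<Inter>m. if m < i then - A m else A i)"
        have "x \<in> A i" using INT_D[OF x, of i] by simp
        moreover have "x \<notin> A m" if "m < i" for m using INT_D[OF x, of m] that by simp
        ultimately show "x \<in> disjointed A i" by (auto simp: disjointed_def)
      qed (auto simp: disjointed_def)
      also have "inj_analytic \<dots>" by (rule inj_analytic_Inter) (use Union in auto)
      finally show ?thesis .
    qed
    from inj_analytic_disjoint_UN[OF this disjoint_family_disjointed]
    have "inj_analytic (\<Union>i. A i)" by (simp add: UN_disjointed_eq)
    with 1 show ?case by simp
  qed
  then show ?thesis ..
qed


lemma graph_param:
  assumes E: "E \<in> sets baire" and s: "s \<in> baire \<rightarrow>\<^sub>M baire"
  obtains C p where "baire_closed C" "baire_cont C p" "baire_cont C (\<lambda>a. s (p a))" "inj_on p C" "p ` C = E"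
proof -
  have "{a \<in> space baire. even_part a \<in> E \<and> odd_part a = s (even_part a)} \<in> sets baire"
  proof -
    note E [measurable] s [measurable]
    have [measurable]: "Measurable.pred baire (\<lambda>a. odd_part a = s (even_part a))"
      by (rule pred_baire_eq) measurable
    show ?thesis by measurable
  qed
  then have "inj_analytic {a. even_part a \<in> E \<and> odd_part a = s (even_part a)}" by (auto intro: sets_baire_inj_analytic)
  then obtain C F where C: "baire_closed C" "baire_cont C F" "inj_on F C"
    and F: "{a. even_part a \<in> E \<and> odd_part a = s (even_part a)} = F ` C"
    unfolding inj_analytic_def by auto
  have F': "even_part (F a) \<in> E" "odd_part (F a) = s (even_part (F a))" if "a \<in> C" for a
    using F that by auto
  have "baire_cont C (\<lambda>a. even_part (F a))" "baire_cont C (\<lambda>a. odd_part (F a))"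
    using C(2) by (auto simp: baire_cont_def even_part_def odd_part_def)
  then have "baire_cont C (\<lambda>a. s (even_part (F a)))" using F' by (simp add: baire_cont_def)
  moreover have "inj_on (\<lambda>a. even_part (F a)) C"
  proof (rule inj_onI)
    fix a b assume "a \<in> C" "b \<in> C" "even_part (F a) = even_part (F b)"
    then have "F a = F b" using F' interleave_even_part_odd_part[of "F a"] interleave_even_part_odd_part[of "F b"] by simp
    then show "a = b" using C(3) \<open>a \<in> C\<close> \<open>b \<in> C\<close> by (auto dest: inj_onD)
  qed
  moreover have "(\<lambda>a. even_part (F a)) ` C = E"
  proof
    show "E \<subseteq> (\<lambda>a. even_part (F a)) ` C"
    proof
      fix x assume "x \<in> E"
      then have "interleave x (s x) \<in> F ` C" unfolding F[symmetric] by simp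
      then show "x \<in> (\<lambda>a. even_part (F a)) ` C" by (metis even_part_interleave image_iff)
    qed
  qed (use F' in auto)
  ultimately show ?thesis using that C(1) \<open>baire_cont C (\<lambda>a. even_part (F a))\<close> by blast
qed

definition analytic :: "(nat \<Rightarrow> nat) set \<Rightarrow> bool" where
  "analytic A \<longleftrightarrow> (\<exists>E\<in>sets baire. \<exists>f \<in> baire \<rightarrow>\<^sub>M baire. A = f ` E)"

lemma analyticI: "E \<in> sets baire \<Longrightarrow> f \<in> baire \<rightarrow>\<^sub>M baire \<Longrightarrow> analytic (f ` E)"
  unfolding analytic_def by blast

lemma analytic_image: "analytic A \<Longrightarrow> f \<in> baire \<rightarrow>\<^sub>M baire \<Longrightarrow> analytic (f ` A)"
  unfolding analytic_def by (auto simp: image_image intro!: bexI[of _ "\<lambda>x. f (g x)" for g] measurable_compose[of _ baire baire f])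

lemma analytic_vimage:
  assumes "analytic A" and q [measurable]: "q \<in> baire \<rightarrow>\<^sub>M baire"
  shows "analytic (q -` A)"
proof -
  obtain E f where [measurable]: "E \<in> sets baire" "f \<in> baire \<rightarrow>\<^sub>M baire" and A: "A = f ` E"
    using assms(1) unfolding analytic_def by blast
  have [measurable]: "Measurable.pred baire (\<lambda>a. f (odd_part a) = q (even_part a))"
    by (rule pred_baire_eq) measurable
  have "{a \<in> space baire. odd_part a \<in> E \<and> f (odd_part a) = q (even_part a)} \<in> sets baire" by measurable
  from analyticI[OF this measurable_even_part]
  have "analytic (even_part ` {a \<in> space baire. odd_part a \<in> E \<and> f (odd_part a) = q (even_part a)})" .
  also have "even_part ` {a \<in> space baire. odd_part a \<in> E \<and> f (odd_part a) = q (even_part a)} = q -` A"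
  proof (intro set_eqI iffI)
    fix x assume "x \<in> q -` A"
    then obtain e where "e \<in> E" "q x = f e" by (auto simp: A)
    then show "x \<in> even_part ` {a \<in> space baire. odd_part a \<in> E \<and> f (odd_part a) = q (even_part a)}"
      by (intro image_eqI[of _ _ "interleave x e"]) auto
  qed (auto simp: A intro: rev_image_eqI)
  finally show ?thesis .
qed

lemma analytic_Inter:
  assumes "\<And>i::nat. analytic (A i)"
  shows "analytic (\<Inter>i. A i)"
proof -
  obtain E f where [measurable]: "\<And>i. E i \<in> sets baire" "\<And>i. f i \<in> baire \<rightarrow>\<^sub>M baire"
    and A: "\<And>i. A i = f i ` E i"
    using assms unfolding analytic_def by metis
  have [measurable]: "Measurable.pred baire (\<lambda>a. f i (slice i a) = f 0 (slice 0 a))" for i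
    by (rule pred_baire_eq) measurable
  have "{a \<in> space baire. \<forall>i. slice i a \<in> E i \<and> f i (slice i a) = f 0 (slice 0 a)} \<in> sets baire" (is "?D \<in> _")
    by measurable
  from analyticI[OF this, of "\<lambda>a. f 0 (slice 0 a)"]
  have "analytic ((\<lambda>a. f 0 (slice 0 a)) ` ?D)" by measurable
  also have "(\<lambda>a. f 0 (slice 0 a)) ` ?D = (\<Inter>i. A i)"
  proof
    show "(\<lambda>a. f 0 (slice 0 a)) ` ?D \<subseteq> (\<Inter>i. A i)"
      unfolding A by auto (metis image_eqI)
    show "(\<Inter>i. A i) \<subseteq> (\<lambda>a. f 0 (slice 0 a)) ` ?D"
    proof
      fix x assume "x \<in> (\<Inter>i. A i)"
      then have "\<forall>i. \<exists>c. c \<in> E i \<and> x = f i c" unfolding A by auto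
      then obtain c where c: "\<And>i. c i \<in> E i" "\<And>i. x = f i (c i)" by metis
      define a where "a = (\<lambda>n. case_prod c (prod_decode n))"
      have "slice i a = c i" for i unfolding a_def by (rule slice_unslice)
      then show "x \<in> (\<lambda>a. f 0 (slice 0 a)) ` ?D"
        using c by (intro image_eqI[of _ _ a]) (auto)
    qed
  qed
  finally show ?thesis .
qed

lemma analytic_sets: "E \<in> sets baire \<Longrightarrow> analytic E"
  using analyticI[of E "\<lambda>x. x"] by simp

lemma analytic_Int: "analytic A \<Longrightarrow> analytic B \<Longrightarrow> analytic (A \<inter> B)"
proof -
  assume "analytic A" "analytic B"
  then have "analytic (\<Inter>i. if i = (0::nat) then A else B)" by (intro analytic_Inter) auto
  also have "(\<Inter>i. if i = (0::nat) then A else B) = A \<inter> B"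
    by (auto split: if_splits)
  finally show ?thesis .
qed

lemma analytic_param:
  assumes "analytic A"
  obtains C f where "baire_closed C" "baire_cont C f" "f ` C = A"
proof -
  obtain E f where "E \<in> sets baire" "f \<in> baire \<rightarrow>\<^sub>M baire" and A: "A = f ` E"
    using assms unfolding analytic_def by blast
  from graph_param[OF this(1,2)] obtain C p where
    "baire_closed C" "baire_cont C (\<lambda>a. f (p a))" "p ` C = E" by metis
  then show ?thesis using that[of C "\<lambda>a. f (p a)"] A by auto
qed

definition borel_sep :: "(nat \<Rightarrow> nat) set \<Rightarrow> (nat \<Rightarrow> nat) set \<Rightarrow> bool" where
  "borel_sep A B \<longleftrightarrow> (\<exists>S\<in>sets baire. A \<subseteq> S \<and> S \<inter> B = {})"

lemma borel_sep_UN: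
  assumes "\<And>(i::nat) (j::nat). borel_sep (A i) (B j)"
  shows "borel_sep (\<Union>i. A i) (\<Union>j. B j)"
proof -
  obtain S where S: "\<And>i j. S i j \<in> sets baire" "\<And>i j. A i \<subseteq> S i j" "\<And>i j. S i j \<inter> B j = {}"
    using assms unfolding borel_sep_def by metis
  have "(\<Union>i. \<Inter>j. S i j) \<in> sets baire"
    using S(1) by (intro sets.countable_UN' sets.countable_INT' countableI_type) auto
  moreover have "(\<Union>i. A i) \<subseteq> (\<Union>i. \<Inter>j. S i j)" using S(2) by blast
  moreover have "(\<Union>i. \<Inter>j. S i j) \<inter> (\<Union>j. B j) = {}" using S(3) by blast
  ultimately show ?thesis unfolding borel_sep_def by blast
qed

theorem lusin_separation:
  assumes "analytic A" "analytic B" "A \<inter> B = {}"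
  shows "borel_sep A B"
proof (rule ccontr)
  assume nsep: "\<not> borel_sep A B"
  obtain C f where C: "baire_closed C" "baire_cont C f" and A: "f ` C = A" using analytic_param[OF assms(1)] .
  obtain D g where D: "baire_closed D" "baire_cont D g" and B: "g ` D = B" using analytic_param[OF assms(2)] .
  define N where "N = (\<lambda>(s, t). \<not> borel_sep (f ` (C \<inter> cylinder s)) (g ` (D \<inter> cylinder t)))"
  have step: "\<exists>j k. N (s @ [j], t @ [k])" if "N (s, t)" for s t
  proof (rule ccontr)
    assume "\<not> ?thesis"
    then have "borel_sep (\<Union>j. f ` (C \<inter> cylinder (s @ [j]))) (\<Union>k. g ` (D \<inter> cylinder (t @ [k])))"
      by (intro borel_sep_UN) (auto simp: N_def)
    moreover have "(\<Union>j. f ` (C \<inter> cylinder (s @ [j]))) = f ` (C \<inter> cylinder s)"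
      "(\<Union>k. g ` (D \<inter> cylinder (t @ [k]))) = g ` (D \<inter> cylinder t)"
      using cylinder_split by blast+
    ultimately show False using that by (simp add: N_def)
  qed
  have "\<exists>P. \<forall>n. (N (P n) \<and> length (fst (P n)) = n \<and> length (snd (P n)) = n) \<and>
     (\<exists>j k. P (Suc n) = (fst (P n) @ [j], snd (P n) @ [k]))"
  proof (rule dependent_nat_choice)
    show "\<exists>x. N x \<and> length (fst x) = 0 \<and> length (snd x) = 0"
      using nsep by (intro exI[of _ "([], [])"]) (auto simp: N_def A B)
  next
    fix x n assume *: "N x \<and> length (fst x) = n \<and> length (snd x) = n"
    then have "N (fst x, snd x)" by simp
    from step[OF this] obtain j k where "N (fst x @ [j], snd x @ [k])" by blast
    then show "\<exists>y. (N y \<and> length (fst y) = Suc n \<and> length (snd y) = Suc n) \<and>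
        (\<exists>j k. y = (fst x @ [j], snd x @ [k]))"
      using * by (intro exI[of _ "(fst x @ [j], snd x @ [k])"]) auto
  qed
  then obtain P where P: "\<And>n. N (P n)" "\<And>n. length (fst (P n)) = n" "\<And>n. length (snd (P n)) = n"
    "\<And>n. \<exists>j k. P (Suc n) = (fst (P n) @ [j], snd (P n) @ [k])" by blast
  have ne: "C \<inter> cylinder (fst (P n)) \<noteq> {} \<and> D \<inter> cylinder (snd (P n)) \<noteq> {}" for n
  proof -
    have "borel_sep {} X" "borel_sep X {}" for X
      unfolding borel_sep_def by (use sets.top[of baire] in \<open>force intro: bexI[of _ "{}"]\<close>)+
    then show ?thesis using P(1)[of n] by (auto simp: N_def split: prod.splits)
  qed
  obtain a where a: "a \<in> C" "\<And>n. a \<in> cylinder (fst (P n))"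
  proof (rule baire_closed_ex_branch[OF C(1), of "\<lambda>n. fst (P n)"])
    show "\<exists>k. fst (P (Suc n)) = fst (P n) @ k" for n using P(4)[of n] by auto
  qed (use ne P(2,3) in auto)
  obtain b where b: "b \<in> D" "\<And>n. b \<in> cylinder (snd (P n))"
  proof (rule baire_closed_ex_branch[OF D(1), of "\<lambda>n. snd (P n)"])
    show "\<exists>k. snd (P (Suc n)) = snd (P n) @ k" for n using P(4)[of n] by auto
  qed (use ne P(2,3) in auto)
  have "f a \<noteq> g b" using a b A B assms(3) by blast
  then obtain k where k: "f a k \<noteq> g b k" by blast
  obtain m1 where m1: "\<forall>n\<ge>m1. \<forall>x \<in> C \<inter> cylinder (init_seg n a). f x k = f a k" using baire_contD[OF C(2) a(1)] by blast
  obtain m2 where m2: "\<forall>n\<ge>m2. \<forall>x \<in> D \<inter> cylinder (init_seg n b). g x k = g b k" using baire_contD[OF D(2) b(1)] by blast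
  define n where "n = max m1 m2"
  have init_seg: "init_seg n a = fst (P n)" "init_seg n b = snd (P n)"
    using a(2)[of n] b(2)[of n] P(2,3)[of n] by (simp_all add: in_cylinder_iff_init_seg)
  have "borel_sep (f ` (C \<inter> cylinder (fst (P n)))) (g ` (D \<inter> cylinder (snd (P n))))"
    unfolding borel_sep_def
  proof (intro bexI conjI)
    have "{x \<in> space baire. x k = f a k} \<in> sets baire" by measurable
    then show "{x. x k = f a k} \<in> sets baire" by simp
    show "f ` (C \<inter> cylinder (fst (P n))) \<subseteq> {x. x k = f a k}"
      using m1[rule_format, of n] unfolding init_seg[symmetric] by (auto simp: n_def)
    show "{x. x k = f a k} \<inter> g ` (D \<inter> cylinder (snd (P n))) = {}"
      using m2[rule_format, of n] k unfolding init_seg[symmetric] by (auto simp: n_def)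
  qed
  then show False using P(1)[of n] by (auto simp: N_def split: prod.splits)
qed

lemma UNIV_sets_baire [simp]: "UNIV \<in> sets baire"
  using sets.top[of baire] by simp

text \<open>The first separation gives a Borel \<open>B0\<close> in which no point collides with one of \<open>S\<close>, the second
  removes the collisions within \<open>B0\<close>.\<close>

lemma analytic_section_extend:
  assumes S: "analytic S" and s [measurable]: "s \<in> baire \<rightarrow>\<^sub>M baire" and inj: "inj_on s S"
  obtains B where "B \<in> sets baire" "S \<subseteq> B" "inj_on s B"
proof -
  define P where "P = (\<lambda>T. {g. \<exists>h\<in>T. s h = s g \<and> h \<noteq> g})"
  have anaP: "analytic (P T)" if "analytic T" for T
  proof -
    have [measurable]: "Measurable.pred baire (\<lambda>a. s (odd_part a) = s (even_part a))"
      "Measurable.pred baire (\<lambda>a. odd_part a = even_part a)"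
      by (rule pred_baire_eq; measurable)+
    have "{a \<in> space baire. s (odd_part a) = s (even_part a) \<and> \<not> (odd_part a = even_part a)} \<in> sets baire" (is "?D \<in> _")
      by measurable
    then have "analytic (even_part ` (odd_part -` T \<inter> ?D))"
      by (intro analytic_image analytic_Int analytic_vimage that analytic_sets measurable_odd_part measurable_even_part)
    also have "even_part ` (odd_part -` T \<inter> ?D) = P T"
    proof (intro set_eqI iffI)
      fix g assume "g \<in> P T"
      then obtain h where "h \<in> T" "s h = s g" "h \<noteq> g" by (auto simp: P_def)
      then show "g \<in> even_part ` (odd_part -` T \<inter> ?D)"
        by (intro image_eqI[of _ _ "interleave g h"]) auto
    qed (auto simp: P_def)
    finally show ?thesis .
  qed
  have "S \<inter> P S = {}" using inj by (auto simp: P_def inj_on_def)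
  then obtain B0 where B0: "B0 \<in> sets baire" "S \<subseteq> B0" "B0 \<inter> P S = {}"
    using lusin_separation[OF S anaP[OF S]] unfolding borel_sep_def by auto
  have "S \<inter> P B0 = {}"
  proof (rule ccontr)
    assume "S \<inter> P B0 \<noteq> {}"
    then obtain x h where "x \<in> S" "h \<in> B0" "s h = s x" "h \<noteq> x" by (auto simp: P_def)
    then have "h \<in> B0 \<inter> P S" unfolding P_def by (auto intro!: bexI[of _ x])
    then show False using B0(3) by simp
  qed
  then obtain B1 where B1: "B1 \<in> sets baire" "S \<subseteq> B1" "B1 \<inter> P B0 = {}"
    using lusin_separation[OF S anaP[OF analytic_sets[OF B0(1)]]] unfolding borel_sep_def by auto
  have "inj_on s (B0 \<inter> B1)" using B1(3) by (auto simp: P_def inj_on_def)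
  then show ?thesis using that[of "B0 \<inter> B1"] B0 B1 by auto
qed

lemma measurable_baire_cont:
  assumes C: "baire_closed C" "baire_cont C p"
  shows "(\<lambda>a. if a \<in> C then p a else (\<lambda>_. 0)) \<in> baire \<rightarrow>\<^sub>M baire"
  unfolding measurable_baire_iff
proof (intro allI)
  fix n k
  have 1: "{x \<in> C. p x n = k} \<in> sets baire"
  proof -
    have "{x \<in> C. p x n = k} = C \<inter> (\<Union>t\<in>{t. \<forall>x\<in>C \<inter> cylinder t. p x n = k}. cylinder t)"
    proof (intro set_eqI iffI)
      fix x assume x: "x \<in> {x \<in> C. p x n = k}"
      then obtain m where "\<forall>b \<in> C \<inter> cylinder (init_seg m x). p b n = p x n"
        using C(2) unfolding baire_cont_def by blast
      then show "x \<in> C \<inter> (\<Union>t\<in>{t. \<forall>x\<in>C \<inter> cylinder t. p x n = k}. cylinder t)"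
        using x by (intro IntI UN_I[of "init_seg m x"]) auto
    qed auto
    also have "\<dots> \<in> sets baire"
      by (intro sets.Int baire_closed_sets[OF C(1)] sets.countable_UN'') auto
    finally show ?thesis .
  qed
  have "{x \<in> space baire. (if x \<in> C then p x else (\<lambda>_. 0)) n = k} = {x \<in> C. p x n = k} \<union> (if k = 0 then - C else {})"
    by auto
  also have "\<dots> \<in> sets baire"
    using 1 baire_closed_sets[OF C(1)] sets.compl_sets[of C baire] by (auto simp: Compl_eq_Diff_UNIV)
  finally show "{x \<in> space baire. (if x \<in> C then p x else (\<lambda>_. 0)) n = k} \<in> sets baire" .
qed

theorem lusin_souslin_baire:
  assumes E: "E \<in> sets baire" and s: "s \<in> baire \<rightarrow>\<^sub>M baire" and inj: "inj_on s E"
  shows "s ` E \<in> sets baire"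
proof -
  obtain C p where C: "baire_closed C" "baire_cont C p" "baire_cont C (\<lambda>a. s (p a))" "inj_on p C" "p ` C = E"
    using graph_param[OF E s] .
  define q where "q = (\<lambda>a. s (p a))"
  have q: "baire_cont C q" "inj_on q C" "q ` C = s ` E"
    using C inj by (auto simp: q_def inj_on_def image_image[symmetric])
  define A where "A = (\<lambda>t. q ` (C \<inter> cylinder t))"
  have anaA: "analytic (A t)" for t
  proof -
    have Ct: "baire_closed (C \<inter> cylinder t)" by (rule baire_closed_Int_cylinder[OF C(1)])
    define p' where "p' = (\<lambda>a. if a \<in> C then p a else (\<lambda>_. 0))"
    have "p' \<in> baire \<rightarrow>\<^sub>M baire" unfolding p'_def by (rule measurable_baire_cont[OF C(1,2)])
    moreover have "A t = (\<lambda>a. s (p' a)) ` (C \<inter> cylinder t)"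
      by (auto simp: A_def q_def p'_def)
    ultimately show ?thesis
      using baire_closed_sets[OF Ct] s by (auto intro!: analyticI measurable_compose[of p' baire baire s])
  qed
  have disj: "A t \<inter> A u = {}" if "length t = length u" "t \<noteq> u" for t u
  proof -
    have "cylinder t \<inter> cylinder u = {}" using that by (auto simp: in_cylinder_iff_init_seg)
    then show ?thesis using q(2) by (auto simp: A_def inj_on_def)
  qed
  have "\<forall>t u. \<exists>S. length t = length u \<and> t \<noteq> u \<longrightarrow> S \<in> sets baire \<and> A t \<subseteq> S \<and> S \<inter> A u = {}"
  proof (intro allI)
    fix t u
    show "\<exists>S. length t = length u \<and> t \<noteq> u \<longrightarrow> S \<in> sets baire \<and> A t \<subseteq> S \<and> S \<inter> A u = {}"
    proof (cases "length t = length u \<and> t \<noteq> u")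
      case True
      with lusin_separation[OF anaA anaA disj, of t u] show ?thesis
        unfolding borel_sep_def by blast
    qed blast
  qed
  then obtain S where S: "\<And>t u. length t = length u \<Longrightarrow> t \<noteq> u \<Longrightarrow>
     S t u \<in> sets baire \<and> A t \<subseteq> S t u \<and> S t u \<inter> A u = {}" by metis
  define B where "B = (\<lambda>t. \<Inter>u. if length t = length u \<and> t \<noteq> u then S t u - S u t else UNIV)"
  have Bsets: "B t \<in> sets baire" for t
    unfolding B_def by (intro sets.countable_INT'') (use S sets.top[of baire] in auto)
  have AB: "A t \<subseteq> B t" for t
    unfolding B_def
  proof (intro subsetI INT_I)
    fix x u assume "x \<in> A t"
    then show "x \<in> (if length t = length u \<and> t \<noteq> u then S t u - S u t else UNIV)"
      using S[of t u] S[of u t] by auto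
  qed
  have Bdisj: "t = u" if "x \<in> B t" "x \<in> B u" "length t = length u" for t u x
  proof (rule ccontr)
    assume "t \<noteq> u"
    then have "x \<in> S t u - S u t" "x \<in> S u t - S t u"
      using INT_D[OF that(1)[unfolded B_def], of u] INT_D[OF that(2)[unfolded B_def], of t] that(3) by auto
    then show False by simp
  qed
  define cl where "cl = (\<lambda>t. \<Inter>m. \<Union>u\<in>{u. length u = m \<and> A t \<inter> cylinder u \<noteq> {}}. cylinder u)"
  have clsets: "cl t \<in> sets baire" for t
    unfolding cl_def by (intro sets.countable_INT'' sets.countable_UN'') auto
  have cl: "y \<in> cl t \<longleftrightarrow> (\<forall>m. A t \<inter> cylinder (init_seg m y) \<noteq> {})" for y t
    unfolding cl_def by (auto simp: in_cylinder_iff_init_seg)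
  define D where "D = (\<lambda>t. \<Inter>k\<in>{..length t}. B (take k t) \<inter> cl (take k t))"
  have Dsets: "D t \<in> sets baire" for t
    unfolding D_def using Bsets clsets by (intro sets.countable_INT'') auto
  have "q ` C = (\<Inter>n. \<Union>t\<in>{t. length t = n}. D t)"
  proof (intro set_eqI iffI)
    fix y assume "y \<in> q ` C"
    then obtain a where a: "a \<in> C" "y = q a" by auto
    have "y \<in> A (init_seg n a)" for n using a by (auto simp: A_def)
    moreover have "A t \<subseteq> cl t" for t unfolding subset_iff cl using in_cylinder_init_seg_self by blast
    moreover have "take k (init_seg n a) = init_seg k a" if "k \<le> n" for k n
      using that by (simp add: init_seg_def take_map)
    ultimately have "y \<in> D (init_seg n a)" for n
      using AB unfolding D_def by (auto simp: subset_iff)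
    then show "y \<in> (\<Inter>n. \<Union>t\<in>{t. length t = n}. D t)"
      by (intro INT_I UN_I[of "init_seg n a" for n]) auto
  next
    fix y assume "y \<in> (\<Inter>n. \<Union>t\<in>{t. length t = n}. D t)"
    then have "\<forall>n. \<exists>t. length t = n \<and> y \<in> D t" by auto
    then obtain T where T: "\<And>n. length (T n) = n" "\<And>n. y \<in> D (T n)" by metis
    have T': "y \<in> B (take k (T n))" "y \<in> cl (take k (T n))" if "k \<le> n" for k n
      using T(2)[of n] T(1)[of n] that by (auto simp: D_def)
    have TB: "y \<in> B (T n)" "y \<in> cl (T n)" for n using T'[of n n] T(1)[of n] by auto
    have tk: "take n (T (Suc n)) = T n" for n
      by (rule Bdisj[of y]) (use TB(1)[of n] T'(1)[of n "Suc n"] T(1) in auto)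
    have ext: "\<exists>k. T (Suc n) = T n @ k" for n
      using tk[of n] by (metis append_take_drop_id)
    have ne: "C \<inter> cylinder (T n) \<noteq> {}" for n
      using TB(2)[of n] unfolding cl by (auto simp: A_def)
    obtain a where a: "a \<in> C" "\<And>n. a \<in> cylinder (T n)"
      by (rule baire_closed_ex_branch[OF C(1), of T]) (use ne ext T(1) in auto)
    have init_seg: "init_seg n a = T n" for n using a(2)[of n] T(1)[of n] by (simp add: in_cylinder_iff_init_seg)
    have "y k = q a k" for k
    proof -
      obtain m where m: "\<forall>n\<ge>m. \<forall>b \<in> C \<inter> cylinder (init_seg n a). q b k = q a k"
        using baire_contD[OF q(1) a(1)] by blast
      have "A (T m) \<inter> cylinder (init_seg (Suc k) y) \<noteq> {}" using TB(2)[of m] by (simp add: cl)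
      then obtain b where b: "b \<in> C \<inter> cylinder (T m)" "q b \<in> cylinder (init_seg (Suc k) y)" by (auto simp: A_def)
      have "q b k = q a k" using m b(1) init_seg[of m] by auto
      moreover have "q b k = y k" using b(2) by (auto simp: in_cylinder_init_seg)
      ultimately show ?thesis by simp
    qed
    then show "y \<in> q ` C" using a(1) by blast
  qed
  also have "\<dots> \<in> sets baire" by (intro sets.countable_INT'' sets.countable_UN'') (use Dsets in auto)
  finally show ?thesis using q(3) by simp
qed

definition small :: "((nat \<Rightarrow> nat) \<Rightarrow> (nat \<Rightarrow> nat)) \<Rightarrow> (nat \<Rightarrow> nat) set \<Rightarrow> bool" where
  "small s A \<longleftrightarrow> (\<exists>B::nat \<Rightarrow> _. (\<forall>n. B n \<in> sets baire \<and> inj_on s (B n)) \<and> A = (\<Union>n. B n))"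

lemma small_single: "B \<in> sets baire \<Longrightarrow> inj_on s B \<Longrightarrow> small s B"
  unfolding small_def by (rule exI[of _ "\<lambda>_. B"]) auto

lemma small_UN:
  fixes A :: "'i::countable \<Rightarrow> _"
  assumes "\<And>i. small s (A i)"
  shows "small s (\<Union>i. A i)"
proof -
  obtain B :: "'i \<Rightarrow> nat \<Rightarrow> _" where B: "\<And>i n. B i n \<in> sets baire" "\<And>i n. inj_on s (B i n)" "\<And>i. A i = (\<Union>n. B i n)"
    using assms unfolding small_def by metis
  define B' where "B' = (\<lambda>k. case from_nat k of (i, n) \<Rightarrow> B i n)"
  have "(\<Union>i. A i) = (\<Union>k. B' k)"
  proof (intro set_eqI iffI)
    fix x assume "x \<in> (\<Union>i. A i)"
    then obtain i n where "x \<in> B i n" using B(3) by auto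
    then show "x \<in> (\<Union>k. B' k)" by (auto simp: B'_def intro!: exI[of _ "to_nat (i, n)"])
  next
    fix x assume "x \<in> (\<Union>k. B' k)"
    then obtain k where "x \<in> B' k" by blast
    then show "x \<in> (\<Union>i. A i)" unfolding B'_def B(3) by (cases "from_nat k :: 'i \<times> nat") auto
  qed
  then show ?thesis unfolding small_def
    by (intro exI[of _ B']) (auto simp: B'_def B(1,2) split: prod.splits)
qed

lemma small_Un:
  assumes "small s A" "small s B" shows "small s (A \<union> B)"
proof -
  have "small s (\<Union>i. if i then A else B)" by (rule small_UN) (use assms in auto)
  also have "(\<Union>i. if i then A else B) = A \<union> B" by (auto split: if_splits)
  finally show ?thesis .
qed

lemma small_sets: "small s A \<Longrightarrow> A \<in> sets baire"
  unfolding small_def by auto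

lemma small_empty: "small s {}" by (rule small_single) auto

lemma analytic_INT_list: "(\<And>x. x \<in> set L \<Longrightarrow> analytic (A x)) \<Longrightarrow> analytic (\<Inter>x\<in>set L. A x)"
proof (induction L)
  case Nil then show ?case using analytic_sets[OF UNIV_sets_baire] by simp
next
  case (Cons x L)
  then show ?case by (simp add: analytic_Int)
qed

text \<open>Failing the conclusion, finite families of cylinders that are jointly large, that is, have
  points in a common fibre off any given small set, can be split repeatedly. The resulting
  Cantor scheme produces uncountably many points in one fibre.\<close>

theorem lusin_novikov_baire:
  assumes E: "E \<in> sets baire" and s: "s \<in> baire \<rightarrow>\<^sub>M baire"
    and countable: "\<And>x. countable {g \<in> E. s g = x}"
  shows "\<exists>A. small s A \<and> E \<subseteq> A"
proof (rule ccontr)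
  assume contra: "\<not> ?thesis"
  obtain C p where C: "baire_closed C" "baire_cont C p" "baire_cont C (\<lambda>a. s (p a))" "inj_on p C" "p ` C = E"
    using graph_param[OF E s] .
  define q where "q = (\<lambda>a. s (p a))"
  define Large where "Large = (\<lambda>K. \<forall>A. small s A \<longrightarrow>
     (\<exists>x. \<forall>\<sigma>\<in>set K. \<exists>a\<in>C \<inter> cylinder \<sigma>. p a \<notin> A \<and> q a = x))"
  define ext where "ext = (\<lambda>\<sigma> \<tau>::nat list. \<exists>k. k \<noteq> [] \<and> \<tau> = \<sigma> @ k)"
  define sepp where "sepp = (\<lambda>\<tau> \<tau>'. \<forall>a\<in>C \<inter> cylinder \<tau>. \<forall>b\<in>C \<inter> cylinder \<tau>'. p a \<noteq> p b)"
  have Large_cong: "Large K'" if "Large K" "set K = set K'" for K K'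
    using that unfolding Large_def by simp
  have Large_Nil: "Large [[]]"
    unfolding Large_def
  proof (intro allI impI)
    fix A assume "small s A"
    then obtain g where "g \<in> E" "g \<notin> A" using contra by blast
    then show "\<exists>x. \<forall>\<sigma>\<in>set [[]]. \<exists>a\<in>C \<inter> cylinder \<sigma>. p a \<notin> A \<and> q a = x"
      using C(5) by auto
  qed
  define p' where "p' = (\<lambda>a. if a \<in> C then p a else (\<lambda>_. 0))"
  have p' [measurable]: "p' \<in> baire \<rightarrow>\<^sub>M baire" unfolding p'_def by (rule measurable_baire_cont[OF C(1,2)])
  have q' [measurable]: "(\<lambda>a. s (p' a)) \<in> baire \<rightarrow>\<^sub>M baire" by (rule measurable_compose[OF p' s])
  have split: "\<exists>\<tau> \<tau>'. ext \<sigma> \<tau> \<and> ext \<sigma> \<tau>' \<and> sepp \<tau> \<tau>' \<and> Large (\<tau> # \<tau>' # K)"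
    if L: "Large (\<sigma> # K)" for \<sigma> K
  proof (rule ccontr)
    assume no: "\<not> ?thesis"
    define bad where "bad = (\<lambda>A \<tau> \<tau>'. small s A \<and>
       \<not> (\<exists>x. \<forall>\<rho>\<in>set (\<tau> # \<tau>' # K). \<exists>a\<in>C \<inter> cylinder \<rho>. p a \<notin> A \<and> q a = x))"
    have "\<exists>A. small s A \<and> (ext \<sigma> \<tau> \<and> ext \<sigma> \<tau>' \<and> sepp \<tau> \<tau>' \<longrightarrow> bad A \<tau> \<tau>')" for \<tau> \<tau>'
      using no small_empty unfolding Large_def bad_def by blast
    then obtain U where U: "\<And>\<tau> \<tau>'. small s (U \<tau> \<tau>')"
      "\<And>\<tau> \<tau>'. ext \<sigma> \<tau> \<Longrightarrow> ext \<sigma> \<tau>' \<Longrightarrow> sepp \<tau> \<tau>' \<Longrightarrow> bad (U \<tau> \<tau>') \<tau> \<tau>'" by metis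
    define V where "V = (\<Union>\<tau>. \<Union>\<tau>'. U \<tau> \<tau>')"
    have V: "small s V" unfolding V_def by (intro small_UN U)
    note small_sets[OF V, measurable] baire_closed_sets[OF C(1), measurable]
    define F where "F = (\<lambda>\<rho>. {a \<in> space baire. a \<in> C \<and> a \<in> cylinder \<rho> \<and> p' a \<notin> V})"
    have F [measurable]: "F \<rho> \<in> sets baire" for \<rho> unfolding F_def by measurable
    define Z where "Z = (\<Inter>\<rho>\<in>set (\<sigma> # K). (\<lambda>a. s (p' a)) ` F \<rho>)"
    have "analytic Z" unfolding Z_def by (intro analytic_INT_list analyticI F q')
    define S where "S = p' ` (F \<sigma> \<inter> (\<lambda>a. s (p' a)) -` Z)"
    have "analytic S" unfolding S_def
      by (intro analytic_image analytic_Int analytic_sets F analytic_vimage \<open>analytic Z\<close> q' p')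
    have memS: "p a \<in> S" if "a \<in> C" "a \<in> cylinder \<sigma>" "p a \<notin> V" "q a \<in> Z" for a
      using that unfolding S_def F_def q_def by (intro image_eqI[of _ _ a]) (auto simp: p'_def)
    have memZ: "x \<in> Z \<longleftrightarrow> (\<forall>\<rho>\<in>set (\<sigma> # K). \<exists>a\<in>C \<inter> cylinder \<rho>. p a \<notin> V \<and> q a = x)" for x
    proof -
      have "x \<in> (\<lambda>a. s (p' a)) ` F \<rho> \<longleftrightarrow> (\<exists>a\<in>C \<inter> cylinder \<rho>. p a \<notin> V \<and> q a = x)" for \<rho>
        unfolding F_def q_def image_iff p'_def by (auto cong: rev_conj_cong)
      then show ?thesis unfolding Z_def by blast
    qed
    have "inj_on s S"
    proof (rule inj_onI)
      fix u v assume "u \<in> S" "v \<in> S" and suv: "s u = s v"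
      then obtain a b where a: "a \<in> C" "a \<in> cylinder \<sigma>" "p a \<notin> V" "q a \<in> Z" "u = p a"
        and b: "b \<in> C" "b \<in> cylinder \<sigma>" "p b \<notin> V" "v = p b"
        by (auto simp: S_def F_def q_def p'_def split: if_splits)
      show "u = v"
      proof (rule ccontr)
        assume "u \<noteq> v"
        then obtain k where k: "p a k \<noteq> p b k" using a b by blast
        obtain m1 where m1: "\<forall>n\<ge>m1. \<forall>x \<in> C \<inter> cylinder (init_seg n a). p x k = p a k" using baire_contD[OF C(2) a(1)] by blast
        obtain m2 where m2: "\<forall>n\<ge>m2. \<forall>x \<in> C \<inter> cylinder (init_seg n b). p x k = p b k" using baire_contD[OF C(2) b(1)] by blast
        define n where "n = max (max m1 m2) (Suc (length \<sigma>))"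
        have ext_init_seg: "ext \<sigma> (init_seg n c)" if "c \<in> cylinder \<sigma>" for c
        proof -
          have "\<sigma> = take (length \<sigma>) (init_seg n c)"
            using that by (auto simp: in_cylinder_iff_init_seg init_seg_def take_map n_def min_def)
          moreover have "drop (length \<sigma>) (init_seg n c) \<noteq> []" by (simp add: n_def)
          ultimately show ?thesis unfolding ext_def by (metis append_take_drop_id)
        qed
        have "sepp (init_seg n a) (init_seg n b)"
          unfolding sepp_def
        proof (intro ballI notI)
          fix x y assume "x \<in> C \<inter> cylinder (init_seg n a)" "y \<in> C \<inter> cylinder (init_seg n b)" "p x = p y"
          then show False using m1[rule_format, of n x] m2[rule_format, of n y] k
              max.cobounded1[of m1 m2] max.cobounded2[of m2 m1] by (auto simp: n_def le_max_iff_disj)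
        qed
        then have "bad (U (init_seg n a) (init_seg n b)) (init_seg n a) (init_seg n b)"
          by (intro U ext_init_seg a b)
        have "U (init_seg n a) (init_seg n b) \<subseteq> V" unfolding V_def by blast
        have "\<forall>\<rho>\<in>set K. \<exists>c\<in>C \<inter> cylinder \<rho>. p c \<notin> V \<and> q c = q a"
          using a(4) unfolding memZ by simp
        have "a \<in> C \<inter> cylinder (init_seg n a)" "b \<in> C \<inter> cylinder (init_seg n b)" using a b by auto
        have "q b = q a" using suv a b by (simp add: q_def)
        have all: "\<forall>\<rho>\<in>set (init_seg n a # init_seg n b # K). \<exists>c\<in>C \<inter> cylinder \<rho>. p c \<notin> U (init_seg n a) (init_seg n b) \<and> q c = q a"
        proof -
          have "p a \<notin> U (init_seg n a) (init_seg n b)" "p b \<notin> U (init_seg n a) (init_seg n b)"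
            using a(3) b(3) \<open>U (init_seg n a) (init_seg n b) \<subseteq> V\<close> by blast+
          moreover have "\<exists>c\<in>C \<inter> cylinder \<rho>. p c \<notin> U (init_seg n a) (init_seg n b) \<and> q c = q a" if "\<rho> \<in> set K" for \<rho>
            using \<open>\<forall>\<rho>\<in>set K. \<exists>c\<in>C \<inter> cylinder \<rho>. p c \<notin> V \<and> q c = q a\<close> that
              \<open>U (init_seg n a) (init_seg n b) \<subseteq> V\<close> by blast
          ultimately show ?thesis
            using \<open>a \<in> C \<inter> cylinder (init_seg n a)\<close> \<open>b \<in> C \<inter> cylinder (init_seg n b)\<close> \<open>q b = q a\<close>
            by (simp only: list.set ball_simps) blast
        qed
        from all show False
          using \<open>bad (U (init_seg n a) (init_seg n b)) (init_seg n a) (init_seg n b)\<close> unfolding bad_def by blast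
      qed
    qed
    from analytic_section_extend[OF \<open>analytic S\<close> s this] obtain B where
      B: "B \<in> sets baire" "S \<subseteq> B" "inj_on s B" .
    have "small s (V \<union> B)" by (intro small_Un V small_single B)
    with L obtain x where x: "\<forall>\<rho>\<in>set (\<sigma> # K). \<exists>a\<in>C \<inter> cylinder \<rho>. p a \<notin> V \<union> B \<and> q a = x"
      unfolding Large_def by blast
    then have "x \<in> Z" unfolding memZ by blast
    obtain a where "a \<in> C \<inter> cylinder \<sigma>" "p a \<notin> V \<union> B" "q a = x" using x by auto
    with memS[of a] \<open>x \<in> Z\<close> B(2) show False by auto
  qed
  have multi: "\<exists>K1 K2. list_all2 ext K K1 \<and> list_all2 ext K K2 \<and> list_all2 sepp K1 K2 \<and> Large (K1 @ K2 @ R)"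
    if "Large (K @ R)" for K R
    using that
  proof (induction K arbitrary: R)
    case Nil then show ?case by simp
  next
    case (Cons \<sigma> K)
    from split[of \<sigma> "K @ R"] Cons.prems obtain \<tau> \<tau>' where
      t: "ext \<sigma> \<tau>" "ext \<sigma> \<tau>'" "sepp \<tau> \<tau>'" "Large (\<tau> # \<tau>' # K @ R)" by auto
    have "Large (K @ (\<tau> # \<tau>' # R))" by (rule Large_cong[OF t(4)]) auto
    from Cons.IH[OF this] obtain K1 K2 where
      K: "list_all2 ext K K1" "list_all2 ext K K2" "list_all2 sepp K1 K2" "Large (K1 @ K2 @ \<tau> # \<tau>' # R)" by blast
    have "Large ((\<tau> # K1) @ (\<tau>' # K2) @ R)" by (rule Large_cong[OF K(4)]) auto
    then show ?case using t K by (intro exI[of _ "\<tau> # K1"] exI[of _ "\<tau>' # K2"]) auto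
  qed
  have "\<exists>K. \<forall>n. (Large (K n) \<and> length (K n) = 2 ^ n) \<and>
     (\<exists>K1 K2. K (Suc n) = K1 @ K2 \<and> list_all2 ext (K n) K1 \<and> list_all2 ext (K n) K2 \<and> list_all2 sepp K1 K2)"
  proof (rule dependent_nat_choice)
    show "\<exists>x. Large x \<and> length x = 2 ^ 0" using Large_Nil by (intro exI[of _ "[[]]"]) auto
  next
    fix x n assume x: "Large x \<and> length x = 2 ^ n"
    then obtain K1 K2 where
      K: "list_all2 ext x K1" "list_all2 ext x K2" "list_all2 sepp K1 K2" "Large (K1 @ K2)"
      using multi[of x "[]"] by auto
    then show "\<exists>y. (Large y \<and> length y = 2 ^ Suc n) \<and>
       (\<exists>K1 K2. y = K1 @ K2 \<and> list_all2 ext x K1 \<and> list_all2 ext x K2 \<and> list_all2 sepp K1 K2)"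
      using x list_all2_lengthD[OF K(1)] list_all2_lengthD[OF K(2)]
      by (intro exI[of _ "K1 @ K2"] conjI exI[of _ K1] exI[of _ K2]) auto
  qed
  then obtain K where K: "\<And>n. Large (K n)" "\<And>n. length (K n) = 2 ^ n"
    "\<And>n. \<exists>K1 K2. K (Suc n) = K1 @ K2 \<and> list_all2 ext (K n) K1 \<and> list_all2 ext (K n) K2 \<and> list_all2 sepp K1 K2"
    by blast
  define idx where "idx = (\<lambda>(\<alpha>::nat \<Rightarrow> bool) n. \<Sum>j<n. if \<alpha> j then 2 ^ j else (0::nat))"
  have idx_less: "idx \<alpha> n < 2 ^ n" for \<alpha> n
    unfolding idx_def by (induction n) auto
  define T where "T = (\<lambda>\<alpha> n. K n ! idx \<alpha> n)"
  have T_step: "\<exists>K1 K2. list_all2 ext (K n) K1 \<and> list_all2 ext (K n) K2 \<and> list_all2 sepp K1 K2 \<and>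
      (\<forall>\<alpha>. T \<alpha> (Suc n) = (if \<alpha> n then K2 else K1) ! idx \<alpha> n)" for n
  proof -
    obtain K1 K2 where k: "K (Suc n) = K1 @ K2" "list_all2 ext (K n) K1" "list_all2 ext (K n) K2" "list_all2 sepp K1 K2"
      using K(3) by blast
    then have "length K1 = 2 ^ n" "length K2 = 2 ^ n" using K(2)[of n] by (auto dest!: list_all2_lengthD)
    then have "T \<alpha> (Suc n) = (if \<alpha> n then K2 else K1) ! idx \<alpha> n" for \<alpha>
      using idx_less[of \<alpha> n] by (auto simp: T_def k(1) nth_append idx_def)
    with k show ?thesis by blast
  qed
  have T_ext: "ext (T \<alpha> n) (T \<alpha> (Suc n))" for \<alpha> n
  proof -
    obtain K1 K2 where k: "list_all2 ext (K n) K1" "list_all2 ext (K n) K2"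
      "T \<alpha> (Suc n) = (if \<alpha> n then K2 else K1) ! idx \<alpha> n" using T_step[of n] by blast
    then show ?thesis
      using list_all2_nthD[OF k(1), of "idx \<alpha> n"] list_all2_nthD[OF k(2), of "idx \<alpha> n"] idx_less[of \<alpha> n] K(2)[of n]
      by (simp add: T_def)
  qed
  have T_len: "n \<le> length (T \<alpha> n)" for \<alpha> n
  proof (induction n)
    case (Suc n) then show ?case using T_ext[of \<alpha> n] by (cases "T \<alpha> n"; auto simp: ext_def neq_Nil_conv)
  qed simp
  have T_mem: "T \<alpha> n \<in> set (K n)" for \<alpha> n
    unfolding T_def using idx_less K(2) by (intro nth_mem) simp
  have "\<exists>a. a \<in> C \<and> (\<forall>n. a \<in> cylinder (T \<alpha> n))" for \<alpha>
  proof -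
    have ne: "C \<inter> cylinder (T \<alpha> n) \<noteq> {}" for n
      using K(1)[of n, unfolded Large_def, rule_format, OF small_empty] T_mem[of \<alpha> n] by blast
    show ?thesis
    proof (rule baire_closed_ex_branch[OF C(1), of "T \<alpha>"])
      show "\<exists>k. T \<alpha> (Suc n) = T \<alpha> n @ k" for n using T_ext[of \<alpha> n] by (auto simp: ext_def)
    qed (use ne T_len in auto)
  qed
  then obtain br where br: "\<And>\<alpha>. br \<alpha> \<in> C" "\<And>\<alpha> n. br \<alpha> \<in> cylinder (T \<alpha> n)" by metis
  have init_seg_sub: "cylinder (T \<alpha> n) \<subseteq> cylinder (init_seg n (br \<alpha>))" for \<alpha> n
    using br(2)[of \<alpha> n] T_len[of n \<alpha>] by (auto simp: cylinder_def)
  have p_inj: "inj (\<lambda>\<alpha>. p (br \<alpha>))"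
  proof (rule injI, rule ccontr)
    fix \<alpha> \<beta> assume eq: "p (br \<alpha>) = p (br \<beta>)" and ne: "\<alpha> \<noteq> \<beta>"
    define n where "n = (LEAST n. \<alpha> n \<noteq> \<beta> n)"
    have n: "\<alpha> n \<noteq> \<beta> n" unfolding n_def by (rule LeastI_ex) (use ne in blast)
    have "\<alpha> j = \<beta> j" if "j < n" for j using not_less_Least[OF that[unfolded n_def]] by simp
    then have idx: "idx \<alpha> n = idx \<beta> n" unfolding idx_def by (intro sum.cong) auto
    obtain K1 K2 where k: "list_all2 sepp K1 K2" "list_all2 ext (K n) K1"
      "\<forall>\<alpha>. T \<alpha> (Suc n) = (if \<alpha> n then K2 else K1) ! idx \<alpha> n" using T_step by blast
    have "length K1 = 2 ^ n" using k(2) K(2)[of n] by (auto dest!: list_all2_lengthD)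
    then have "sepp (K1 ! idx \<alpha> n) (K2 ! idx \<alpha> n)"
      using idx_less[of \<alpha> n] by (intro list_all2_nthD[OF k(1)]) auto
    then have sp: "p a \<noteq> p b" if "a \<in> C" "b \<in> C" "a \<in> cylinder (K1 ! idx \<alpha> n)" "b \<in> cylinder (K2 ! idx \<alpha> n)" for a b
      using that unfolding sepp_def by blast
    have T: "T \<alpha> (Suc n) = (if \<alpha> n then K2 else K1) ! idx \<alpha> n" "T \<beta> (Suc n) = (if \<beta> n then K2 else K1) ! idx \<alpha> n"
      using k(3) idx by simp_all
    show False
    proof (cases "\<alpha> n")
      case True
      with n T br(2)[of \<alpha> "Suc n"] br(2)[of \<beta> "Suc n"] have "p (br \<beta>) \<noteq> p (br \<alpha>)"
        by (intro sp br(1)) auto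
      with eq show False by simp
    next
      case False
      with n T br(2)[of \<alpha> "Suc n"] br(2)[of \<beta> "Suc n"] have "p (br \<alpha>) \<noteq> p (br \<beta>)"
        by (intro sp br(1)) auto
      with eq show False by simp
    qed
  qed
  have q_eq: "q (br \<alpha>) = q (br \<beta>)" for \<alpha> \<beta>
  proof
    fix k
    have qC: "baire_cont C q" using C(3) by (simp add: q_def)
    obtain m1 where m1: "\<forall>n\<ge>m1. \<forall>x \<in> C \<inter> cylinder (init_seg n (br \<alpha>)). q x k = q (br \<alpha>) k" using baire_contD[OF qC br(1)] by blast
    obtain m2 where m2: "\<forall>n\<ge>m2. \<forall>x \<in> C \<inter> cylinder (init_seg n (br \<beta>)). q x k = q (br \<beta>) k" using baire_contD[OF qC br(1)] by blast
    define n where "n = max m1 m2"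
    obtain x where x: "\<forall>\<sigma>\<in>set (K n). \<exists>a\<in>C \<inter> cylinder \<sigma>. q a = x"
      using K(1)[of n, unfolded Large_def, rule_format, OF small_empty] by blast
    obtain a b where "a \<in> C" "a \<in> cylinder (T \<alpha> n)" "q a = x" "b \<in> C" "b \<in> cylinder (T \<beta> n)" "q b = x"
      using x T_mem[of \<alpha> n] T_mem[of \<beta> n] by blast
    then have "q a k = q (br \<alpha>) k" "q b k = q (br \<beta>) k"
      using m1[rule_format, of n a] m2[rule_format, of n b] init_seg_sub[of \<alpha> n] init_seg_sub[of \<beta> n] unfolding n_def by auto
    then show "q (br \<alpha>) k = q (br \<beta>) k" using \<open>q a = x\<close> \<open>q b = x\<close> by simp
  qed
  have "range (\<lambda>\<alpha>. p (br \<alpha>)) \<subseteq> {g \<in> E. s g = q (br (\<lambda>_. True))}"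
    using q_eq br(1) C(5) unfolding q_def by blast
  then have "countable (range (\<lambda>\<alpha>. p (br \<alpha>)))" using countable countable_subset by blast
  then have cnt: "countable (UNIV :: (nat \<Rightarrow> bool) set)" using p_inj countable_image_inj_on by blast
  define e :: "nat \<Rightarrow> nat \<Rightarrow> bool" where "e = from_nat_into UNIV"
  have "range e = UNIV" unfolding e_def using cnt by (intro range_from_nat_into) auto
  then obtain n where "e n = (\<lambda>n. \<not> e n n)" by (metis surjD)
  then show False by metis
qed


lemma standard_borel_embed:
  assumes "standard_borel M"
  obtains I where "inj_on I (space M)" "I \<in> M \<rightarrow>\<^sub>M baire" "I ` space M \<in> sets baire"
    "\<And>B. B \<in> sets M \<Longrightarrow> \<exists>B'\<in>sets baire. B = I -` B' \<inter> space M"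
proof -
  obtain T where T: "topspace T = space M" "completely_metrizable_space T" "second_countable T"
    "sets M = sigma_sets (space M) {U. openin T U}"
    using assms unfolding standard_borel_def by blast
  obtain X d where "Metric_space X d" and mc: "Metric_space.mcomplete X d"
    and Td: "T = Metric_space.mtopology X d"
    using T(2) unfolding completely_metrizable_space_def by blast
  interpret Metric_space X d by fact
  have X: "X = space M" using T(1) Td by simp
  obtain \<B> where \<B>': "countable \<B> \<and> (\<forall>V\<in>\<B>. openin T V) \<and>
      (\<forall>W x. openin T W \<and> x \<in> W \<longrightarrow> (\<exists>V\<in>\<B>. x \<in> V \<and> V \<subseteq> W))"
    using T(3) unfolding second_countable_def ..
  then have \<B>: "countable \<B>" "\<And>V. V \<in> \<B> \<Longrightarrow> openin T V"
    "\<And>W x. openin T W \<Longrightarrow> x \<in> W \<Longrightarrow> \<exists>V\<in>\<B>. x \<in> V \<and> V \<subseteq> W"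
    by simp_all
  define U where "U = from_nat_into (insert {} \<B>)"
  have rU: "range U = insert {} \<B>" unfolding U_def using \<B>(1) by (intro range_from_nat_into) auto
  have Uopen: "openin T (U k)" for k
  proof -
    have "U k \<in> insert {} \<B>" unfolding rU[symmetric] by simp
    then show ?thesis using \<B>(2) by auto
  qed
  have Ubase: "\<exists>k. x \<in> U k \<and> U k \<subseteq> W" if W: "openin T W" "x \<in> W" for W x
  proof -
    obtain V where V: "V \<in> \<B>" "x \<in> V" "V \<subseteq> W" using \<B>(3)[OF W] by blast
    then have "V \<in> range U" using rU by simp
    then show ?thesis using V by auto
  qed
  have UX: "U k \<subseteq> X" for k using openin_subset[OF Uopen[of k]] T(1) X by simp
  have ball_open: "openin T (mball x e)" for x e by (simp add: Td)
  define I where "I = (\<lambda>g k. if g \<in> U k then 1 else (0::nat))"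
  have inj: "inj_on I (space M)"
  proof (rule inj_onI, rule ccontr)
    fix x y assume xy: "x \<in> space M" "y \<in> space M" "I x = I y" "x \<noteq> y"
    then have pos: "d x y > 0" using mdist_pos_less X by blast
    have "x \<in> X" using xy(1) X by simp
    then have "x \<in> mball x (d x y)" using pos by simp
    then obtain k where k: "x \<in> U k" "U k \<subseteq> mball x (d x y)" using Ubase[OF ball_open] by blast
    have "I x k = 1" using k by (simp add: I_def)
    then have "I y k = 1" using xy(3) by simp
    then have "y \<in> U k" by (simp add: I_def split: if_splits)
    then show False using k by auto
  qed
  have Usets: "U k \<in> sets M" for k using Uopen T(4) by auto
  have meas: "I \<in> M \<rightarrow>\<^sub>M baire"
  proof (rule measurable_baire_I)
    note Usets[measurable]
    show "(\<lambda>x. I x n) \<in> M \<rightarrow>\<^sub>M count_space UNIV" for n unfolding I_def by measurable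
  qed
  have pull: "\<exists>B'\<in>sets baire. B = I -` B' \<inter> space M" if "B \<in> sets M" for B
  proof -
    have "B \<in> sigma_sets (space M) {U. openin T U}" using that T(4) by simp
    then show ?thesis
    proof induction
      case (Basic W)
      define K where "K = {k. U k \<subseteq> W}"
      have "W = (\<Union>k\<in>K. U k)" using Ubase[of W] Basic by (auto simp: K_def)
      moreover have "\<dots> = I -` (\<Union>k\<in>K. {a \<in> space baire. a k = 1}) \<inter> space M"
        using UX X by (auto simp: I_def split: if_splits)
      moreover have "(\<Union>k\<in>K. {a \<in> space baire. a k = 1}) \<in> sets baire"
      proof (rule sets.countable_UN'')
        show "{a \<in> space baire. a k = 1} \<in> sets baire" for k by measurable
      qed auto
      ultimately show ?case by (intro bexI[of _ "\<Union>k\<in>K. {a \<in> space baire. a k = 1}"]) auto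
    next
      case Empty then show ?case by (intro bexI[of _ "{}"]) auto
    next
      case (Compl a)
      then obtain B' where "B' \<in> sets baire" "a = I -` B' \<inter> space M" by auto
      then show ?case by (intro bexI[of _ "space baire - B'"]) auto
    next
      case (Union A)
      then have "\<forall>i. \<exists>B'. B' \<in> sets baire \<and> A i = I -` B' \<inter> space M" by blast
      then obtain B' where "\<And>i. B' i \<in> sets baire" "\<And>i. A i = I -` B' i \<inter> space M" by metis
      then show ?case by (intro bexI[of _ "\<Union>i. B' i"]) auto
    qed
  qed
  define sm where "sm = (\<lambda>k (n::nat). U k \<noteq> {} \<and> (\<forall>x\<in>U k. \<forall>y\<in>U k. d x y < inverse (real (Suc n))))"
  define N where "N = {a \<in> space baire. (\<forall>k. a k = 0 \<or> a k = 1) \<and> (\<forall>n. \<exists>k. sm k n \<and> a k = 1) \<and>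
     (\<forall>k j. a k = 1 \<and> a j = 1 \<longrightarrow> (\<exists>l. (U l \<noteq> {} \<and> T closure_of U l \<subseteq> U k \<inter> U j) \<and> a l = 1)) \<and>
     (\<forall>k j. U k \<subseteq> U j \<longrightarrow> a k = 1 \<longrightarrow> a j = 1)}"
  have "N \<in> sets baire" unfolding N_def by measurable
  moreover have "I ` space M = N"
  proof (intro set_eqI iffI)
    fix a assume "a \<in> I ` space M"
    then obtain g where g: "g \<in> X" "a = I g" using X by auto
    have 1: "a k = 1 \<longleftrightarrow> g \<in> U k" for k by (simp add: g I_def)
    have "\<exists>k. sm k n \<and> a k = 1" for n
    proof -
      define e where "e = inverse (real (Suc n)) / 2"
      have e: "e > 0" by (simp add: e_def)
      obtain k where k: "g \<in> U k" "U k \<subseteq> mball g e"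
        using Ubase[OF ball_open, of g g e] g e by auto
      have "d x y < inverse (real (Suc n))" if "x \<in> U k" "y \<in> U k" for x y
      proof -
        have "d g x < e" "d g y < e" "x \<in> X" "y \<in> X" using k that by auto
        then have "d x y < e + e" using triangle[of x g y] commute[of x g] g by force
        then show ?thesis by (simp add: e_def)
      qed
      then show ?thesis using k 1 by (auto simp: sm_def)
    qed
    moreover have "\<exists>l. (U l \<noteq> {} \<and> T closure_of U l \<subseteq> U k \<inter> U j) \<and> a l = 1" if "a k = 1" "a j = 1" for k j
    proof -
      have "openin T (U k \<inter> U j)" using Uopen by blast
      moreover have "g \<in> U k \<inter> U j" using that 1 by simp
      ultimately obtain e where e: "e > 0" "mball g e \<subseteq> U k \<inter> U j"
        unfolding Td openin_mtopology by blast
      obtain l where l: "g \<in> U l" "U l \<subseteq> mball g (e / 2)"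
        using Ubase[OF ball_open, of g g "e / 2"] g e by auto
      have "T closure_of U l \<subseteq> mcball g (e / 2)"
        unfolding Td using l(2) mball_subset_mcball by (intro closure_of_minimal) auto
      also have "\<dots> \<subseteq> mball g e" using e(1) by (auto simp: mcball_def mball_def)
      finally show ?thesis using l e 1 by blast
    qed
    moreover have "a k = 0 \<or> a k = 1" for k by (simp add: g I_def)
    moreover have "U k \<subseteq> U j \<longrightarrow> a k = 1 \<longrightarrow> a j = 1" for k j using 1 by blast
    ultimately show "a \<in> N" by (simp add: N_def)
  next
    fix a assume "a \<in> N"
    then have a: "\<And>k. a k = 0 \<or> a k = 1" "\<And>n. \<exists>k. sm k n \<and> a k = 1"
      "\<And>k j. a k = 1 \<Longrightarrow> a j = 1 \<Longrightarrow> \<exists>l. (U l \<noteq> {} \<and> T closure_of U l \<subseteq> U k \<inter> U j) \<and> a l = 1"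
      "\<And>k j. U k \<subseteq> U j \<Longrightarrow> a k = 1 \<Longrightarrow> a j = 1" by (auto simp: N_def)
    define \<C> where "\<C> = (\<lambda>k. T closure_of U k) ` {k. a k = 1}"
    have cl_sub: "U k \<subseteq> T closure_of U k" for k
      using closure_of_subset[of "U k" T] UX X T(1) by simp
    have small_cl: "T closure_of U k \<subseteq> mcball x (inverse (real (Suc n)))" if "sm k n" "x \<in> U k" for k n x
      unfolding Td
    proof (rule closure_of_minimal)
      show "U k \<subseteq> mcball x (inverse (real (Suc n)))"
        using that UX[of k] by (force simp: sm_def)
    qed auto
    have arch: "\<exists>n. inverse (real (Suc n)) < e" if "e > 0" for e
      using reals_Archimedean[OF that] .
    have "\<Inter>\<C> \<noteq> {}"
    proof (rule mcomplete_fip[THEN iffD1, OF mc, rule_format])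
      show "(\<forall>C\<in>\<C>. closedin mtopology C) \<and> (\<forall>e>0. \<exists>C a. C \<in> \<C> \<and> C \<subseteq> mcball a e) \<and>
        (\<forall>\<F>. finite \<F> \<and> \<F> \<subseteq> \<C> \<longrightarrow> \<Inter> \<F> \<noteq> {})"
      proof (intro conjI allI impI ballI)
        show "closedin mtopology C" if "C \<in> \<C>" for C using that by (auto simp: \<C>_def Td)
      next
        fix e :: real assume "e > 0"
        then obtain n where n: "inverse (real (Suc n)) < e" using arch by blast
        obtain k where k: "sm k n" "a k = 1" using a(2) by blast
        then obtain x where "x \<in> U k" by (auto simp: sm_def)
        then have "T closure_of U k \<subseteq> mcball x e"
          using small_cl[OF k(1), of x] n mcball_subset_concentric[of "inverse (real (Suc n))" e x] by auto
        then show "\<exists>C x. C \<in> \<C> \<and> C \<subseteq> mcball x e" using k by (auto simp: \<C>_def)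
      next
        fix \<F> assume "finite \<F> \<and> \<F> \<subseteq> \<C>"
        then obtain K where K: "finite K" "K \<subseteq> {k. a k = 1}" "\<F> = (\<lambda>k. T closure_of U k) ` K"
          unfolding \<C>_def by (meson finite_subset_image)
        from K(1,2) have "\<exists>l. a l = 1 \<and> U l \<noteq> {} \<and> (\<forall>k\<in>K. U l \<subseteq> U k)"
        proof (induction K)
          case empty
          then show ?case using a(2)[of 0] by (auto simp: sm_def)
        next
          case (insert k K)
          then obtain l where l: "a l = 1" "\<forall>k\<in>K. U l \<subseteq> U k" by auto
          have "a k = 1" using insert by auto
          from a(3)[OF this l(1)] show ?case using l(2) cl_sub by blast
        qed
        then obtain l x where "x \<in> U l" "\<forall>k\<in>K. U l \<subseteq> U k" by auto
        then have "x \<in> \<Inter>\<F>" using K(3) cl_sub by blast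
        then show "\<Inter>\<F> \<noteq> {}" by blast
      qed
    qed
    then obtain g where g: "\<And>k. a k = 1 \<Longrightarrow> g \<in> T closure_of U k" by (auto simp: \<C>_def)
    have gU: "g \<in> U k" if "a k = 1" for k using a(3)[OF that that] g by blast
    obtain k0 where "a k0 = 1" using a(2) by blast
    then have gX: "g \<in> X" using gU UX by blast
    have Ug: "a k = 1" if gk: "g \<in> U k" for k
    proof -
      obtain e where e: "e > 0" "mball g e \<subseteq> U k"
        using gk Uopen[of k] unfolding Td openin_mtopology by blast
      obtain n where n: "inverse (real (Suc n)) < e" using arch[OF e(1)] by blast
      obtain j where j: "sm j n" "a j = 1" using a(2) by blast
      have "U j \<subseteq> mball g e"
      proof
        fix y assume y: "y \<in> U j"
        then have "d g y < inverse (real (Suc n))" using j gU[OF j(2)] by (simp add: sm_def)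
        then show "y \<in> mball g e" using n y UX gX by auto
      qed
      then show ?thesis using a(4)[of j k] j e by blast
    qed
    have "a = I g"
    proof
      fix k show "a k = I g k" using a(1)[of k] gU[of k] Ug[of k] by (auto simp: I_def)
    qed
    then show "a \<in> I ` space M" using gX X by blast
  qed
  ultimately show ?thesis using that inj meas pull by blast
qed

lemma standard_borel_transport:
  assumes M: "standard_borel M" and f: "f \<in> M \<rightarrow>\<^sub>M M"
  obtains I s where "inj_on I (space M)" "I \<in> M \<rightarrow>\<^sub>M baire" "\<And>E. E \<in> sets M \<Longrightarrow> I ` E \<in> sets baire"
    "s \<in> baire \<rightarrow>\<^sub>M baire" "\<And>x. x \<in> space M \<Longrightarrow> s (I x) = I (f x)"
proof -
  obtain I where I: "inj_on I (space M)" "I \<in> M \<rightarrow>\<^sub>M baire" "I ` space M \<in> sets baire"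
    "\<And>B. B \<in> sets M \<Longrightarrow> \<exists>B'\<in>sets baire. B = I -` B' \<inter> space M"
    using standard_borel_embed[OF M] by blast
  have img: "I ` E \<in> sets baire" if E: "E \<in> sets M" for E
  proof -
    obtain B' where B': "B' \<in> sets baire" "E = I -` B' \<inter> space M" using I(4)[OF E] by blast
    then have "I ` E = I ` space M \<inter> B'" by auto
    then show ?thesis using I(3) B'(1) by auto
  qed
  define s where "s = (\<lambda>a. if a \<in> I ` space M then I (f (the_inv_into (space M) I a)) else (\<lambda>_. 0))"
  have "s \<in> baire \<rightarrow>\<^sub>M baire"
    unfolding measurable_baire_iff
  proof (intro allI)
    fix n k
    define B where "B = {x \<in> space M. I (f x) n = k}"
    have "B \<in> sets M"
      using measurable_compose[OF f I(2)] unfolding measurable_baire_iff B_def by blast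
    moreover have "{a \<in> space baire. s a n = k} = I ` B \<union> (if k = 0 then space baire - I ` space M else {})"
      by (auto simp: s_def B_def the_inv_into_f_f[OF I(1)] inj_on_eq_iff[OF I(1)])
    moreover have "space baire - I ` space M \<in> sets baire" using I(3) by (rule sets.compl_sets)
    ultimately show "{a \<in> space baire. s a n = k} \<in> sets baire" using img by auto
  qed
  moreover have "s (I x) = I (f x)" if "x \<in> space M" for x
    using that I(1) by (simp add: s_def the_inv_into_f_f)
  ultimately show ?thesis using that I(1,2) img by blast
qed

theorem lusin_souslin:
  assumes M: "standard_borel M" and f: "f \<in> M \<rightarrow>\<^sub>M M" and E: "E \<in> sets M" and inj: "inj_on f E"
  shows "f ` E \<in> sets M"
proof -
  obtain I s where I: "inj_on I (space M)" "I \<in> M \<rightarrow>\<^sub>M baire" "\<And>E. E \<in> sets M \<Longrightarrow> I ` E \<in> sets baire"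
    "s \<in> baire \<rightarrow>\<^sub>M baire" "\<And>x. x \<in> space M \<Longrightarrow> s (I x) = I (f x)"
    using standard_borel_transport[OF M f] by blast
  have EM: "E \<subseteq> space M" using E by (rule sets.sets_into_space)
  have fE: "f ` E \<subseteq> space M" using EM measurable_space[OF f] by blast
  have "inj_on s (I ` E)"
  proof (rule inj_onI)
    fix u v assume "u \<in> I ` E" "v \<in> I ` E" "s u = s v"
    then obtain x y where xy: "x \<in> E" "y \<in> E" "u = I x" "v = I y" by auto
    moreover have "x \<in> space M" "y \<in> space M" using xy EM by auto
    ultimately have "I (f x) = I (f y)" using I(5)[of x] I(5)[of y] \<open>s u = s v\<close> by simp
    then have "f x = f y" using I(1) fE xy by (auto dest!: inj_onD)
    then show "u = v" using inj xy by (auto dest: inj_onD)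
  qed
  then have "s ` I ` E \<in> sets baire" using I E by (intro lusin_souslin_baire) auto
  moreover have "f ` E = I -` (s ` I ` E) \<inter> space M"
  proof
    show "f ` E \<subseteq> I -` (s ` I ` E) \<inter> space M"
    proof
      fix y assume "y \<in> f ` E"
      then obtain x where x: "x \<in> E" "y = f x" by blast
      then have "I y = s (I x)" using I(5)[of x] EM by auto
      then show "y \<in> I -` (s ` I ` E) \<inter> space M" using x fE by auto
    qed
    show "I -` (s ` I ` E) \<inter> space M \<subseteq> f ` E"
    proof
      fix y assume y: "y \<in> I -` (s ` I ` E) \<inter> space M"
      then obtain x where x: "x \<in> E" "I y = s (I x)" by auto
      then have "I y = I (f x)" using I(5) EM by auto
      then have "y = f x" using I(1) y fE x by (auto dest!: inj_onD)
      then show "y \<in> f ` E" using x by blast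
    qed
  qed
  ultimately show ?thesis using measurable_sets[OF I(2)] by simp
qed

theorem lusin_novikov:
  assumes M: "standard_borel M" and f: "f \<in> M \<rightarrow>\<^sub>M M"
    and countable: "\<And>x. x \<in> space M \<Longrightarrow> countable {g \<in> space M. f g = x}"
  obtains B :: "nat \<Rightarrow> 'a set" where "\<And>n. B n \<in> sets M" "\<And>n. inj_on f (B n)" "space M = (\<Union>n. B n)"
proof -
  obtain I s where I: "inj_on I (space M)" "I \<in> M \<rightarrow>\<^sub>M baire" "\<And>E. E \<in> sets M \<Longrightarrow> I ` E \<in> sets baire"
    "s \<in> baire \<rightarrow>\<^sub>M baire" "\<And>x. x \<in> space M \<Longrightarrow> s (I x) = I (f x)"
    using standard_borel_transport[OF M f] by blast
  have "countable {g \<in> I ` space M. s g = x}" for x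
  proof (cases "\<exists>y\<in>space M. x = I y")
    case True
    then obtain y where y: "y \<in> space M" "x = I y" by blast
    have "{g \<in> I ` space M. s g = x} \<subseteq> I ` {g \<in> space M. f g = y}"
    proof
      fix g assume "g \<in> {g \<in> I ` space M. s g = x}"
      then obtain z where z: "z \<in> space M" "g = I z" "s (I z) = x" by auto
      then have "I (f z) = I y" using I(5) y by simp
      then have "f z = y" using I(1) y(1) measurable_space[OF f z(1)] by (auto dest: inj_onD)
      then show "g \<in> I ` {g \<in> space M. f g = y}" using z by blast
    qed
    then show ?thesis using countable[OF y(1)] by (meson countable_image countable_subset)
  next
    case False
    then have "{g \<in> I ` space M. s g = x} = {}" using I(5) measurable_space[OF f] by auto
    then show ?thesis by (simp only: countable_empty)
  qed
  from lusin_novikov_baire[OF I(3)[OF sets.top] I(4) this]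
  obtain B where B: "\<And>n::nat. B n \<in> sets baire" "\<And>n. inj_on s (B n)" "I ` space M \<subseteq> (\<Union>n. B n)"
    unfolding small_def by metis
  show ?thesis
  proof
    show "I -` B n \<inter> space M \<in> sets M" for n by (rule measurable_sets[OF I(2) B(1)])
    show "inj_on f (I -` B n \<inter> space M)" for n
    proof (rule inj_onI)
      fix x y assume xy: "x \<in> I -` B n \<inter> space M" "y \<in> I -` B n \<inter> space M" "f x = f y"
      then have "s (I x) = s (I y)" using I(5) by auto
      then have "I x = I y" using B(2)[of n] xy by (auto dest: inj_onD)
      then show "x = y" using I(1) xy by (auto dest: inj_onD)
    qed
    show "space M = (\<Union>n. I -` B n \<inter> space M)" using B(3) by (auto simp: image_subset_iff)
  qed
qed

section \<open>Words in a groupoid\<close>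

definition tinv :: "'b \<times> bool \<Rightarrow> 'b \<times> bool" where
  "tinv t = (fst t, \<not> snd t)"

lemma tinv_tinv [simp]: "tinv (tinv t) = t"
  and fst_tinv [simp]: "fst (tinv t) = fst t"
  and snd_tinv [simp]: "snd (tinv t) \<longleftrightarrow> \<not> snd t"
  by (auto simp: tinv_def)

definition freely_reduced :: "('b \<times> bool) list \<Rightarrow> bool" where
  "freely_reduced = successively (\<lambda>s t. t \<noteq> tinv s)"

definition push :: "'b \<times> bool \<Rightarrow> ('b \<times> bool) list \<Rightarrow> ('b \<times> bool) list" where
  "push t w = (case w of [] \<Rightarrow> [t] | u # us \<Rightarrow> if u = tinv t then us else t # w)"

definition reduct :: "('b \<times> bool) list \<Rightarrow> ('b \<times> bool) list" where
  "reduct w = foldr push w []"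

lemma reduct_simps [simp]: "reduct [] = []" "reduct (t # w) = push t (reduct w)"
  by (simp_all add: reduct_def)

lemma freely_reduced_push: "freely_reduced w \<Longrightarrow> freely_reduced (push t w)"
  by (cases w) (auto simp: push_def freely_reduced_def successively_Cons)

lemma freely_reduced_reduct: "freely_reduced (reduct w)"
  by (induction w) (auto simp: freely_reduced_push, simp add: freely_reduced_def)

lemma push_push_tinv: "freely_reduced w \<Longrightarrow> push t (push (tinv t) w) = w"
  by (cases w) (auto simp: push_def freely_reduced_def successively_Cons split: list.splits)

lemma reduct_idem: "freely_reduced w \<Longrightarrow> reduct w = w"
proof (induction w)
  case (Cons t w)
  then show ?case by (cases w) (auto simp: freely_reduced_def push_def)
qed simp

lemma reduct_filter_push:
  assumes P: "\<And>t. P (tinv t) = P t"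
  shows "reduct (filter P (push t w)) = reduct (filter P (t # w))"
proof (cases "\<exists>us. w = tinv t # us")
  case True
  then obtain us where w: "w = tinv t # us" by blast
  then have "push t w = us" by (simp add: push_def)
  moreover have "reduct (filter P (t # w)) = reduct (filter P us)"
    unfolding w using P[of t] push_push_tinv[OF freely_reduced_reduct, of t "filter P us"] by simp
  ultimately show ?thesis by simp
next
  case False
  then show ?thesis by (cases w) (auto simp: push_def)
qed

text \<open>Deleting an inverse-closed set of letters is a homomorphism of free groups.\<close>

lemma reduct_filter:
  assumes P: "\<And>t. P (tinv t) = P t"
  shows "reduct (filter P (reduct w)) = reduct (filter P w)"
  by (induction w) (simp_all add: reduct_filter_push[of P, OF P])

lemma reduct_ne_Nil:
  assumes "\<And>t. P (tinv t) = P t" "freely_reduced (filter P w)" "filter P w \<noteq> []"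
  shows "reduct w \<noteq> []"
  using reduct_filter[of P w] assms reduct_idem[of "filter P w"] by auto

definition winv :: "('b \<times> bool) list \<Rightarrow> ('b \<times> bool) list" where
  "winv w = rev (map tinv w)"

text \<open>A letter \<open>((E, e), b)\<close> is the arrow \<open>e\<close> of the sheet \<open>E\<close>, or its inverse if \<open>b\<close> is false.
  Words act from the right end, as products of arrows do.\<close>

definition tval :: "'a groupoid_data \<Rightarrow> ('b \<times> 'a) \<times> bool \<Rightarrow> 'a" where
  "tval G t = (if snd t then snd (fst t) else inverse_of G (snd (fst t)))"

primrec pval :: "'a groupoid_data \<Rightarrow> 'a \<Rightarrow> (('b \<times> 'a) \<times> bool) list \<Rightarrow> 'a" where
  "pval G x [] = x"
| "pval G x (t # w) = mult G (tval G t) (pval G x w)"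

definition edge :: "'a set set \<Rightarrow> ('a set \<times> 'a) \<times> bool \<Rightarrow> bool" where
  "edge \<E> t \<longleftrightarrow> fst (fst t) \<in> \<E> \<and> snd (fst t) \<in> fst (fst t)"

primrec pok :: "'a groupoid_data \<Rightarrow> 'a set set \<Rightarrow> 'a \<Rightarrow> (('a set \<times> 'a) \<times> bool) list \<Rightarrow> bool" where
  "pok G \<E> x [] \<longleftrightarrow> x \<in> units G"
| "pok G \<E> x (t # w) \<longleftrightarrow> pok G \<E> x w \<and> edge \<E> t \<and> src G (tval G t) = rng G (pval G x w)"

definition token_label :: "('a set \<times> 'a) \<times> bool \<Rightarrow> 'a set \<times> int" where
  "token_label t = (fst (fst t), if snd t then 1 else -1)"

lemma edge_tinv [simp]: "edge \<E> (tinv t) = edge \<E> t"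
  by (simp add: edge_def)

lemma pok_mono: "pok G \<E> x w \<Longrightarrow> \<E> \<subseteq> \<F> \<Longrightarrow> pok G \<F> x w"
  by (induction w) (auto simp: edge_def)

lemma pok_edge: "pok G \<E> x w \<Longrightarrow> t \<in> set w \<Longrightarrow> edge \<E> t"
  by (induction w) auto

context groupoid
begin

abbreviation "A \<equiv> space (arrows G)"

lemma units_A: "x \<in> units G \<Longrightarrow> x \<in> A" using units_subset by blast

lemma mult_unit_left: "g \<in> A \<Longrightarrow> rng G g = x \<Longrightarrow> mult G x g = g"
  using mult_rng by blast
lemma mult_unit_right: "g \<in> A \<Longrightarrow> src G g = x \<Longrightarrow> mult G g x = g"
  using mult_src by blast

lemma mult_A [simp]: "g \<in> A \<Longrightarrow> h \<in> A \<Longrightarrow> src G g = rng G h \<Longrightarrow> mult G g h \<in> A"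
  and src_mult' [simp]: "g \<in> A \<Longrightarrow> h \<in> A \<Longrightarrow> src G g = rng G h \<Longrightarrow> src G (mult G g h) = src G h"
  and rng_mult' [simp]: "g \<in> A \<Longrightarrow> h \<in> A \<Longrightarrow> src G g = rng G h \<Longrightarrow> rng G (mult G g h) = rng G g"
  and assoc': "g \<in> A \<Longrightarrow> h \<in> A \<Longrightarrow> k \<in> A \<Longrightarrow> src G g = rng G h \<Longrightarrow> src G h = rng G k \<Longrightarrow>
      mult G (mult G g h) k = mult G g (mult G h k)"
  using mult_closed[of g h] src_mult[of g h] rng_mult[of g h] mult_assoc[of g h k]
  by (auto simp: composable_def)

declare src_closed [simp] rng_closed [simp] src_unit [simp] rng_unit [simp]
  inverse_closed [simp] src_inverse [simp] rng_inverse [simp] inverse_mult [simp]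
  mult_inverse [simp] mult_src [simp] mult_rng [simp] units_A [simp]

lemma inv_cancel_left [simp]:
  "g \<in> A \<Longrightarrow> h \<in> A \<Longrightarrow> src G g = rng G h \<Longrightarrow> mult G (inverse_of G g) (mult G g h) = h"
  by (simp flip: assoc')

lemma inv_cancel_left' [simp]:
  "g \<in> A \<Longrightarrow> h \<in> A \<Longrightarrow> rng G g = rng G h \<Longrightarrow> mult G g (mult G (inverse_of G g) h) = h"
  by (simp flip: assoc')

lemma inv_cancel_right [simp]:
  "g \<in> A \<Longrightarrow> h \<in> A \<Longrightarrow> src G h = rng G g \<Longrightarrow> mult G (mult G h g) (inverse_of G g) = h"
  by (simp add: assoc' mult_unit_right)

lemma inv_cancel_right' [simp]:
  "g \<in> A \<Longrightarrow> h \<in> A \<Longrightarrow> src G h = src G g \<Longrightarrow> mult G (mult G h (inverse_of G g)) g = h"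
  by (simp add: assoc' mult_unit_right)

lemma inverse_unique:
  assumes "g \<in> A" "h \<in> A" "src G g = rng G h" "mult G g h = rng G g"
  shows "h = inverse_of G g"
proof -
  have "h = mult G (inverse_of G g) (mult G g h)"
    by (rule inv_cancel_left[symmetric]) (use assms in auto)
  also have "\<dots> = inverse_of G g" using assms by (simp add: mult_unit_right)
  finally show ?thesis .
qed

lemma inverse_inverse [simp]: "g \<in> A \<Longrightarrow> inverse_of G (inverse_of G g) = g"
  by (rule inverse_unique[symmetric]) auto

lemma inverse_mult': "g \<in> A \<Longrightarrow> h \<in> A \<Longrightarrow> src G g = rng G h \<Longrightarrow>
    inverse_of G (mult G g h) = mult G (inverse_of G h) (inverse_of G g)"
  by (rule inverse_unique[symmetric]) (auto simp: assoc')

lemma inverse_unit [simp]: "x \<in> units G \<Longrightarrow> inverse_of G x = x"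
  by (rule inverse_unique[symmetric]) (auto simp: mult_unit_left)

end

locale sheets = groupoid G for G :: "'a groupoid_data" +
  fixes \<E> :: "'a set set"
  assumes sheets_A: "\<And>E. E \<in> \<E> \<Longrightarrow> E \<subseteq> A"
begin

lemma edge_A: "edge \<E> t \<Longrightarrow> snd (fst t) \<in> A"
  by (auto simp: edge_def dest!: sheets_A)

lemma tval_A [simp]: "edge \<E> t \<Longrightarrow> tval G t \<in> A"
  using edge_A by (auto simp: tval_def)

lemma tval_tinv [simp]: "edge \<E> t \<Longrightarrow> tval G (tinv t) = inverse_of G (tval G t)"
  using edge_A by (auto simp: tval_def)

lemma pok_simps: "pok G \<E> x w \<Longrightarrow> x \<in> units G \<and> pval G x w \<in> A \<and> src G (pval G x w) = x"
  by (induction w) auto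

lemma pok_x [simp]: "pok G \<E> x w \<Longrightarrow> x \<in> units G"
  and pval_A [simp]: "pok G \<E> x w \<Longrightarrow> pval G x w \<in> A"
  and src_pval [simp]: "pok G \<E> x w \<Longrightarrow> src G (pval G x w) = x"
  using pok_simps by blast+

lemma pok_append: "pok G \<E> x (u @ w) \<longleftrightarrow> pok G \<E> x w \<and> pok G \<E> (rng G (pval G x w)) u"
  and pval_append: "pok G \<E> x (u @ w) \<Longrightarrow>
     pval G x (u @ w) = mult G (pval G (rng G (pval G x w)) u) (pval G x w)"
proof -
  have "(pok G \<E> x (u @ w) \<longleftrightarrow> pok G \<E> x w \<and> pok G \<E> (rng G (pval G x w)) u) \<and>
    (pok G \<E> x (u @ w) \<longrightarrow> pval G x (u @ w) = mult G (pval G (rng G (pval G x w)) u) (pval G x w))"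
  proof (induction u)
    case Nil then show ?case by auto
  next
    case (Cons t u)
    then show ?case
      by (auto simp: assoc')
  qed
  then show "pok G \<E> x (u @ w) \<longleftrightarrow> pok G \<E> x w \<and> pok G \<E> (rng G (pval G x w)) u"
    and "pok G \<E> x (u @ w) \<Longrightarrow>
     pval G x (u @ w) = mult G (pval G (rng G (pval G x w)) u) (pval G x w)" by auto
qed

lemma pok_push:
  assumes "pok G \<E> x (t # w)"
  shows "pok G \<E> x (push t w) \<and> pval G x (push t w) = pval G x (t # w)"
proof (cases "\<exists>us. w = tinv t # us")
  case True
  then obtain us where w: "w = tinv t # us" by blast
  then have *: "edge \<E> t" "pok G \<E> x us" "src G (tval G (tinv t)) = rng G (pval G x us)" using assms by auto
  then have "src G (inverse_of G (tval G t)) = rng G (pval G x us)" by simp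
  then have "rng G (tval G t) = rng G (pval G x us)" using * by simp
  then show ?thesis using * by (simp add: push_def w)
next
  case False
  then show ?thesis using assms by (cases w) (auto simp: push_def)
qed

lemma pok_reduct: "pok G \<E> x w \<Longrightarrow> pok G \<E> x (reduct w) \<and> pval G x (reduct w) = pval G x w"
proof (induction w)
  case (Cons t w)
  then show ?case using pok_push[of x t "reduct w"] by auto
qed simp

lemma pok_winv: "pok G \<E> x w \<Longrightarrow> pok G \<E> (rng G (pval G x w)) (winv w) \<and>
    pval G (rng G (pval G x w)) (winv w) = inverse_of G (pval G x w)"
proof (induction w)
  case Nil then show ?case by (simp add: winv_def)
next
  case (Cons t w)
  then have t: "edge \<E> t" "src G (tval G t) = rng G (pval G x w)" "pok G \<E> x w" by auto
  define y where "y = rng G (tval G t)"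
  have y: "rng G (pval G x (t # w)) = y" using t by (simp add: y_def)
  have yU: "y \<in> units G" using t by (simp add: y_def)
  have 1: "pok G \<E> y [tinv t]" "pval G y [tinv t] = inverse_of G (tval G t)"
    using t yU by (auto simp: y_def mult_unit_right)
  have "winv (t # w) = winv w @ [tinv t]" by (simp add: winv_def)
  moreover have "pok G \<E> y (winv w @ [tinv t])" using t 1 Cons.IH by (simp add: pok_append)
  ultimately show ?case using 1 Cons.IH t y
    by (simp add: pval_append inverse_mult')
qed

lemma word_set_iff:
  "g \<in> word_set G lw \<and> lw \<in> lists (\<E> \<times> {1, -1}) \<longleftrightarrow>
     (\<exists>w. pok G \<E> (src G g) w \<and> pval G (src G g) w = g \<and> map token_label w = lw)"
proof (induction lw arbitrary: g)
  case Nil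
  then show ?case by (auto simp: word_set_def)
next
  case (Cons l lw)
  have ws: "word_set G (l # lw) = set_mult G (set_power G l) (word_set G lw)" by (simp add: word_set_def)
  show ?case
  proof
    assume *: "g \<in> word_set G (l # lw) \<and> l # lw \<in> lists (\<E> \<times> {1, -1})"
    then obtain h k where hk: "g = mult G h k" "h \<in> set_power G l" "k \<in> word_set G lw" "h \<in> A" "k \<in> A" "src G h = rng G k"
      unfolding ws by (auto simp: set_mult_def composable_def)
    have sg: "src G g = src G k" using hk by simp
    from Cons.IH[of k] hk * obtain w where w: "pok G \<E> (src G k) w" "pval G (src G k) w = k" "map token_label w = lw"
      by auto
    obtain E i where l: "l = (E, i)" "E \<in> \<E>" "i = 1 \<or> i = -1" using * by (cases l) auto
    obtain e where e: "e \<in> E" "h = (if i = 1 then e else inverse_of G e)"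
      using hk(2) l by (auto simp: set_power_def split: if_splits)
    define t where "t = ((E, e), i = 1)"
    have "tval G t = h" "edge \<E> t" "token_label t = l" using e l by (auto simp: t_def tval_def edge_def token_label_def)
    then show "\<exists>w. pok G \<E> (src G g) w \<and> pval G (src G g) w = g \<and> map token_label w = l # lw"
      using w hk sg by (intro exI[of _ "t # w"]) auto
  next
    assume "\<exists>w. pok G \<E> (src G g) w \<and> pval G (src G g) w = g \<and> map token_label w = l # lw"
    then obtain t w where w: "pok G \<E> (src G g) (t # w)" "pval G (src G g) (t # w) = g"
      "token_label t = l" "map token_label w = lw" by (auto simp: map_eq_Cons_conv)
    define k where "k = pval G (src G g) w"
    have k: "pok G \<E> (src G g) w" "src G k = src G g" using w by (auto simp: k_def)
    then have "k \<in> word_set G lw \<and> lw \<in> lists (\<E> \<times> {1, -1})"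
      using Cons.IH[of k] w by (auto simp: k_def)
    moreover have "tval G t \<in> set_power G l"
      using w(1,3) by (cases l) (auto simp: token_label_def set_power_def tval_def edge_def)
    moreover have "l \<in> \<E> \<times> {1, -1}" using w(1,3) by (auto simp: token_label_def edge_def)
    moreover have "(tval G t, k) \<in> composable G" "g = mult G (tval G t) k"
      using w k by (auto simp: composable_def k_def)
    ultimately show "g \<in> word_set G (l # lw) \<and> l # lw \<in> lists (\<E> \<times> {1, -1})"
      unfolding ws set_mult_def by auto
  qed
qed

end

lemma successively_conv_nth:
  "successively P xs \<longleftrightarrow> (\<forall>i. Suc i < length xs \<longrightarrow> P (xs ! i) (xs ! Suc i))"
proof (induction P xs rule: successively.induct)
  case (3 P x y xs)
  then show ?case by (auto simp: nth_Cons split: nat.splits)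
qed auto

locale bisheets = sheets +
  assumes sheets_inj: "\<And>E. E \<in> \<E> \<Longrightarrow> inj_on (src G) E \<and> inj_on (rng G) E"
begin

lemma reduced_words_map:
  assumes "pok G \<E> x w" "w \<noteq> []" "freely_reduced w"
  shows "map token_label w \<in> reduced_words \<E>"
proof -
  have "successively (\<lambda>s t. fst s = fst t \<longrightarrow> snd s = snd t) (map token_label w)"
    using assms(1,3)
  proof (induction w)
    case (Cons s w)
    show ?case
    proof (cases w)
      case (Cons t v)
      have s: "edge \<E> s" "edge \<E> t" "src G (tval G s) = rng G (pval G x (t # v))" "t \<noteq> tinv s"
        "pok G \<E> x (t # v)" "freely_reduced w"
        using Cons.prems unfolding Cons by (auto simp: freely_reduced_def)
      have "rng G (pval G x (t # v)) = rng G (tval G t)" using s by simp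
      then have st: "src G (tval G s) = rng G (tval G t)" using s by simp
      have "snd s = snd t" if "fst (fst s) = fst (fst t)"
      proof (rule ccontr)
        assume ne: "snd s \<noteq> snd t"
        have E: "fst (fst s) \<in> \<E>" "snd (fst s) \<in> fst (fst s)" "snd (fst t) \<in> fst (fst s)"
          "snd (fst s) \<in> A" "snd (fst t) \<in> A"
          using s that edge_A by (auto simp: edge_def)
        have "snd (fst s) = snd (fst t)"
          using st ne E sheets_inj[OF E(1)] by (cases "snd s") (auto simp: tval_def dest: inj_onD)
        then have "t = tinv s" using that ne by (auto simp: tinv_def prod_eq_iff)
        then show False using s by simp
      qed
      then show ?thesis using Cons.IH s by (auto simp: Cons token_label_def)
    qed simp
  qed simp
  moreover have "set (map token_label w) \<subseteq> \<E> \<times> {1, -1}"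
    using pok_edge[OF assms(1)] by (auto simp: token_label_def edge_def)
  ultimately show ?thesis
    using assms(2) unfolding reduced_words_def successively_conv_nth by auto
qed

lemma freely_reduced_of_label:
  assumes "map token_label w \<in> reduced_words \<E>"
  shows "freely_reduced w"
  unfolding freely_reduced_def successively_conv_nth
proof (intro allI impI)
  fix i assume i: "Suc i < length w"
  show "w ! Suc i \<noteq> tinv (w ! i)"
  proof
    assume "w ! Suc i = tinv (w ! i)"
    then have "fst (map token_label w ! i) = fst (map token_label w ! Suc i)"
      "snd (map token_label w ! i) \<noteq> snd (map token_label w ! Suc i)"
      using i by (auto simp: token_label_def)
    then show False using assms i unfolding reduced_words_def by auto
  qed
qed

lemma reduced_words_lists: "lw \<in> reduced_words \<E> \<Longrightarrow> lw \<in> lists (\<E> \<times> {1, -1}) \<and> lw \<noteq> []"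
  by (auto simp: reduced_words_def)

lemma unit_in_Wr_iff:
  assumes "x \<in> units G"
  shows "x \<in> \<Union>(Wr G \<E>) \<longleftrightarrow> (\<exists>w. w \<noteq> [] \<and> freely_reduced w \<and> pok G \<E> x w \<and> pval G x w = x)"
proof
  assume "x \<in> \<Union>(Wr G \<E>)"
  then obtain lw where lw: "lw \<in> reduced_words \<E>" "x \<in> word_set G lw" by (auto simp: Wr_def)
  with word_set_iff[of x lw] reduced_words_lists[OF lw(1)] assms obtain w where
    w: "pok G \<E> x w" "pval G x w = x" "map token_label w = lw" by auto
  then show "\<exists>w. w \<noteq> [] \<and> freely_reduced w \<and> pok G \<E> x w \<and> pval G x w = x"
    using freely_reduced_of_label[of w] lw reduced_words_lists[OF lw(1)] by (intro exI[of _ w]) auto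
next
  assume "\<exists>w. w \<noteq> [] \<and> freely_reduced w \<and> pok G \<E> x w \<and> pval G x w = x"
  then obtain w where w: "w \<noteq> []" "freely_reduced w" "pok G \<E> x w" "pval G x w = x" by blast
  from word_set_iff[of x "map token_label w"] w assms have "x \<in> word_set G (map token_label w)" by auto
  then show "x \<in> \<Union>(Wr G \<E>)" using reduced_words_map[OF w(3,1,2)] by (auto simp: Wr_def)
qed

lemma in_Wr_iff:
  assumes g: "g \<in> A"
  shows "g \<in> units G \<union> \<Union>(Wr G \<E>) \<longleftrightarrow> (\<exists>w. pok G \<E> (src G g) w \<and> pval G (src G g) w = g)"
proof
  assume "g \<in> units G \<union> \<Union>(Wr G \<E>)"
  then show "\<exists>w. pok G \<E> (src G g) w \<and> pval G (src G g) w = g"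
  proof
    assume "g \<in> units G" then show ?thesis by (intro exI[of _ "[]"]) auto
  next
    assume "g \<in> \<Union>(Wr G \<E>)"
    then obtain lw where lw: "lw \<in> reduced_words \<E>" "g \<in> word_set G lw" by (auto simp: Wr_def)
    with word_set_iff[of g lw] reduced_words_lists[OF lw(1)] show ?thesis by blast
  qed
next
  assume "\<exists>w. pok G \<E> (src G g) w \<and> pval G (src G g) w = g"
  then obtain w where "pok G \<E> (src G g) w" "pval G (src G g) w = g" by blast
  then have w: "pok G \<E> (src G g) (reduct w)" "pval G (src G g) (reduct w) = g" using pok_reduct by auto
  show "g \<in> units G \<union> \<Union>(Wr G \<E>)"
  proof (cases "reduct w = []")
    case True then show ?thesis using w g by (metis UnI1 pval.simps(1) src_closed)
  next
    case False
    have "g \<in> word_set G (map token_label (reduct w))"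
      using word_set_iff[of g "map token_label (reduct w)"] w by blast
    then show ?thesis using reduced_words_map[OF w(1) False freely_reduced_reduct] by (auto simp: Wr_def)
  qed
qed

end

lemma restrict_simps [simp]:
  "units (groupoid_restrict G Y) = Y" "src (groupoid_restrict G Y) = src G"
  "rng (groupoid_restrict G Y) = rng G" "mult (groupoid_restrict G Y) = mult G"
  "inverse_of (groupoid_restrict G Y) = inverse_of G"
  "space (arrows (groupoid_restrict G Y)) = {g \<in> space (arrows G). src G g \<in> Y \<and> rng G g \<in> Y}"
  by (auto simp: groupoid_restrict_def space_restrict_space)

lemma tval_restrict [simp]: "tval (groupoid_restrict G Y) t = tval G t"
  by (simp add: tval_def)

lemma pval_restrict [simp]: "pval (groupoid_restrict G Y) x w = pval G x w"
  by (induction w) auto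

lemma pok_restrict: "x \<in> Y \<Longrightarrow> Y \<subseteq> units G \<Longrightarrow> pok (groupoid_restrict G Y) \<E> x w = pok G \<E> x w"
  by (induction w) auto

lemma (in groupoid) groupoid_groupoid_restrict:
  assumes Y: "Y \<subseteq> units G"
  shows "groupoid (groupoid_restrict G Y)"
proof -
  show ?thesis
    by unfold_locales (use Y in \<open>auto simp: composable_def assoc' mult_unit_left mult_unit_right subset_iff\<close>)
qed

section \<open>Sheets of a discrete Borel groupoid\<close>

lemma infsum_eq_nn_integral_count_space:
  fixes f :: "'b \<Rightarrow> ennreal"
  assumes "countable A"
  shows "infsum f A = (\<integral>\<^sup>+x. f x \<partial>count_space A)"
proof -
  have S: "infsum f A = (SUP F\<in>{F. finite F \<and> F \<subseteq> A}. sum f F)"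
    by (rule nonneg_infsum_complete) auto
  have fin: "sum f F \<le> (\<integral>\<^sup>+x. f x \<partial>count_space A)" if "finite F" "F \<subseteq> A" for F
  proof -
    have "sum f F = (\<integral>\<^sup>+x. f x * indicator F x \<partial>count_space A)"
      using that by (subst nn_integral_count_space'[of F]) (auto intro!: sum.cong split: split_indicator)
    also have "\<dots> \<le> (\<integral>\<^sup>+x. f x \<partial>count_space A)"
      by (intro nn_integral_mono) (auto split: split_indicator)
    finally show ?thesis .
  qed
  have "(\<integral>\<^sup>+x. f x \<partial>count_space A) \<le> (SUP F\<in>{F. finite F \<and> F \<subseteq> A}. sum f F)"
  proof (cases "finite A")
    case True
    then show ?thesis by (auto simp: nn_integral_count_space_finite intro!: SUP_upper)
  next
    case False
    then have b: "bij_betw (from_nat_into A) UNIV A" using assms by (intro bij_betw_from_nat_into)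
    have "(\<integral>\<^sup>+x. f x \<partial>count_space A) = (\<Sum>n. f (from_nat_into A n))"
      using nn_integral_bij_count_space[OF b, of f] by (simp add: nn_integral_count_space_nat)
    also have "\<dots> = (SUP n. \<Sum>i<n. f (from_nat_into A i))" by (rule suminf_eq_SUP)
    also have "\<dots> \<le> (SUP F\<in>{F. finite F \<and> F \<subseteq> A}. sum f F)"
    proof (rule SUP_least)
      fix n
      have "(\<Sum>i<n. f (from_nat_into A i)) = sum f (from_nat_into A ` {..<n})"
        using b by (subst sum.reindex) (auto simp: bij_betw_def intro: inj_on_subset)
      also have "\<dots> \<le> (SUP F\<in>{F. finite F \<and> F \<subseteq> A}. sum f F)"
        using b by (intro SUP_upper) (auto simp: bij_betw_def)
      finally show "(\<Sum>i<n. f (from_nat_into A i)) \<le> (SUP F\<in>{F. finite F \<and> F \<subseteq> A}. sum f F)" .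
    qed
    finally show ?thesis .
  qed
  then show ?thesis unfolding S by (intro antisym SUP_least) (auto intro: fin)
qed

context discrete_borel_groupoid
begin

lemma src_measurable [measurable]: "src G \<in> arrows G \<rightarrow>\<^sub>M arrows G"
  and rng_measurable [measurable]: "rng G \<in> arrows G \<rightarrow>\<^sub>M arrows G"
  using src_borel rng_borel by (auto simp: measurable_restrict_space2_iff)

lemma one_sheeted_sets: "E \<in> one_sheeted G \<Longrightarrow> E \<in> sets (arrows G)"
  and one_sheeted_src: "E \<in> one_sheeted G \<Longrightarrow> inj_on (src G) E"
  and one_sheeted_rng: "E \<in> one_sheeted G \<Longrightarrow> inj_on (rng G) E"
  and one_sheeted_A: "E \<in> one_sheeted G \<Longrightarrow> E \<subseteq> A"
  by (auto simp: one_sheeted_def dest: sets.sets_into_space)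

lemma one_sheeted_subset:
  "E \<in> one_sheeted G \<Longrightarrow> B \<in> sets (arrows G) \<Longrightarrow> B \<subseteq> E \<Longrightarrow> B \<in> one_sheeted G"
  unfolding one_sheeted_def by (auto intro: inj_on_subset)

lemma one_sheeted_src_vimage:
  "E \<in> one_sheeted G \<Longrightarrow> B \<in> sets (arrows G) \<Longrightarrow> {g \<in> E. src G g \<in> B} \<in> one_sheeted G"
  and one_sheeted_rng_vimage:
  "E \<in> one_sheeted G \<Longrightarrow> B \<in> sets (arrows G) \<Longrightarrow> {g \<in> E. rng G g \<in> B} \<in> one_sheeted G"
proof -
  assume E: "E \<in> one_sheeted G" and B [measurable]: "B \<in> sets (arrows G)"
  note one_sheeted_sets[OF E, measurable]
  have "{g \<in> E. src G g \<in> B} = {g \<in> A. g \<in> E \<and> src G g \<in> B}"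
    "{g \<in> E. rng G g \<in> B} = {g \<in> A. g \<in> E \<and> rng G g \<in> B}"
    using one_sheeted_A[OF E] by auto
  moreover have "{g \<in> A. g \<in> E \<and> src G g \<in> B} \<in> sets (arrows G)"
    "{g \<in> A. g \<in> E \<and> rng G g \<in> B} \<in> sets (arrows G)" by measurable
  ultimately show "{g \<in> E. src G g \<in> B} \<in> one_sheeted G" "{g \<in> E. rng G g \<in> B} \<in> one_sheeted G"
    by (auto intro!: one_sheeted_subset[OF E])
qed

lemma inverse_image_eq: "B \<subseteq> A \<Longrightarrow> inverse_of G ` B = inverse_of G -` B \<inter> A"
  by (auto intro!: rev_image_eqI[where f="inverse_of G"])

lemma inverse_image_sets: "B \<in> sets (arrows G) \<Longrightarrow> inverse_of G ` B \<in> sets (arrows G)"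
  using measurable_sets[OF inverse_borel, of B] inverse_image_eq[of B] sets.sets_into_space[of B "arrows G"]
  by simp

lemma one_sheeted_inverse: "E \<in> one_sheeted G \<Longrightarrow> inverse_of G ` E \<in> one_sheeted G"
  using inverse_image_sets[of E] one_sheeted_A[of E]
  unfolding one_sheeted_def by (auto simp: inj_on_def subset_iff)

lemma set_power_one_sheeted: "E \<in> one_sheeted G \<Longrightarrow> set_power G (E, i) \<in> one_sheeted G"
  by (auto simp: set_power_def one_sheeted_inverse)

lemma src_inverse_image: "E \<subseteq> A \<Longrightarrow> src G ` inverse_of G ` E = rng G ` E"
  by (auto simp: image_image subset_iff cong: image_cong)

lemma sheet_cover:
  obtains S :: "nat \<Rightarrow> 'a set" where "\<And>n. S n \<in> one_sheeted G" "A = (\<Union>n. S n)" "disjoint_family S"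
proof -
  have cnt: "countable {g \<in> A. src G g = x}" "countable {g \<in> A. rng G g = x}" if "x \<in> A" for x
  proof -
    have "countable {g \<in> A. src G g = x} \<and> countable {g \<in> A. rng G g = x}"
    proof (cases "x \<in> units G")
      case False
      then have "{g \<in> A. src G g = x} = {}" "{g \<in> A. rng G g = x} = {}"
        using src_closed rng_closed by blast+
      then show ?thesis by (simp only: countable_empty)
    qed (use countable_src countable_rng in blast)
    then show "countable {g \<in> A. src G g = x}" "countable {g \<in> A. rng G g = x}" by blast+
  qed
  obtain B where B: "\<And>n::nat. B n \<in> sets (arrows G)" "\<And>n. inj_on (src G) (B n)" "A = (\<Union>n. B n)"
    using lusin_novikov[OF standard_borel src_measurable cnt(1)] by blast
  obtain B' where B': "\<And>n::nat. B' n \<in> sets (arrows G)" "\<And>n. inj_on (rng G) (B' n)" "A = (\<Union>n. B' n)"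
    using lusin_novikov[OF standard_borel rng_measurable cnt(2)] by blast
  define S0 where "S0 = (\<lambda>k. case prod_decode k of (n, m) \<Rightarrow> B n \<inter> B' m)"
  have S0: "S0 k \<in> one_sheeted G" for k
    using B(1,2) B'(1,2) unfolding S0_def one_sheeted_def
    by (auto split: prod.splits intro: inj_on_subset[OF B(2)] inj_on_subset[OF B'(2)])
  have UN: "(\<Union>k. S0 k) = A"
  proof
    show "A \<subseteq> (\<Union>k. S0 k)"
    proof
      fix x assume "x \<in> A"
      then obtain n m where "x \<in> B n" "x \<in> B' m" using B(3) B'(3) by blast
      then have "x \<in> S0 (prod_encode (n, m))" by (simp add: S0_def)
      then show "x \<in> (\<Union>k. S0 k)" by blast
    qed
    show "(\<Union>k. S0 k) \<subseteq> A" using S0 one_sheeted_A by blast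
  qed
  show ?thesis
  proof
    show "disjointed S0 n \<in> one_sheeted G" for n
    proof (rule one_sheeted_subset[OF S0])
      have "range (disjointed S0) \<subseteq> sets (arrows G)"
        using S0 one_sheeted_sets by (intro sets.range_disjointed_sets) auto
      then show "disjointed S0 n \<in> sets (arrows G)" by auto
    qed (rule disjointed_subset)
    show "A = (\<Union>n. disjointed S0 n)" by (simp add: UN_disjointed_eq UN)
    show "disjoint_family (disjointed S0)" by (rule disjoint_family_disjointed)
  qed
qed

lemma src_image_sets:
  assumes "B \<in> sets (arrows G)" shows "src G ` B \<in> sets (arrows G)"
proof -
  obtain S :: "nat \<Rightarrow> 'a set" where S: "\<And>n. S n \<in> one_sheeted G" "A = (\<Union>n. S n)"
    using sheet_cover by metis
  have "B = (\<Union>n. S n \<inter> B)" using sets.sets_into_space[OF assms] S(2) by auto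
  then have "src G ` B = (\<Union>n. src G ` (S n \<inter> B))" by (metis image_UN)
  moreover have "src G ` (S n \<inter> B) \<in> sets (arrows G)" for n
    using lusin_souslin[OF standard_borel src_measurable, of "S n \<inter> B"] S(1)[of n] assms
    by (auto simp: one_sheeted_def intro: inj_on_subset)
  ultimately show ?thesis by auto
qed

lemma rng_image_sets: "B \<in> sets (arrows G) \<Longrightarrow> rng G ` B \<in> sets (arrows G)"
  using src_image_sets[OF inverse_image_sets, of B] src_inverse_image[of B] sets.sets_into_space[of B "arrows G"]
  by simp

lemma set_mult_sets:
  assumes E: "E \<in> one_sheeted G" and B: "B \<in> sets (arrows G)"
  shows "set_mult G E B \<in> sets (arrows G)"
proof -
  note EA = one_sheeted_A[OF E] and BA = sets.sets_into_space[OF B]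
  define sec where "sec = the_inv_into E (rng G)"
  have sec: "sec (rng G e) = e" if "e \<in> E" for e
    unfolding sec_def by (rule the_inv_into_f_f[OF one_sheeted_rng[OF E] that])
  define R where "R = {h \<in> A. rng G h \<in> rng G ` E}"
  note rng_image_sets[OF one_sheeted_sets[OF E], measurable]
  have R: "R \<in> sets (arrows G)" unfolding R_def by measurable
  have sec_meas: "sec \<in> restrict_space (arrows G) (rng G ` E) \<rightarrow>\<^sub>M arrows G"
  proof (rule measurableI)
    show "sec x \<in> A" if "x \<in> space (restrict_space (arrows G) (rng G ` E))" for x
      using that sec EA by (auto simp: space_restrict_space)
  next
    fix C assume C: "C \<in> sets (arrows G)"
    have "sec -` C \<inter> space (restrict_space (arrows G) (rng G ` E)) = rng G ` (E \<inter> C)"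
      using EA sec rng_closed units_A by (auto simp: space_restrict_space)
    moreover have "rng G ` (E \<inter> C) \<in> sets (arrows G)"
      using C one_sheeted_sets[OF E] by (intro rng_image_sets) auto
    ultimately show "sec -` C \<inter> space (restrict_space (arrows G) (rng G ` E))
        \<in> sets (restrict_space (arrows G) (rng G ` E))"
      using rng_image_sets[OF one_sheeted_sets[OF E]] by (auto simp: sets_restrict_space_iff)
  qed
  have rngR: "rng G \<in> restrict_space (arrows G) R \<rightarrow>\<^sub>M restrict_space (arrows G) (rng G ` E)"
    by (intro measurable_restrict_space2 measurable_restrict_space1 rng_measurable)
      (auto simp: space_restrict_space R_def)
  have 1: "(\<lambda>h. inverse_of G (sec (rng G h))) \<in> restrict_space (arrows G) R \<rightarrow>\<^sub>M arrows G"
    by (rule measurable_compose[OF measurable_compose[OF rngR sec_meas] inverse_borel])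
  have 2: "(\<lambda>h. (inverse_of G (sec (rng G h)), h)) \<in>
      restrict_space (arrows G) R \<rightarrow>\<^sub>M restrict_space (arrows G \<Otimes>\<^sub>M arrows G) (composable G)"
  proof (rule measurable_restrict_space2)
    show "(\<lambda>h. (inverse_of G (sec (rng G h)), h)) \<in> restrict_space (arrows G) R \<rightarrow>\<^sub>M arrows G \<Otimes>\<^sub>M arrows G"
      by (intro measurable_Pair 1 measurable_restrict_space1 measurable_ident_sets refl)
    show "(\<lambda>h. (inverse_of G (sec (rng G h)), h)) \<in> space (restrict_space (arrows G) R) \<rightarrow> composable G"
      using EA by (auto simp: space_restrict_space R_def composable_def sec subset_iff)
  qed
  from measurable_compose[OF 2 mult_borel]
  have 3: "(\<lambda>h. mult G (inverse_of G (sec (rng G h))) h) \<in> restrict_space (arrows G) R \<rightarrow>\<^sub>M arrows G" by simp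
  have "set_mult G E B = (\<lambda>h. mult G (inverse_of G (sec (rng G h))) h) -` B \<inter> space (restrict_space (arrows G) R)"
    (is "_ = ?P")
  proof
    show "set_mult G E B \<subseteq> ?P"
    proof
      fix h assume "h \<in> set_mult G E B"
      then obtain e b where eb: "e \<in> E" "b \<in> B" "src G e = rng G b" "h = mult G e b"
        by (auto simp: set_mult_def composable_def)
      then have "e \<in> A" "b \<in> A" using EA BA by auto
      then show "h \<in> ?P" using eb sec by (auto simp: space_restrict_space R_def)
    qed
    show "?P \<subseteq> set_mult G E B"
    proof
      fix h assume "h \<in> ?P"
      then obtain e where e: "e \<in> E" "rng G h = rng G e" "h \<in> A" "mult G (inverse_of G e) h \<in> B"
        by (auto simp: space_restrict_space R_def sec)
      have "h = mult G e (mult G (inverse_of G e) h)" using e EA by auto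
      moreover have "(e, mult G (inverse_of G e) h) \<in> composable G" using e EA by (auto simp: composable_def)
      ultimately show "h \<in> set_mult G E B" using e unfolding set_mult_def by blast
    qed
  qed
  also have "\<dots> \<in> sets (arrows G)"
    using measurable_sets[OF 3 B] R by (auto simp: sets_restrict_space_iff)
  finally show ?thesis .
qed

lemma one_sheeted_set_mult:
  assumes E: "E \<in> one_sheeted G" and F: "F \<in> one_sheeted G"
  shows "set_mult G E F \<in> one_sheeted G"
proof -
  have A: "E \<subseteq> A" "F \<subseteq> A" using E F one_sheeted_A by auto
  have 1: "inj_on (src G) (set_mult G E F)"
  proof (rule inj_onI)
    fix x y assume "x \<in> set_mult G E F" "y \<in> set_mult G E F" and eq: "src G x = src G y"
    then obtain e f e' f' where *: "e \<in> E" "f \<in> F" "src G e = rng G f" "x = mult G e f"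
      "e' \<in> E" "f' \<in> F" "src G e' = rng G f'" "y = mult G e' f'"
      by (auto simp: set_mult_def composable_def)
    moreover have "e \<in> A" "f \<in> A" "e' \<in> A" "f' \<in> A" using * A by auto
    ultimately have "src G f = src G f'" using eq by simp
    then have "f = f'" using * inj_onD[OF one_sheeted_src[OF F], of f f'] by simp
    then have "e = e'" using * inj_onD[OF one_sheeted_src[OF E], of e e'] by simp
    then show "x = y" using * \<open>f = f'\<close> by simp
  qed
  have 2: "inj_on (rng G) (set_mult G E F)"
  proof (rule inj_onI)
    fix x y assume "x \<in> set_mult G E F" "y \<in> set_mult G E F" and eq: "rng G x = rng G y"
    then obtain e f e' f' where *: "e \<in> E" "f \<in> F" "src G e = rng G f" "x = mult G e f"
      "e' \<in> E" "f' \<in> F" "src G e' = rng G f'" "y = mult G e' f'"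
      by (auto simp: set_mult_def composable_def)
    moreover have "e \<in> A" "f \<in> A" "e' \<in> A" "f' \<in> A" using * A by auto
    ultimately have "rng G e = rng G e'" using eq by simp
    then have "e = e'" using * inj_onD[OF one_sheeted_rng[OF E], of e e'] by simp
    then have "f = f'" using * inj_onD[OF one_sheeted_rng[OF F], of f f'] by simp
    then show "x = y" using * \<open>e = e'\<close> by simp
  qed
  show ?thesis using set_mult_sets[OF E one_sheeted_sets[OF F]] 1 2 by (simp add: one_sheeted_def)
qed

lemma bisheets_family: "sheet_family G \<E> \<Longrightarrow> bisheets G \<E>"
  by unfold_locales (auto simp: sheet_family_def dest: one_sheeted_A one_sheeted_src one_sheeted_rng)

end

context pmp_discrete_groupoid
begin

lemma sets_mu_iff: "B \<in> sets mu \<longleftrightarrow> B \<in> sets (arrows G) \<and> B \<subseteq> units G"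
  using units_borel sets.sets_into_space[OF units_borel]
  by (auto simp: sets_mu sets_restrict_space_iff)

lemma space_mu [simp]: "space mu = units G"
  using sets_eq_imp_space_eq[OF sets_mu] units_subset by (auto simp: space_restrict_space)

lemma src_image_mu: "B \<in> sets (arrows G) \<Longrightarrow> src G ` B \<in> sets mu"
  using sets.sets_into_space[of B "arrows G"]
  by (auto simp: sets_mu_iff src_image_sets subset_iff)

lemma emeasure_rng_src:
  assumes E: "E \<in> one_sheeted G"
  shows "emeasure mu (rng G ` E) = emeasure mu (src G ` E)"
proof -
  have "sheet_map G E ` src G ` E = rng G ` E"
    using one_sheeted_src[OF E] by (auto simp: sheet_map_def image_image the_inv_into_f_f cong: image_cong)
  then show ?thesis using invariant[OF E src_image_mu[OF one_sheeted_sets[OF E]]] by simp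
qed

lemma AE_saturate:
  assumes "AE x in mu. P x"
  shows "AE x in mu. \<forall>g\<in>A. src G g = x \<longrightarrow> P (rng G g)"
proof -
  obtain N where N: "{x \<in> space mu. \<not> P x} \<subseteq> N" "emeasure mu N = 0" "N \<in> sets mu"
    using AE_E[OF assms] by blast
  have NA [measurable]: "N \<in> sets (arrows G)" using N(3) by (simp add: sets_mu_iff)
  obtain S :: "nat \<Rightarrow> 'a set" where S: "\<And>n. S n \<in> one_sheeted G" "A = (\<Union>n. S n)"
    using sheet_cover by metis
  define T where "T = (\<lambda>n. {g \<in> S n. rng G g \<in> N})"
  have T: "T n \<in> one_sheeted G" for n unfolding T_def by (rule one_sheeted_rng_vimage[OF S(1) NA])
  have null: "src G ` T n \<in> null_sets mu" for n
  proof -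
    have "emeasure mu (src G ` T n) = emeasure mu (rng G ` T n)" using emeasure_rng_src[OF T] by simp
    also have "\<dots> \<le> emeasure mu N" using N(3) by (intro emeasure_mono) (auto simp: T_def)
    finally show ?thesis using N(2) src_image_mu[OF one_sheeted_sets[OF T]] by (auto simp: null_sets_def)
  qed
  have "(\<Union>n. src G ` T n) \<in> null_sets mu" using null by blast
  then show ?thesis
  proof (rule AE_I')
    show "{x \<in> space mu. \<not> (\<forall>g\<in>A. src G g = x \<longrightarrow> P (rng G g))} \<subseteq> (\<Union>n. src G ` T n)"
      using N(1) S(2) by (fastforce simp: T_def)
  qed
qed

lemma groupoid_measure_one_sheeted:
  assumes E: "E \<in> one_sheeted G"
  shows "groupoid_measure G mu E = emeasure mu (src G ` E)"
proof -
  have "emeasure (count_space UNIV) ({g \<in> A. src G g = x} \<inter> E) = indicator (src G ` E) x" for x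
  proof (cases "x \<in> src G ` E")
    case True
    then obtain e where e: "e \<in> E" "x = src G e" by blast
    then have "{g \<in> A. src G g = x} \<inter> E = {e}"
      using one_sheeted_src[OF E] one_sheeted_A[OF E] by (auto dest: inj_onD)
    then show ?thesis using True by simp
  next
    case False
    then have "{g \<in> A. src G g = x} \<inter> E = {}" by auto
    then show ?thesis using False by simp
  qed
  then show ?thesis
    unfolding groupoid_measure_def using src_image_mu[OF one_sheeted_sets[OF E]] by simp
qed

lemma groupoid_measure_eq_0_iff:
  assumes B: "B \<in> sets (arrows G)"
  shows "groupoid_measure G mu B = 0 \<longleftrightarrow> (AE x in mu. \<forall>g\<in>B. src G g \<noteq> x)"
proof -
  have S: "src G ` B \<in> sets mu" by (rule src_image_mu[OF B])
  have BA: "B \<subseteq> A" by (rule sets.sets_into_space[OF B])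
  have AE: "(AE x in mu. \<forall>g\<in>B. src G g \<noteq> x) \<longleftrightarrow> emeasure mu (src G ` B) = 0"
  proof -
    have "(AE x in mu. x \<notin> src G ` B) \<longleftrightarrow> emeasure mu (src G ` B) = 0"
      using S by (subst AE_iff_null_sets[symmetric]) (auto simp: null_sets_def)
    moreover have "(\<forall>g\<in>B. src G g \<noteq> x) \<longleftrightarrow> x \<notin> src G ` B" for x by auto
    ultimately show ?thesis by simp
  qed
  have lower: "indicator (src G ` B) x \<le> emeasure (count_space UNIV) ({g \<in> A. src G g = x} \<inter> B)" for x
  proof (cases "x \<in> src G ` B")
    case True
    then obtain g where g: "g \<in> {g \<in> A. src G g = x} \<inter> B" using BA by auto
    have "1 = emeasure (count_space UNIV) {g}" by simp
    also have "\<dots> \<le> emeasure (count_space UNIV) ({g \<in> A. src G g = x} \<inter> B)"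
      using g by (intro emeasure_mono) auto
    finally show ?thesis using True by simp
  qed simp
  have upper: "emeasure (count_space UNIV) ({g \<in> A. src G g = x} \<inter> B) \<le> top * indicator (src G ` B) x" for x
  proof (cases "x \<in> src G ` B")
    case False
    then have "{g \<in> A. src G g = x} \<inter> B = {}" by auto
    then show ?thesis by simp
  qed simp
  show ?thesis
  proof
    assume "groupoid_measure G mu B = 0"
    moreover have "emeasure mu (src G ` B) \<le> groupoid_measure G mu B"
      unfolding groupoid_measure_def nn_integral_indicator[OF S, symmetric]
      by (intro nn_integral_mono lower)
    ultimately show "AE x in mu. \<forall>g\<in>B. src G g \<noteq> x" unfolding AE by simp
  next
    assume "AE x in mu. \<forall>g\<in>B. src G g \<noteq> x"
    then have "emeasure mu (src G ` B) = 0" unfolding AE .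
    moreover have "groupoid_measure G mu B \<le> top * emeasure mu (src G ` B)"
      unfolding groupoid_measure_def nn_integral_cmult_indicator[OF S, symmetric]
      by (intro nn_integral_mono upper)
    ultimately show "groupoid_measure G mu B = 0" by simp
  qed
qed

lemma groupoid_measure_restrict:
  assumes Y: "Y \<in> sets mu" and B: "B \<subseteq> space (arrows (groupoid_restrict G Y))"
  shows "groupoid_measure (groupoid_restrict G Y) (restrict_space mu Y) B = groupoid_measure G mu B"
proof -
  have YU: "Y \<inter> units G = Y" using Y by (auto simp: sets_mu_iff)
  have "groupoid_measure (groupoid_restrict G Y) (restrict_space mu Y) B =
    (\<integral>\<^sup>+x. emeasure (count_space UNIV) ({g \<in> A. (src G g \<in> Y \<and> rng G g \<in> Y) \<and> src G g = x} \<inter> B) * indicator Y x \<partial>mu)"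
    unfolding groupoid_measure_def using Y
    by (subst nn_integral_restrict_space) (auto simp: conj_assoc YU)
  also have "\<dots> = groupoid_measure G mu B"
    unfolding groupoid_measure_def
  proof (rule nn_integral_cong)
    fix x
    have "{g \<in> A. (src G g \<in> Y \<and> rng G g \<in> Y) \<and> src G g = x} \<inter> B = {g \<in> A. src G g = x} \<inter> B"
      using B by auto
    moreover have "{g \<in> A. src G g = x} \<inter> B = {}" if "x \<notin> Y" using B that by auto
    ultimately show "emeasure (count_space UNIV) ({g \<in> A. (src G g \<in> Y \<and> rng G g \<in> Y) \<and> src G g = x} \<inter> B) * indicator Y x
      = emeasure (count_space UNIV) ({g \<in> A. src G g = x} \<inter> B)"
      by (cases "x \<in> Y") auto
  qed
  finally show ?thesis .
qed

lemma sets_restrict_iff: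
  assumes Y: "Y \<in> sets mu"
  shows "B \<in> sets (arrows (groupoid_restrict G Y)) \<longleftrightarrow>
    B \<in> sets (arrows G) \<and> B \<subseteq> space (arrows (groupoid_restrict G Y))"
proof -
  have [measurable]: "Y \<in> sets (arrows G)" using Y by (simp add: sets_mu_iff)
  have "{g \<in> A. src G g \<in> Y \<and> rng G g \<in> Y} \<in> sets (arrows G)" by measurable
  then show ?thesis
    using sets.sets_into_space by (auto simp: groupoid_restrict_def space_restrict_space sets_restrict_space_iff)
qed

lemma one_sheeted_restrict_iff:
  assumes Y: "Y \<in> sets mu"
  shows "E \<in> one_sheeted (groupoid_restrict G Y) \<longleftrightarrow>
    E \<in> one_sheeted G \<and> E \<subseteq> space (arrows (groupoid_restrict G Y))"
  using sets_restrict_iff[OF Y] by (auto simp: one_sheeted_def)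

lemma sheet_family_restrict_iff:
  assumes Y: "Y \<in> sets mu"
  shows "sheet_family (groupoid_restrict G Y) \<F> \<longleftrightarrow>
    sheet_family G \<F> \<and> (\<forall>E\<in>\<F>. \<forall>g\<in>E. src G g \<in> Y \<and> rng G g \<in> Y)"
proof -
  have "E \<in> one_sheeted (groupoid_restrict G Y) \<longleftrightarrow>
    E \<in> one_sheeted G \<and> (\<forall>g\<in>E. src G g \<in> Y \<and> rng G g \<in> Y)" for E
    using one_sheeted_restrict_iff[OF Y] one_sheeted_A by auto
  then show ?thesis by (auto simp: sheet_family_def subset_iff)
qed

lemma family_cost_restrict:
  assumes Y: "Y \<in> sets mu" and F: "sheet_family (groupoid_restrict G Y) \<F>"
  shows "family_cost (groupoid_restrict G Y) (restrict_space mu Y) \<F> =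
    (\<integral>\<^sup>+E. emeasure mu (src G ` E) \<partial>count_space \<F>)"
proof -
  have "family_cost (groupoid_restrict G Y) (restrict_space mu Y) \<F> =
    (\<integral>\<^sup>+E. groupoid_measure (groupoid_restrict G Y) (restrict_space mu Y) E \<partial>count_space \<F>)"
    unfolding family_cost_def using F
    by (intro infsum_eq_nn_integral_count_space) (auto simp: sheet_family_def)
  also have "\<dots> = (\<integral>\<^sup>+E. emeasure mu (src G ` E) \<partial>count_space \<F>)"
  proof (rule nn_integral_cong)
    fix E assume "E \<in> space (count_space \<F>)"
    then have "E \<in> one_sheeted (groupoid_restrict G Y)" using F by (auto simp: sheet_family_def)
    then show "groupoid_measure (groupoid_restrict G Y) (restrict_space mu Y) E = emeasure mu (src G ` E)"
      unfolding one_sheeted_restrict_iff[OF Y]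
      using groupoid_measure_restrict[OF Y, of E] groupoid_measure_one_sheeted by auto
  qed
  finally show ?thesis .
qed

lemma word_set_restrict_sets:
  assumes Y: "Y \<in> sets mu" and F: "sheet_family (groupoid_restrict G Y) \<F>"
  shows "lw \<in> lists (\<F> \<times> {1, -1}) \<Longrightarrow> word_set (groupoid_restrict G Y) lw \<in> sets (arrows G) \<and>
     word_set (groupoid_restrict G Y) lw \<subseteq> space (arrows (groupoid_restrict G Y))"
proof (induction lw)
  case Nil
  have "Y \<subseteq> units G" using Y by (simp add: sets_mu_iff)
  then show ?case using Y by (auto simp: word_set_def sets_mu_iff subset_iff)
next
  case (Cons l lw)
  let ?H = "groupoid_restrict G Y"
  interpret H: groupoid ?H using Y by (intro groupoid_groupoid_restrict) (simp add: sets_mu_iff)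
  obtain E i where l: "l = (E, i)" "E \<in> \<F>" using Cons.prems by (cases l) auto
  have E: "E \<in> one_sheeted G" "E \<subseteq> space (arrows ?H)"
    using F l one_sheeted_restrict_iff[OF Y] by (auto simp: sheet_family_def)
  have P: "set_power ?H l \<in> one_sheeted G" "set_power ?H l \<subseteq> space (arrows ?H)"
    using set_power_one_sheeted[OF E(1), of i] E(2) l by (auto simp: set_power_def subset_iff)
  let ?W = "word_set ?H lw"
  have W: "?W \<in> sets (arrows G)" "?W \<subseteq> space (arrows ?H)" using Cons by auto
  have eq: "word_set ?H (l # lw) = set_mult ?H (set_power ?H l) ?W" by (simp add: word_set_def)
  have "set_mult ?H (set_power ?H l) ?W = set_mult G (set_power ?H l) ?W"
    using P W unfolding set_mult_def composable_def by fastforce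
  moreover have "set_mult ?H (set_power ?H l) ?W \<subseteq> space (arrows ?H)"
    using H.mult_closed by (auto simp: set_mult_def simp del: restrict_simps)
  ultimately show ?case unfolding eq using set_mult_sets[OF P(1) W(1)] by simp
qed

lemma countable_reduced_words: "countable \<F> \<Longrightarrow> countable (reduced_words \<F>)"
  by (rule countable_subset[of _ "lists (\<F> \<times> {1, -1})"]) (auto simp: reduced_words_def)

lemma bisheets_restrict:
  assumes Y: "Y \<in> sets mu" and F: "sheet_family (groupoid_restrict G Y) \<F>"
  shows "bisheets (groupoid_restrict G Y) \<F>"
proof -
  interpret H: groupoid "groupoid_restrict G Y" using Y by (intro groupoid_groupoid_restrict) (simp add: sets_mu_iff)
  show ?thesis
  proof
    fix E assume "E \<in> \<F>"
    then have "E \<in> one_sheeted G \<and> E \<subseteq> space (arrows (groupoid_restrict G Y))"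
      using F one_sheeted_restrict_iff[OF Y] by (auto simp: sheet_family_def)
    then show "E \<subseteq> space (arrows (groupoid_restrict G Y))"
      "inj_on (src (groupoid_restrict G Y)) E \<and> inj_on (rng (groupoid_restrict G Y)) E"
      using one_sheeted_src one_sheeted_rng by auto
  qed
qed

lemma graphing_restrict_iff:
  assumes Y: "Y \<in> sets mu"
  shows "graphing (groupoid_restrict G Y) (restrict_space mu Y) \<F> \<longleftrightarrow>
    sheet_family (groupoid_restrict G Y) \<F> \<and>
    (AE x in mu. \<forall>g\<in>A. src G g = x \<and> x \<in> Y \<and> rng G g \<in> Y \<longrightarrow> (\<exists>w. pok G \<F> x w \<and> pval G x w = g))"
proof (cases "sheet_family (groupoid_restrict G Y) \<F>")
  case True
  let ?H = "groupoid_restrict G Y"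
  interpret H: bisheets ?H \<F> by (rule bisheets_restrict[OF Y True])
  have YU: "Y \<subseteq> units G" using Y by (simp add: sets_mu_iff)
  have [measurable]: "Y \<in> sets (arrows G)" using Y by (simp add: sets_mu_iff)
  define B where "B = space (arrows ?H) - (Y \<union> \<Union>(Wr ?H \<F>))"
  have "{g \<in> A. src G g \<in> Y \<and> rng G g \<in> Y} \<in> sets (arrows G)" by measurable
  then have sp: "space (arrows ?H) \<in> sets (arrows G)" by simp
  have "\<Union>(Wr ?H \<F>) \<in> sets (arrows G)"
    unfolding Wr_def
  proof (intro sets.countable_UN'')
    show "countable (reduced_words \<F>)" using True by (intro countable_reduced_words) (auto simp: sheet_family_def)
    show "word_set ?H w \<in> sets (arrows G)" if "w \<in> reduced_words \<F>" for w
      using word_set_restrict_sets[OF Y True] H.reduced_words_lists[OF that] by blast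
  qed
  then have B: "B \<in> sets (arrows G)" using sp unfolding B_def by measurable
  have "graphing ?H (restrict_space mu Y) \<F> \<longleftrightarrow> groupoid_measure G mu B = 0"
    using True groupoid_measure_restrict[OF Y, of B] unfolding graphing_def by (simp add: B_def)
  also have "\<dots> \<longleftrightarrow> (AE x in mu. \<forall>g\<in>B. src G g \<noteq> x)" by (rule groupoid_measure_eq_0_iff[OF B])
  also have "\<dots> \<longleftrightarrow> (AE x in mu. \<forall>g\<in>A. src G g = x \<and> x \<in> Y \<and> rng G g \<in> Y \<longrightarrow> (\<exists>w. pok G \<F> x w \<and> pval G x w = g))"
  proof (rule AE_cong)
    fix x
    have "g \<in> B \<longleftrightarrow> g \<in> space (arrows ?H) \<and> \<not> (\<exists>w. pok G \<F> (src G g) w \<and> pval G (src G g) w = g)" for g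
      using H.in_Wr_iff[of g] pok_restrict[of "src G g" Y G \<F>] YU by (auto simp: B_def)
    then show "(\<forall>g\<in>B. src G g \<noteq> x) \<longleftrightarrow>
      (\<forall>g\<in>A. src G g = x \<and> x \<in> Y \<and> rng G g \<in> Y \<longrightarrow> (\<exists>w. pok G \<F> x w \<and> pval G x w = g))"
      by auto
  qed
  finally show ?thesis using True by simp
qed (simp add: graphing_def)

lemma treeing_restrict_iff:
  assumes Y: "Y \<in> sets mu"
  shows "treeing (groupoid_restrict G Y) (restrict_space mu Y) \<F> \<longleftrightarrow>
    sheet_family (groupoid_restrict G Y) \<F> \<and>
    (AE x in mu. x \<in> Y \<longrightarrow> \<not> (\<exists>w. w \<noteq> [] \<and> freely_reduced w \<and> pok G \<F> x w \<and> pval G x w = x))"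
proof (cases "sheet_family (groupoid_restrict G Y) \<F>")
  case True
  let ?H = "groupoid_restrict G Y"
  interpret H: bisheets ?H \<F> by (rule bisheets_restrict[OF Y True])
  have YU: "Y \<subseteq> units G" using Y by (simp add: sets_mu_iff)
  have cW: "countable (Wr ?H \<F>)"
    unfolding Wr_def using True by (intro countable_image countable_reduced_words) (auto simp: sheet_family_def)
  have W: "(groupoid_measure ?H (restrict_space mu Y) (W \<inter> units ?H) = 0) \<longleftrightarrow> (AE x in mu. x \<notin> W \<inter> Y)"
    if "W \<in> Wr ?H \<F>" for W
  proof -
    have WY: "W \<inter> Y \<in> sets (arrows G)"
      using that word_set_restrict_sets[OF Y True] H.reduced_words_lists Y
      by (auto simp: Wr_def sets_mu_iff)
    have "W \<inter> Y \<subseteq> space (arrows ?H)" using YU by auto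
    then have "groupoid_measure ?H (restrict_space mu Y) (W \<inter> units ?H) = groupoid_measure G mu (W \<inter> Y)"
      using groupoid_measure_restrict[OF Y] by simp
    also have "\<dots> = 0 \<longleftrightarrow> (AE x in mu. \<forall>g\<in>W \<inter> Y. src G g \<noteq> x)" by (rule groupoid_measure_eq_0_iff[OF WY])
    also have "\<dots> \<longleftrightarrow> (AE x in mu. x \<notin> W \<inter> Y)"
      using YU by (intro AE_cong) (auto simp: subset_iff)
    finally show ?thesis .
  qed
  have "treeing ?H (restrict_space mu Y) \<F> \<longleftrightarrow> (\<forall>W\<in>Wr ?H \<F>. AE x in mu. x \<notin> W \<inter> Y)"
    using True W unfolding treeing_def by auto
  also have "\<dots> \<longleftrightarrow> (AE x in mu. \<forall>W\<in>Wr ?H \<F>. x \<notin> W \<inter> Y)" by (rule AE_ball_countable[OF cW, symmetric])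
  also have "\<dots> \<longleftrightarrow> (AE x in mu. x \<in> Y \<longrightarrow> \<not> (\<exists>w. w \<noteq> [] \<and> freely_reduced w \<and> pok G \<F> x w \<and> pval G x w = x))"
  proof (rule AE_cong)
    fix x
    show "(\<forall>W\<in>Wr ?H \<F>. x \<notin> W \<inter> Y) \<longleftrightarrow>
      (x \<in> Y \<longrightarrow> \<not> (\<exists>w. w \<noteq> [] \<and> freely_reduced w \<and> pok G \<F> x w \<and> pval G x w = x))"
      using H.unit_in_Wr_iff[of x] pok_restrict[of x Y G \<F>] YU by auto
  qed
  finally show ?thesis using True by simp
qed (simp add: treeing_def)

lemma restrict_units [simp]: "groupoid_restrict G (units G) = G" "restrict_space mu (units G) = mu"
proof -
  have "{g \<in> A. src G g \<in> units G \<and> rng G g \<in> units G} = A" by auto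
  moreover have "restrict_space M (space M) = M" for M :: "'a measure"
    by (rule measure_eqI) (auto simp: sets_restrict_space_iff emeasure_restrict_space dest: sets.sets_into_space[THEN subsetD])
  ultimately show "groupoid_restrict G (units G) = G" "restrict_space mu (units G) = mu"
    by (simp_all add: groupoid_restrict_def flip: space_mu)
qed

lemma units_mu: "units G \<in> sets mu"
  using sets.top[of mu] by simp

lemma graphing_iff:
  "graphing G mu \<E> \<longleftrightarrow> sheet_family G \<E> \<and>
    (AE x in mu. \<forall>g\<in>A. src G g = x \<longrightarrow> (\<exists>w. pok G \<E> x w \<and> pval G x w = g))"
proof -
  have "(\<forall>g\<in>A. src G g = x \<and> x \<in> units G \<and> rng G g \<in> units G \<longrightarrow> P g) \<longleftrightarrow>
    (\<forall>g\<in>A. src G g = x \<longrightarrow> P g)" for x P by auto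
  then show ?thesis using graphing_restrict_iff[OF units_mu, of \<E>] by (simp only: restrict_units)
qed

lemma treeing_iff:
  "treeing G mu \<E> \<longleftrightarrow> sheet_family G \<E> \<and>
    (AE x in mu. \<not> (\<exists>w. w \<noteq> [] \<and> freely_reduced w \<and> pok G \<E> x w \<and> pval G x w = x))"
proof -
  have "(AE x in mu. x \<in> units G \<longrightarrow> P x) \<longleftrightarrow> (AE x in mu. P x)" for P
    by (rule AE_cong) simp
  then show ?thesis using treeing_restrict_iff[OF units_mu, of \<E>] by (simp only: restrict_units)
qed

lemma family_cost_eq:
  "sheet_family G \<E> \<Longrightarrow> family_cost G mu \<E> = (\<integral>\<^sup>+E. emeasure mu (src G ` E) \<partial>count_space \<E>)"
  using family_cost_restrict[OF units_mu, of \<E>] by (simp only: restrict_units)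

end

section \<open>Extending a graphing of the restriction\<close>

context pmp_discrete_groupoid
begin

lemma section_into:
  assumes Y: "Y \<in> sets mu" and meets: "AE x in mu. \<exists>g\<in>A. src G g = x \<and> rng G g \<in> Y"
  obtains \<D> where "countable \<D>" "\<D> \<subseteq> one_sheeted G" "disjoint \<D>" "inj_on (src G) (\<Union>\<D>)"
    "\<And>D g. D \<in> \<D> \<Longrightarrow> g \<in> D \<Longrightarrow> src G g \<notin> Y \<and> rng G g \<in> Y"
    "AE x in mu. x \<notin> Y \<longrightarrow> x \<in> src G ` \<Union>\<D>"
proof -
  obtain S :: "nat \<Rightarrow> 'a set" where S: "\<And>n. S n \<in> one_sheeted G" "A = (\<Union>n. S n)"
    using sheet_cover by metis
  have YA: "Y \<in> sets (arrows G)" using Y by (simp add: sets_mu_iff)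
  define T where "T = (\<lambda>n. {g \<in> {g \<in> S n. rng G g \<in> Y}. src G g \<in> A - Y})"
  have T: "T n \<in> one_sheeted G" for n
    unfolding T_def using YA by (intro one_sheeted_src_vimage one_sheeted_rng_vimage S sets.Diff) auto
  define X where "X = disjointed (\<lambda>n. src G ` T n)"
  have X: "X n \<in> sets (arrows G)" for n
  proof -
    have "range X \<subseteq> sets (arrows G)"
      unfolding X_def using src_image_sets[OF one_sheeted_sets[OF T]]
      by (intro sets.range_disjointed_sets) auto
    then show ?thesis by auto
  qed
  have X_disj: "n = m" if "x \<in> X n" "x \<in> X m" for n m x
    using that disjoint_family_disjointed[of "\<lambda>n. src G ` T n"] unfolding X_def disjoint_family_on_def by auto
  define D where "D = (\<lambda>n. {g \<in> T n. src G g \<in> X n})"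
  have D: "D n \<in> one_sheeted G" for n unfolding D_def by (intro one_sheeted_src_vimage T X)
  show ?thesis
  proof
    show "countable (range D)" "range D \<subseteq> one_sheeted G" using D by auto
    show "disjoint (range D)"
      using X_disj by (auto simp: disjoint_def D_def)
    show "inj_on (src G) (\<Union>(range D))"
    proof (rule inj_onI)
      fix g h assume "g \<in> \<Union>(range D)" "h \<in> \<Union>(range D)" and eq: "src G g = src G h"
      then obtain n m where gh: "g \<in> D n" "h \<in> D m" by auto
      then have "src G g \<in> X n" "src G g \<in> X m" using eq by (auto simp: D_def)
      then have "n = m" by (rule X_disj)
      then show "g = h" using inj_onD[OF one_sheeted_src[OF D[of n]] eq] gh by simp
    qed
    show "src G g \<notin> Y \<and> rng G g \<in> Y" if "B \<in> range D" "g \<in> B" for B g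
      using that by (auto simp: D_def T_def)
    have src_D: "x \<in> src G ` \<Union>(range D)" if x: "x \<in> src G ` T n" for x n
    proof -
      have "x \<in> (\<Union>n. X n)" unfolding X_def UN_disjointed_eq using x by blast
      then obtain m where m: "x \<in> X m" by blast
      then have "x \<in> src G ` T m" using disjointed_subset[of "\<lambda>n. src G ` T n" m] by (auto simp: X_def)
      then show ?thesis using m by (auto simp: D_def)
    qed
    show "AE x in mu. x \<notin> Y \<longrightarrow> x \<in> src G ` \<Union>(range D)"
      using meets
    proof eventually_elim
      case (elim x)
      show ?case
      proof
        assume "x \<notin> Y"
        obtain g where g: "g \<in> A" "src G g = x" "rng G g \<in> Y" using elim by blast
        then obtain n where "g \<in> S n" using S(2) by blast
        then have "g \<in> T n" using g \<open>x \<notin> Y\<close> by (auto simp: T_def)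
        then show "x \<in> src G ` \<Union>(range D)" using g by (intro src_D[of x n]) auto
      qed
    qed
  qed
qed

lemma graphing_extend:
  assumes Y: "Y \<in> sets mu" and meets: "AE x in mu. \<exists>g\<in>A. src G g = x \<and> rng G g \<in> Y"
    and F: "graphing (groupoid_restrict G Y) (restrict_space mu Y) \<F>"
  obtains \<E> where "graphing G mu \<E>"
    "family_cost G mu \<E> \<le> family_cost (groupoid_restrict G Y) (restrict_space mu Y) \<F> + emeasure mu (units G - Y)"
    "treeing (groupoid_restrict G Y) (restrict_space mu Y) \<F> \<Longrightarrow> treeing G mu \<E>"
proof -
  let ?H = "groupoid_restrict G Y" and ?muY = "restrict_space mu Y"
  obtain \<D> where \<D>: "countable \<D>" "\<D> \<subseteq> one_sheeted G" "disjoint \<D>" "inj_on (src G) (\<Union>\<D>)"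
    "\<And>D g. D \<in> \<D> \<Longrightarrow> g \<in> D \<Longrightarrow> src G g \<notin> Y \<and> rng G g \<in> Y"
    "AE x in mu. x \<notin> Y \<longrightarrow> x \<in> src G ` \<Union>\<D>"
    using section_into[OF Y meets] by blast
  have \<F>: "sheet_family ?H \<F>" and AEF: "AE x in mu. \<forall>g\<in>A. src G g = x \<and> x \<in> Y \<and> rng G g \<in> Y \<longrightarrow>
      (\<exists>w. pok G \<F> x w \<and> pval G x w = g)"
    using F unfolding graphing_restrict_iff[OF Y] by blast+
  have \<F>G: "sheet_family G \<F>" "\<And>E g. E \<in> \<F> \<Longrightarrow> g \<in> E \<Longrightarrow> src G g \<in> Y \<and> rng G g \<in> Y"
    using \<F> sheet_family_restrict_iff[OF Y] by auto
  have YU: "Y \<subseteq> units G" using Y by (simp add: sets_mu_iff)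
  define \<E> where "\<E> = \<F> \<union> \<D>"
  have \<E>: "sheet_family G \<E>" using \<F>G(1) \<D>(1,2) by (auto simp: \<E>_def sheet_family_def)
  interpret E: bisheets G \<E> by (rule bisheets_family[OF \<E>])
  interpret F: bisheets G \<F> by (rule bisheets_family[OF \<F>G(1)])
  have \<D>A: "d \<in> A" if "D \<in> \<D>" "d \<in> D" for D d using that \<D>(2) one_sheeted_A by blast
  have \<D>eq: "D = D' \<and> d = d'" if "D \<in> \<D>" "D' \<in> \<D>" "d \<in> D" "d' \<in> D'" "src G d = src G d'" for D D' d d'
  proof -
    have "d = d'" using that inj_onD[OF \<D>(4)] by blast
    then show ?thesis using that \<D>(3) by (auto simp: disjoint_def)
  qed
  have graph: "graphing G mu \<E>"
    unfolding graphing_iff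
  proof (intro conjI \<E>)
    define Good where "Good = (\<lambda>x. (\<forall>g\<in>A. src G g = x \<and> x \<in> Y \<and> rng G g \<in> Y \<longrightarrow>
      (\<exists>w. pok G \<F> x w \<and> pval G x w = g)) \<and> (x \<notin> Y \<longrightarrow> x \<in> src G ` \<Union>\<D>))"
    have "AE x in mu. Good x" using AEF \<D>(6) unfolding Good_def by eventually_elim auto
    from AE_saturate[OF this] have "AE x in mu. \<forall>g\<in>A. src G g = x \<longrightarrow> (\<exists>w. pok G \<E> x w \<and> pval G x w = g)"
    proof eventually_elim
      case (elim x)
      show ?case
      proof (intro ballI impI)
        fix g assume g: "g \<in> A" "src G g = x"
        have leg: "\<exists>l. pok G \<E> z l \<and> rng G (pval G z l) \<in> Y" if "z \<in> units G" "Good z" for z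
        proof (cases "z \<in> Y")
          case True then show ?thesis using that by (intro exI[of _ "[]"]) simp
        next
          case False
          then obtain D d where "D \<in> \<D>" "d \<in> D" "z = src G d" using \<open>Good z\<close> by (auto simp: Good_def)
          then show ?thesis using \<D>(5)[of D d] \<D>A[of D d]
            by (intro exI[of _ "[((D, d), True)]"]) (auto simp: edge_def \<E>_def tval_def)
        qed
        have x: "x \<in> units G" using g by auto
        then have "Good x" using elim[rule_format, of x] by simp
        then obtain l0 where l0: "pok G \<E> x l0" "rng G (pval G x l0) \<in> Y" using leg x by blast
        obtain l1 where l1: "pok G \<E> (rng G g) l1" "rng G (pval G (rng G g) l1) \<in> Y"
          using leg[of "rng G g"] g elim by auto
        define d0 d1 where "d0 = pval G x l0" and "d1 = pval G (rng G g) l1"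
        have d0: "d0 \<in> A" "src G d0 = x" "rng G d0 \<in> Y" using l0 by (auto simp: d0_def)
        have d1: "d1 \<in> A" "src G d1 = rng G g" "rng G d1 \<in> Y" using l1 by (auto simp: d1_def)
        define h where "h = mult G (mult G d1 g) (inverse_of G d0)"
        have h: "h \<in> A" "src G h = rng G d0" "rng G h = rng G d1" using d0 d1 g by (auto simp: h_def)
        have hd: "mult G h d0 = mult G d1 g" using d0 d1 g by (simp add: h_def)
        have "Good (rng G d0)" using elim d0 by blast
        then obtain v where v: "pok G \<F> (rng G d0) v" "pval G (rng G d0) v = h"
          unfolding Good_def using h d0 d1 by metis
        have v': "pok G \<E> (rng G d0) v" using v(1) by (rule pok_mono) (simp add: \<E>_def)
        have wi: "pok G \<E> (rng G d1) (winv l1)" "pval G (rng G d1) (winv l1) = inverse_of G d1"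
          using E.pok_winv[OF l1(1)] by (auto simp: d1_def)
        have p1: "pok G \<E> x (v @ l0)" using l0 v' by (simp add: E.pok_append d0_def)
        have p1v: "pval G x (v @ l0) = mult G d1 g" using E.pval_append[OF p1] v hd by (simp add: d0_def)
        have p2: "pok G \<E> x (winv l1 @ (v @ l0))"
          using p1 wi(1) d1 g by (subst E.pok_append) (simp add: p1v)
        have "pval G x (winv l1 @ (v @ l0)) = g"
          using E.pval_append[OF p2] wi(2) d1 g by (simp add: p1v)
        then show "\<exists>w. pok G \<E> x w \<and> pval G x w = g" using p2 by blast
      qed
    qed
    then show "AE x in mu. \<forall>g\<in>A. src G g = x \<longrightarrow> (\<exists>w. pok G \<E> x w \<and> pval G x w = g)" .
  qed
  have tok: "(fst (fst t) \<in> \<F> \<and> src G (tval G t) \<in> Y \<and> rng G (tval G t) \<in> Y) \<or>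
     (fst (fst t) \<in> \<D> \<and> snd t \<and> src G (tval G t) \<notin> Y \<and> rng G (tval G t) \<in> Y) \<or>
     (fst (fst t) \<in> \<D> \<and> \<not> snd t \<and> src G (tval G t) \<in> Y \<and> rng G (tval G t) \<notin> Y)" if t: "edge \<E> t" for t
  proof -
    have e: "snd (fst t) \<in> A" using E.edge_A[OF t] .
    have m: "snd (fst t) \<in> fst (fst t)" "fst (fst t) \<in> \<F> \<or> fst (fst t) \<in> \<D>"
      using t by (auto simp: edge_def \<E>_def)
    show ?thesis using m(2) \<F>G(2)[OF _ m(1)] \<D>(5)[OF _ m(1)] e by (cases "snd t") (auto simp: tval_def)
  qed
  have shape: "(pok G \<F> y w \<and> rng G (pval G y w) \<in> Y) \<or>
      (\<exists>D d w'. w = ((D, d), False) # w' \<and> D \<in> \<D> \<and> d \<in> D \<and> pok G \<F> y w' \<and> rng G (pval G y w) = src G d)"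
    if "y \<in> Y" "pok G \<E> y w" "freely_reduced w" for y w
    using that
  proof (induction w)
    case Nil then show ?case using YU by auto
  next
    case (Cons t w)
    have t: "edge \<E> t" "pok G \<E> y w" "src G (tval G t) = rng G (pval G y w)" "freely_reduced w"
      using Cons.prems by (auto simp: freely_reduced_def successively_Cons)
    have rt: "rng G (pval G y (t # w)) = rng G (tval G t)" using t by simp
    from Cons.IH[OF Cons.prems(1) t(2,4)] show ?case
    proof (elim disjE exE conjE)
      assume w: "pok G \<F> y w" "rng G (pval G y w) \<in> Y"
      then have "src G (tval G t) \<in> Y" using t by simp
      then consider "fst (fst t) \<in> \<F>" "rng G (tval G t) \<in> Y" | "fst (fst t) \<in> \<D>" "\<not> snd t"
        using tok[OF t(1)] by blast
      then show ?thesis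
      proof cases
        case 1
        then have "edge \<F> t" using t(1) by (simp add: edge_def)
        then show ?thesis using w t 1 by auto
      next
        case 2
        then obtain D d where d: "t = ((D, d), False)" "D \<in> \<D>" "d \<in> D"
          using t(1) by (cases t) (auto simp: edge_def)
        then have "rng G (tval G t) = src G d" using \<D>A by (simp add: tval_def)
        then have "rng G (pval G y (t # w)) = src G d" using rt by simp
        then show ?thesis using d w(1)
          by (intro disjI2 exI[of _ D] exI[of _ d] exI[of _ w]) auto
      qed
    next
      fix D d w' assume w: "w = ((D, d), False) # w'" "D \<in> \<D>" "d \<in> D" "rng G (pval G y w) = src G d"
      then have "src G (tval G t) \<notin> Y" using t(3) \<D>(5) by auto
      then have "fst (fst t) \<in> \<D>" "snd t" using tok[OF t(1)] by blast+
      then obtain D' d' where d': "t = ((D', d'), True)" "D' \<in> \<D>" "d' \<in> D'"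
        using t(1) by (cases t) (auto simp: edge_def)
      then have "src G d' = src G d" using t(3) w(4) by (simp add: tval_def)
      then have "D' = D \<and> d' = d" using \<D>eq d' w by blast
      then have "((D, d), False) = tinv t" using d' by (simp add: tinv_def)
      then show ?thesis using Cons.prems(3) w(1) by (simp add: freely_reduced_def)
    qed
  qed
  have tree: "treeing G mu \<E>" if T: "treeing ?H ?muY \<F>"
    unfolding treeing_iff
  proof (intro conjI \<E>)
    define Good where "Good = (\<lambda>x. x \<in> Y \<longrightarrow>
      \<not> (\<exists>w. w \<noteq> [] \<and> freely_reduced w \<and> pok G \<F> x w \<and> pval G x w = x))"
    have "AE x in mu. Good x" using T unfolding treeing_restrict_iff[OF Y] Good_def by blast
    from AE_saturate[OF this] have "AE x in mu. \<not> (\<exists>w. w \<noteq> [] \<and> freely_reduced w \<and> pok G \<E> x w \<and> pval G x w = x)"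
    proof eventually_elim
      case (elim x)
      show ?case
      proof
        assume "\<exists>w. w \<noteq> [] \<and> freely_reduced w \<and> pok G \<E> x w \<and> pval G x w = x"
        then obtain w where w: "w \<noteq> []" "freely_reduced w" "pok G \<E> x w" "pval G x w = x" by blast
        have x: "x \<in> units G" using w by simp
        show False
        proof (cases "x \<in> Y")
          case True
          have "Good x" using elim[rule_format, of x] x by simp
          from shape[OF True w(3,2)] show False
          proof (elim disjE exE conjE)
            assume "pok G \<F> x w"
            then show False using \<open>Good x\<close> w True by (auto simp: Good_def)
          next
            fix D d assume "D \<in> \<D>" "d \<in> D" "rng G (pval G x w) = src G d"
            then show False using w(4) x True \<D>(5) by auto
          qed
        next
          case False
          obtain w1 t where wt: "w = w1 @ [t]" using w(1) by (metis rev_exhaust)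
          have t: "edge \<E> t" "src G (tval G t) = x" "pok G \<E> x [t]"
            using w(3) x unfolding wt by (auto simp: E.pok_append)
          then have "fst (fst t) \<in> \<D>" "snd t" using tok[OF t(1)] False by blast+
          then obtain D d where d: "t = ((D, d), True)" "D \<in> \<D>" "d \<in> D"
            using t(1) by (cases t) (auto simp: edge_def)
          have dA: "d \<in> A" "src G d = x" using d t \<D>A by (auto simp: tval_def)
          define y where "y = rng G d"
          have y: "y \<in> Y" using d \<D>(5) by (auto simp: y_def)
          have pt: "pval G x [t] = d" using d dA x by (simp add: tval_def mult_unit_right)
          have w1: "pok G \<E> y w1" using w(3) unfolding wt E.pok_append pt y_def by simp
          have w1v: "mult G (pval G y w1) d = x"
            using E.pval_append[of x w1 "[t]"] w(3,4) pt unfolding wt y_def by simp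
          have yU: "y \<in> units G" using y YU by blast
          have rw1: "rng G (pval G y w1) = x"
          proof -
            have "rng G (mult G (pval G y w1) d) = rng G (pval G y w1)" using w1 dA by (simp add: y_def)
            then show ?thesis using w1v x by simp
          qed
          have fr: "freely_reduced w1" using w(2) unfolding wt freely_reduced_def by (simp add: successively_append_iff)
          from shape[OF y w1 fr] rw1 False obtain D' d' w' where
            w': "w1 = ((D', d'), False) # w'" "D' \<in> \<D>" "d' \<in> D'" "pok G \<F> y w'" "rng G (pval G y w1) = src G d'"
            by blast
          then have eq: "D' = D" "d' = d" using \<D>eq[of D' D d' d] d dA rw1 by auto
          have v: "pval G y w' \<in> A" "src G (pval G y w') = y" "rng G (pval G y w') = rng G d"
          proof -
            show "pval G y w' \<in> A" "src G (pval G y w') = y" using w'(4) by auto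
            show "rng G (pval G y w') = rng G d" using w1 w' eq dA by (simp add: tval_def)
          qed
          have "mult G (mult G (inverse_of G d) (pval G y w')) d = x"
            using w1v w'(1) eq by (simp add: tval_def)
          then have "mult G d (mult G (mult G (inverse_of G d) (pval G y w')) d) = d"
            using dA by (simp add: mult_unit_right)
          then have "mult G (pval G y w') d = mult G y d"
            using dA v by (simp add: assoc' y_def)
          then have "pval G y w' = y"
            using dA v yU inv_cancel_right[of d "pval G y w'"] inv_cancel_right[of d y] by (simp add: y_def)
          moreover have "w' \<noteq> []"
            using w(2) unfolding wt w'(1) eq d(1) by (auto simp: freely_reduced_def tinv_def)
          moreover have "freely_reduced w'" using fr w'(1) by (auto simp: freely_reduced_def successively_Cons)
          moreover have "Good y" using elim dA by (simp add: y_def)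
          ultimately show False using w'(4) y unfolding Good_def by blast
        qed
      qed
    qed
    then show "AE x in mu. \<not> (\<exists>w. w \<noteq> [] \<and> freely_reduced w \<and> pok G \<E> x w \<and> pval G x w = x)" .
  qed
  have "family_cost G mu \<E> = (\<integral>\<^sup>+E. emeasure mu (src G ` E) * indicator (\<F> \<union> \<D>) E \<partial>count_space UNIV)"
    using family_cost_eq[OF \<E>] by (simp add: \<E>_def nn_integral_count_space_indicator)
  also have "\<dots> \<le> (\<integral>\<^sup>+E. emeasure mu (src G ` E) * indicator \<F> E + emeasure mu (src G ` E) * indicator \<D> E \<partial>count_space UNIV)"
    by (intro nn_integral_mono) (auto split: split_indicator)
  also have "\<dots> = (\<integral>\<^sup>+E. emeasure mu (src G ` E) * indicator \<F> E \<partial>count_space UNIV) +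
      (\<integral>\<^sup>+E. emeasure mu (src G ` E) * indicator \<D> E \<partial>count_space UNIV)"
    by (rule nn_integral_add) auto
  also have "\<dots> = family_cost ?H ?muY \<F> + (\<integral>\<^sup>+E. emeasure mu (src G ` E) \<partial>count_space \<D>)"
    unfolding family_cost_restrict[OF Y \<F>] by (simp add: nn_integral_count_space_indicator)
  also have "(\<integral>\<^sup>+E. emeasure mu (src G ` E) \<partial>count_space \<D>) = emeasure mu (\<Union>D\<in>\<D>. src G ` D)"
  proof (rule emeasure_UN_countable[symmetric])
    show "src G ` D \<in> sets mu" if "D \<in> \<D>" for D using that \<D>(2) one_sheeted_sets by (intro src_image_mu) blast
    show "disjoint_family_on (\<lambda>D. src G ` D) \<D>"
      using \<D>eq unfolding disjoint_family_on_def by blast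
  qed (rule \<D>(1))
  also have "\<dots> \<le> emeasure mu (units G - Y)"
  proof (rule emeasure_mono)
    show "(\<Union>D\<in>\<D>. src G ` D) \<subseteq> units G - Y" using \<D>(5) \<D>A by auto
    show "units G - Y \<in> sets mu" using Y units_mu by auto
  qed
  finally have "family_cost G mu \<E> \<le> family_cost ?H ?muY \<F> + emeasure mu (units G - Y)"
    by (simp add: add_left_mono)
  with graph tree show ?thesis using that by blast
qed

end

section \<open>Sliding a graphing into the restriction\<close>

locale sliding = pmp_discrete_groupoid G mu for G :: "'a groupoid_data" and mu +
  fixes Y :: "'a set" and \<E> :: "'a set set" and S :: "nat \<Rightarrow> 'a set"
  assumes Y: "Y \<in> sets mu" and family: "sheet_family G \<E>"
    and S: "\<And>n. S n \<in> one_sheeted G" "A = (\<Union>n. S n)" "disjoint_family S"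
begin

sublocale bisheets G \<E>
  by (rule bisheets_family[OF family])

lemma YU: "Y \<subseteq> units G" and YA: "Y \<in> sets (arrows G)"
  using Y by (auto simp: sets_mu_iff)

definition sheet_of :: "'a set \<times> bool \<Rightarrow> 'a set" where
  "sheet_of l = (if snd l then fst l else inverse_of G ` fst l)"

abbreviation "labels \<equiv> \<E> \<times> (UNIV :: bool set)"

abbreviation lab :: "('a set \<times> 'a) \<times> bool \<Rightarrow> 'a set \<times> bool" where
  "lab t \<equiv> (fst (fst t), snd t)"

lemma countable_family: "countable \<E>" and family_sheet: "E \<in> \<E> \<Longrightarrow> E \<in> one_sheeted G"
  using family by (auto simp: sheet_family_def)

lemma countable_labels: "countable labels"
  using countable_family by auto

lemma sheet_of_sheet: "l \<in> labels \<Longrightarrow> sheet_of l \<in> one_sheeted G"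
  by (auto simp: sheet_of_def family_sheet one_sheeted_inverse)

lemma sheet_of_A: "l \<in> labels \<Longrightarrow> g \<in> sheet_of l \<Longrightarrow> g \<in> A"
  using sheet_of_sheet one_sheeted_A by blast

lemma tval_sheet_of: "edge \<E> t \<Longrightarrow> tval G t \<in> sheet_of (lab t)"
  by (auto simp: edge_def tval_def sheet_of_def)

lemma lab_labels: "edge \<E> t \<Longrightarrow> lab t \<in> labels"
  by (auto simp: edge_def)

lemma sheet_of_tval: "l \<in> labels \<Longrightarrow> g \<in> sheet_of l \<Longrightarrow> \<exists>t. edge \<E> t \<and> lab t = l \<and> tval G t = g"
proof -
  assume l: "l \<in> labels" "g \<in> sheet_of l"
  obtain E b where E: "l = (E, b)" by (cases l)
  obtain e where "e \<in> E" "g = (if b then e else inverse_of G e)"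
    using l E by (auto simp: sheet_of_def split: if_splits)
  then show ?thesis using l E by (intro exI[of _ "((E, e), b)"]) (auto simp: edge_def tval_def)
qed

primrec reach :: "nat \<Rightarrow> 'a set" where
  "reach 0 = Y"
| "reach (Suc n) = reach n \<union> (\<Union>l\<in>labels. src G ` {g \<in> sheet_of l. rng G g \<in> reach n})"

definition reachable :: "'a set" where "reachable = (\<Union>n. reach n)"

definition level :: "'a \<Rightarrow> nat" where "level x = (LEAST n. x \<in> reach n)"

definition closer :: "'a set \<times> bool \<Rightarrow> nat \<Rightarrow> 'a set" where
  "closer l n = src G ` {g \<in> sheet_of l. rng G g \<in> reach n} - reach n"

text \<open>Every point at positive distance from \<open>Y\<close> chooses the first letter that brings it closer.\<close>

definition chosen :: "'a set \<times> bool \<Rightarrow> 'a set" where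
  "chosen l = (\<Union>n. closer l n - (\<Union>l'\<in>{l' \<in> labels. to_nat_on labels l' < to_nat_on labels l}. closer l' n))"

lemma reach_sets: "reach n \<in> sets (arrows G)"
proof (induction n)
  case 0 then show ?case using YA by simp
next
  case (Suc n)
  have "src G ` {g \<in> sheet_of l. rng G g \<in> reach n} \<in> sets (arrows G)" if "l \<in> labels" for l
    by (intro src_image_sets one_sheeted_sets one_sheeted_rng_vimage sheet_of_sheet that Suc)
  then show ?case using Suc countable_labels by (auto intro!: sets.Un sets.countable_UN'')
qed

lemma closer_sets: "l \<in> labels \<Longrightarrow> closer l n \<in> sets (arrows G)"
  unfolding closer_def
  by (intro sets.Diff src_image_sets one_sheeted_sets one_sheeted_rng_vimage sheet_of_sheet reach_sets)

lemma chosen_sets: "l \<in> labels \<Longrightarrow> chosen l \<in> sets (arrows G)"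
  unfolding chosen_def
  by (intro sets.countable_UN'' sets.Diff closer_sets countable_subset[OF _ countable_labels]) auto

lemma reachable_sets: "reachable \<in> sets (arrows G)"
  unfolding reachable_def using reach_sets by auto

lemma reach_mono: "n \<le> m \<Longrightarrow> reach n \<subseteq> reach m"
  by (rule lift_Suc_mono_le) auto

lemma reach_units: "reach n \<subseteq> units G"
proof (induction n)
  case (Suc n) then show ?case using sheet_of_A by auto
qed (use YU in simp)

lemma reachable_units: "x \<in> reachable \<Longrightarrow> x \<in> units G"
  using reach_units by (auto simp: reachable_def)

lemma Y_fin: "Y \<subseteq> reachable"
  unfolding reachable_def using reach.simps(1) by blast

lemma level_le: "x \<in> reach n \<Longrightarrow> level x \<le> n"
  unfolding level_def by (rule Least_le)

lemma reach_level: "x \<in> reachable \<Longrightarrow> x \<in> reach (level x)"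
  unfolding level_def reachable_def by (auto intro: LeastI)

lemma closer_lev: "l \<in> labels \<Longrightarrow> x \<in> closer l n \<Longrightarrow> x \<in> reachable - Y \<and> level x = Suc n"
proof -
  assume l: "l \<in> labels" and x: "x \<in> closer l n"
  then have 1: "x \<in> reach (Suc n)" "x \<notin> reach n" by (auto simp: closer_def)
  then have xf: "x \<in> reachable" unfolding reachable_def by blast
  have "x \<notin> reach m" if "m \<le> n" for m using reach_mono[OF that] 1 by blast
  then have "\<not> level x \<le> n" using reach_level[OF xf] by blast
  moreover have "x \<notin> Y" using reach_mono[of 0 n] 1 by auto
  ultimately show ?thesis using level_le[OF 1(1)] xf by auto
qed

lemma chosen_fin: "l \<in> labels \<Longrightarrow> chosen l \<subseteq> reachable - Y"
  using closer_lev unfolding chosen_def by blast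

lemma chosen_unique:
  assumes "l \<in> labels" "l' \<in> labels" "x \<in> chosen l" "x \<in> chosen l'"
  shows "l = l'"
proof -
  obtain n where n: "x \<in> closer l n" "\<And>k. k \<in> labels \<Longrightarrow> to_nat_on labels k < to_nat_on labels l \<Longrightarrow> x \<notin> closer k n"
    using assms(3) unfolding chosen_def by blast
  obtain m where m: "x \<in> closer l' m" "\<And>k. k \<in> labels \<Longrightarrow> to_nat_on labels k < to_nat_on labels l' \<Longrightarrow> x \<notin> closer k m"
    using assms(4) unfolding chosen_def by blast
  have "n = m" using closer_lev[OF assms(1) n(1)] closer_lev[OF assms(2) m(1)] by simp
  then have "to_nat_on labels l = to_nat_on labels l'"
    using n m assms by (metis linorder_neqE_nat)
  then show ?thesis using inj_on_to_nat_on[OF countable_labels] assms by (auto dest: inj_onD)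
qed

lemma chosen_cover: "x \<in> reachable - Y \<Longrightarrow> \<exists>l\<in>labels. x \<in> chosen l"
proof -
  assume x: "x \<in> reachable - Y"
  then have "level x \<noteq> 0" using reach_level[of x] by (metis DiffE reach.simps(1))
  then obtain n where n: "level x = Suc n" using not0_implies_Suc by blast
  have "x \<notin> reach n" using level_le[of x n] n by auto
  moreover have "x \<in> reach (Suc n)" using reach_level[of x] x n by auto
  ultimately have "\<exists>l. l \<in> labels \<and> x \<in> closer l n" unfolding closer_def by auto
  from ex_has_least_nat[of "\<lambda>l. l \<in> labels \<and> x \<in> closer l n", OF someI_ex[OF this], of "to_nat_on labels"]
  obtain l where l: "l \<in> labels" "x \<in> closer l n"
    "\<And>k. k \<in> labels \<Longrightarrow> x \<in> closer k n \<Longrightarrow> to_nat_on labels l \<le> to_nat_on labels k" by blast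
  have "x \<notin> (\<Union>l'\<in>{l' \<in> labels. to_nat_on labels l' < to_nat_on labels l}. closer l' n)"
  proof
    assume "x \<in> (\<Union>l'\<in>{l' \<in> labels. to_nat_on labels l' < to_nat_on labels l}. closer l' n)"
    then obtain l' where "l' \<in> labels" "to_nat_on labels l' < to_nat_on labels l" "x \<in> closer l' n" by blast
    then show False using l(3)[of l'] by simp
  qed
  then have "x \<in> chosen l" unfolding chosen_def using l(2) by blast
  then show ?thesis using l by blast
qed

definition step_token :: "('a set \<times> 'a) \<times> bool \<Rightarrow> bool" where
  "step_token t \<longleftrightarrow> edge \<E> t \<and> src G (tval G t) \<in> chosen (lab t)"

lemma step_token_level:
  assumes t: "step_token t"
  shows "rng G (tval G t) \<in> reachable \<and> level (rng G (tval G t)) < level (src G (tval G t))"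
proof -
  have e: "edge \<E> t" and c: "src G (tval G t) \<in> chosen (lab t)" using t by (auto simp: step_token_def)
  obtain n where n: "src G (tval G t) \<in> closer (lab t) n" using c unfolding chosen_def by blast
  then obtain g where g: "g \<in> sheet_of (lab t)" "rng G g \<in> reach n" "src G g = src G (tval G t)"
    unfolding closer_def by auto
  have "g = tval G t"
    using inj_onD[OF one_sheeted_src[OF sheet_of_sheet[OF lab_labels[OF e]]] g(3)] g(1) tval_sheet_of[OF e] by blast
  then have "rng G (tval G t) \<in> reach n" using g by simp
  then show ?thesis using level_le closer_lev[OF lab_labels[OF e] n] unfolding reachable_def by fastforce
qed

lemma step_token_unique:
  assumes "step_token t" "step_token t'" "src G (tval G t) = src G (tval G t')"
  shows "t = t'"
proof -
  have e: "edge \<E> t" "edge \<E> t'" using assms by (auto simp: step_token_def)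
  have l: "lab t = lab t'"
    using chosen_unique[OF lab_labels[OF e(1)] lab_labels[OF e(2)]] assms by (auto simp: step_token_def)
  have "tval G t = tval G t'"
    using inj_onD[OF one_sheeted_src[OF sheet_of_sheet[OF lab_labels[OF e(1)]]] assms(3)] tval_sheet_of[OF e(1)] tval_sheet_of[OF e(2)] l
    by simp
  then have tv: "tval G t = tval G t'" .
  have l': "fst (fst t) = fst (fst t')" "snd t = snd t'" using l by simp_all
  have "snd (fst t) = snd (fst t')"
  proof (cases "snd t")
    case True
    then show ?thesis using tv l'(2) unfolding tval_def by simp
  next
    case False
    then have "inverse_of G (snd (fst t)) = inverse_of G (snd (fst t'))" using tv l'(2) unfolding tval_def by simp
    then have "inverse_of G (inverse_of G (snd (fst t))) = inverse_of G (inverse_of G (snd (fst t')))" by (rule arg_cong)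
    then show ?thesis unfolding inverse_inverse[OF edge_A[OF e(1)]] inverse_inverse[OF edge_A[OF e(2)]] .
  qed
  then show ?thesis using l' by (intro prod_eqI)
qed

lemma step_token_ex: "x \<in> reachable - Y \<Longrightarrow> \<exists>t. step_token t \<and> src G (tval G t) = x"
proof -
  assume "x \<in> reachable - Y"
  then obtain l where l: "l \<in> labels" "x \<in> chosen l" using chosen_cover by blast
  then obtain n where "x \<in> closer l n" unfolding chosen_def by blast
  then obtain g where "g \<in> sheet_of l" "src G g = x" unfolding closer_def by auto
  then obtain t where "edge \<E> t" "lab t = l" "tval G t = g" using sheet_of_tval[OF l(1)] by blast
  then show ?thesis using l \<open>src G g = x\<close> by (intro exI[of _ t]) (auto simp: step_token_def)
qed

definition step_of :: "'a \<Rightarrow> ('a set \<times> 'a) \<times> bool" where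
  "step_of x = (SOME t. step_token t \<and> src G (tval G t) = x)"

definition next_unit :: "'a \<Rightarrow> 'a" where "next_unit x = rng G (tval G (step_of x))"

lemma step_of: "x \<in> reachable - Y \<Longrightarrow> step_token (step_of x) \<and> src G (tval G (step_of x)) = x"
  unfolding step_of_def by (rule someI_ex[OF step_token_ex])

lemma step_of_eq: "step_token t \<Longrightarrow> step_of (src G (tval G t)) = t"
proof -
  assume t: "step_token t"
  then have "src G (tval G t) \<in> reachable - Y"
    using chosen_fin[OF lab_labels, of t] unfolding step_token_def by blast
  then show ?thesis using step_of step_token_unique t by blast
qed

lemma next_unit: "x \<in> reachable - Y \<Longrightarrow> next_unit x \<in> reachable \<and> level (next_unit x) < level x"
  using step_token_level[of "step_of x"] step_of[of x] by (simp add: next_unit_def)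

primrec tree_path_upto :: "nat \<Rightarrow> 'a \<Rightarrow> (('a set \<times> 'a) \<times> bool) list" where
  "tree_path_upto 0 x = []"
| "tree_path_upto (Suc n) x = (if x \<in> reachable - Y then tree_path_upto n (next_unit x) @ [step_of x] else [])"

definition tree_path :: "'a \<Rightarrow> (('a set \<times> 'a) \<times> bool) list" where "tree_path x = tree_path_upto (level x) x"

lemma tree_path_upto_eq: "x \<in> reachable \<Longrightarrow> level x \<le> n \<Longrightarrow> tree_path_upto n x = tree_path x"
proof (induction n arbitrary: x rule: less_induct)
  case (less n)
  show ?case
  proof (cases "x \<in> reachable - Y")
    case False
    then show ?thesis by (cases n; cases "level x") (auto simp: tree_path_def)
  next
    case True
    have nx: "next_unit x \<in> reachable" "level (next_unit x) < level x" using next_unit[OF True] by auto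
    then obtain m where m: "level x = Suc m" by (cases "level x") auto
    then obtain k where k: "n = Suc k" using less.prems by (cases n) auto
    have 1: "tree_path_upto k (next_unit x) = tree_path (next_unit x)" using less.IH[of k "next_unit x"] nx m k less.prems by auto
    have 2: "tree_path_upto m (next_unit x) = tree_path (next_unit x)" using less.IH[of m "next_unit x"] nx m k less.prems by auto
    show ?thesis unfolding tree_path_def[of x] m k using True 1 2 by simp
  qed
qed

lemma tree_path_Y [simp]: "x \<in> Y \<Longrightarrow> tree_path x = []"
  unfolding tree_path_def by (cases "level x") auto

lemma tree_path_step: "x \<in> reachable - Y \<Longrightarrow> tree_path x = tree_path (next_unit x) @ [step_of x]"
proof -
  assume x: "x \<in> reachable - Y"
  have "tree_path x = tree_path_upto (Suc (level x)) x" using x by (intro tree_path_upto_eq[symmetric]) auto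
  also have "\<dots> = tree_path (next_unit x) @ [step_of x]" using x next_unit[OF x] by (auto simp: tree_path_upto_eq)
  finally show ?thesis .
qed

definition tree_edge :: "'a set \<times> 'a \<Rightarrow> bool" where
  "tree_edge p \<longleftrightarrow> src G (snd p) \<in> chosen (fst p, True) \<or> rng G (snd p) \<in> chosen (fst p, False)"

lemma tree_edge_iff:
  "edge \<E> t \<Longrightarrow> tree_edge (fst t) \<longleftrightarrow> step_token t \<or> step_token (tinv t)"
  using edge_A[of t] by (cases "snd t") (auto simp: tree_edge_def step_token_def tval_def)

definition leg :: "'a \<Rightarrow> 'a" where "leg x = pval G x (tree_path x)"

lemma tree_path: "x \<in> reachable \<Longrightarrow> pok G \<E> x (tree_path x) \<and> rng G (pval G x (tree_path x)) \<in> Y \<and> (\<forall>t\<in>set (tree_path x). tree_edge (fst t))"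
proof (induction "level x" arbitrary: x rule: less_induct)
  case less
  show ?case
  proof (cases "x \<in> Y")
    case True then show ?thesis using YU by auto
  next
    case False
    then have x: "x \<in> reachable - Y" using less.prems by blast
    have t: "edge \<E> (step_of x)" "step_token (step_of x)" "src G (tval G (step_of x)) = x"
      using step_of[OF x] by (auto simp: step_token_def)
    have xU: "x \<in> units G" using reachable_units less.prems by blast
    have 1: "pok G \<E> x [step_of x]" "pval G x [step_of x] = tval G (step_of x)"
      using t xU by (auto simp: mult_unit_right)
    note IH = less.hyps[of "next_unit x"]
    have n: "next_unit x \<in> reachable" "level (next_unit x) < level x" using next_unit[OF x] by auto
    have ok: "pok G \<E> x (tree_path (next_unit x) @ [step_of x])"
      using 1 IH[OF n(2,1)] by (simp only: pok_append) (simp add: next_unit_def)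
    moreover have "rng G (pval G x (tree_path (next_unit x) @ [step_of x])) \<in> Y"
      using pval_append[OF ok] 1 IH[OF n(2,1)] t by (simp add: next_unit_def)
    moreover have "tree_edge (fst (step_of x))" using tree_edge_iff[OF t(1)] t(2) by simp
    ultimately show ?thesis unfolding tree_path_step[OF x] using IH[OF n(2,1)] by auto
  qed
qed

lemma leg_A [simp]: "x \<in> reachable \<Longrightarrow> leg x \<in> A"
  and src_leg [simp]: "x \<in> reachable \<Longrightarrow> src G (leg x) = x"
  and rng_leg [simp]: "x \<in> reachable \<Longrightarrow> rng G (leg x) \<in> Y"
  using tree_path[of x] by (auto simp: leg_def)

lemma leg_Y [simp]: "x \<in> Y \<Longrightarrow> leg x = x"
  by (simp add: leg_def)

lemma step_token_leg: "step_token t \<Longrightarrow> mult G (leg (rng G (tval G t))) (tval G t) = leg (src G (tval G t))"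
proof -
  assume t: "step_token t"
  define x where "x = src G (tval G t)"
  have e: "edge \<E> t" and "x \<in> chosen (lab t)" using t by (auto simp: step_token_def x_def)
  then have x: "x \<in> reachable - Y" using chosen_fin[OF lab_labels[OF e]] by blast
  have s: "step_of x = t" unfolding x_def by (rule step_of_eq[OF t])
  have n: "next_unit x = rng G (tval G t)" by (simp add: next_unit_def s)
  have ok: "pok G \<E> x (tree_path (next_unit x) @ [t])" using tree_path[of x] x tree_path_step[OF x] s by simp
  have "x \<in> units G" using x reachable_units by blast
  then have 1: "pval G x [t] = tval G t" using e by (simp add: mult_unit_right x_def)
  have "leg x = pval G x (tree_path (next_unit x) @ [t])" unfolding leg_def tree_path_step[OF x] s ..
  also have "\<dots> = mult G (leg (next_unit x)) (tval G t)" using pval_append[OF ok] 1 by (simp add: leg_def n)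
  finally show ?thesis unfolding x_def[symmetric] n[symmetric] by (rule sym)
qed

lemma reachable_closed: "edge \<E> t \<Longrightarrow> src G (tval G t) \<in> reachable \<longleftrightarrow> rng G (tval G t) \<in> reachable"
proof -
  have 1: "src G (tval G t) \<in> reachable" if t: "edge \<E> t" "rng G (tval G t) \<in> reachable" for t
  proof -
    obtain n where "rng G (tval G t) \<in> reach n" using t by (auto simp: reachable_def)
    then have "src G (tval G t) \<in> reach (Suc n)" using tval_sheet_of[OF t(1)] lab_labels[OF t(1)] by auto
    then show ?thesis unfolding reachable_def by blast
  qed
  assume "edge \<E> t"
  then show ?thesis using 1[of t] 1[of "tinv t"] by auto
qed

lemma tree_edge_leg:
  assumes t: "edge \<E> t" "tree_edge (fst t)" "src G (tval G t) \<in> reachable"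
  shows "mult G (leg (rng G (tval G t))) (tval G t) = leg (src G (tval G t))"
proof (cases "step_token t")
  case True then show ?thesis by (rule step_token_leg)
next
  case False
  then have "step_token (tinv t)" using t tree_edge_iff by blast
  from step_token_leg[OF this] have "mult G (leg (src G (tval G t))) (inverse_of G (tval G t)) = leg (rng G (tval G t))"
    using t by simp
  moreover have "rng G (tval G t) \<in> reachable" using t reachable_closed by blast
  ultimately show ?thesis using t inv_cancel_right'[of "tval G t" "leg (src G (tval G t))"] by simp
qed

lemma pok_fin: "pok G \<E> x w \<Longrightarrow> x \<in> reachable \<longleftrightarrow> rng G (pval G x w) \<in> reachable"
proof (induction w)
  case (Cons t w)
  then show ?case using reachable_closed[of t] by auto
qed simp

definition slide :: "('a set \<times> 'a) \<times> bool \<Rightarrow> 'a" where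
  "slide t = mult G (leg (rng G (tval G t))) (mult G (tval G t) (inverse_of G (leg (src G (tval G t)))))"

lemma slide_facts:
  assumes t: "edge \<E> t" "src G (tval G t) \<in> reachable"
  shows "slide t \<in> A" "src G (slide t) = rng G (leg (src G (tval G t)))"
    "rng G (slide t) = rng G (leg (rng G (tval G t)))" "slide (tinv t) = inverse_of G (slide t)"
    "src G (slide t) \<in> Y" "rng G (slide t) \<in> Y"
    "g \<in> A \<Longrightarrow> rng G g = src G (tval G t) \<Longrightarrow>
      mult G (slide t) (mult G (leg (src G (tval G t))) g) = mult G (leg (rng G (tval G t))) (mult G (tval G t) g)"
proof -
  have r: "rng G (tval G t) \<in> reachable" using t reachable_closed by blast
  show "slide t \<in> A" "src G (slide t) = rng G (leg (src G (tval G t)))"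
    "rng G (slide t) = rng G (leg (rng G (tval G t)))"
    using t r by (auto simp: slide_def)
  then show "src G (slide t) \<in> Y" "rng G (slide t) \<in> Y" using t r by auto
  show "slide (tinv t) = inverse_of G (slide t)"
    using t r by (simp add: slide_def inverse_mult' assoc')
  show "g \<in> A \<Longrightarrow> rng G g = src G (tval G t) \<Longrightarrow>
      mult G (slide t) (mult G (leg (src G (tval G t))) g) = mult G (leg (rng G (tval G t))) (mult G (tval G t) g)"
    using t r by (simp add: slide_def assoc')
qed

primrec legs_inv :: "nat \<Rightarrow> 'a set" where
  "legs_inv 0 = Y"
| "legs_inv (Suc n) = (\<Union>l\<in>labels. set_mult G (inverse_of G ` {g \<in> sheet_of l. src G g \<in> chosen l}) (legs_inv n))"

lemma legs_inv_sets: "legs_inv n \<in> sets (arrows G)"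
proof (induction n)
  case (Suc n)
  have "set_mult G (inverse_of G ` {g \<in> sheet_of l. src G g \<in> chosen l}) (legs_inv n) \<in> sets (arrows G)" if "l \<in> labels" for l
    by (intro set_mult_sets one_sheeted_inverse one_sheeted_src_vimage sheet_of_sheet chosen_sets that Suc)
  then show ?case using countable_labels by (auto intro!: sets.countable_UN'')
qed (use YA in simp)

lemma legs_inv_eq: "(\<Union>n. legs_inv n) = (\<lambda>x. inverse_of G (leg x)) ` reachable"
proof
  have "legs_inv n \<subseteq> (\<lambda>x. inverse_of G (leg x)) ` reachable" for n
  proof (induction n)
    case 0
    then show ?case using Y_fin YU by (auto simp: subset_iff intro!: rev_image_eqI)
  next
    case (Suc n)
    show ?case
    proof
      fix q assume "q \<in> legs_inv (Suc n)"
      then obtain l g q' where q: "l \<in> labels" "g \<in> sheet_of l" "src G g \<in> chosen l" "q' \<in> legs_inv n"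
        "src G (inverse_of G g) = rng G q'" "q = mult G (inverse_of G g) q'"
        by (auto simp: set_mult_def composable_def)
      obtain x where x: "x \<in> reachable" "q' = inverse_of G (leg x)" using Suc q by blast
      obtain t where t: "edge \<E> t" "lab t = l" "tval G t = g" using sheet_of_tval[OF q(1,2)] by blast
      then have st: "step_token t" using q by (simp add: step_token_def)
      have gA: "g \<in> A" using sheet_of_A q by blast
      then have "rng G g = x" using q(5) x by simp
      then have "leg (src G g) = mult G (leg x) g" using step_token_leg[OF st] t by simp
      then have "inverse_of G (leg (src G g)) = q" using q(6) x gA \<open>rng G g = x\<close> by (simp add: inverse_mult')
      moreover have "src G g \<in> reachable" using chosen_fin[OF q(1)] q(3) by blast
      ultimately show "q \<in> (\<lambda>x. inverse_of G (leg x)) ` reachable" by blast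
    qed
  qed
  then show "(\<Union>n. legs_inv n) \<subseteq> (\<lambda>x. inverse_of G (leg x)) ` reachable" by blast
  have "\<exists>n. inverse_of G (leg x) \<in> legs_inv n" if "x \<in> reachable" for x
    using that
  proof (induction "level x" arbitrary: x rule: less_induct)
    case less
    show ?case
    proof (cases "x \<in> Y")
      case True then show ?thesis using YU by (intro exI[of _ 0]) auto
    next
      case False
      then have x: "x \<in> reachable - Y" using less.prems by blast
      have n: "next_unit x \<in> reachable" "level (next_unit x) < level x" using next_unit[OF x] by auto
      obtain n where IH: "inverse_of G (leg (next_unit x)) \<in> legs_inv n" using less.hyps[OF n(2,1)] by blast
      have t: "edge \<E> (step_of x)" "step_token (step_of x)" "src G (tval G (step_of x)) = x"
        using step_of[OF x] by (auto simp: step_token_def)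
      define g where "g = tval G (step_of x)"
      have g: "g \<in> A" "src G g = x" "rng G g = next_unit x" "g \<in> sheet_of (lab (step_of x))" "src G g \<in> chosen (lab (step_of x))"
        using t tval_sheet_of[OF t(1)] by (auto simp: g_def next_unit_def step_token_def)
      have "leg x = mult G (leg (next_unit x)) g" using step_token_leg[OF t(2)] t g by (simp add: g_def)
      then have "inverse_of G (leg x) = mult G (inverse_of G g) (inverse_of G (leg (next_unit x)))"
        using g n by (simp add: inverse_mult')
      moreover have "(inverse_of G g, inverse_of G (leg (next_unit x))) \<in> composable G"
        using g n by (simp add: composable_def)
      moreover have "inverse_of G g \<in> inverse_of G ` {g \<in> sheet_of (lab (step_of x)). src G g \<in> chosen (lab (step_of x))}"
        using g by blast
      ultimately have "inverse_of G (leg x) \<in>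
          set_mult G (inverse_of G ` {g \<in> sheet_of (lab (step_of x)). src G g \<in> chosen (lab (step_of x))}) (legs_inv n)"
        using IH unfolding set_mult_def by blast
      then have "inverse_of G (leg x) \<in> legs_inv (Suc n)"
        unfolding legs_inv.simps using lab_labels[OF t(1)] by blast
      then show ?thesis by blast
    qed
  qed
  then show "(\<lambda>x. inverse_of G (leg x)) ` reachable \<subseteq> (\<Union>n. legs_inv n)" by blast
qed

lemma legs_sets: "leg ` reachable \<in> sets (arrows G)"
proof -
  have "inverse_of G ` (\<Union>n. legs_inv n) \<in> sets (arrows G)"
    using legs_inv_sets by (intro inverse_image_sets) auto
  also have "inverse_of G ` (\<Union>n. legs_inv n) = leg ` reachable"
    unfolding legs_inv_eq by (simp add: image_image cong: image_cong)
  finally show ?thesis .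
qed

definition leg_piece :: "nat \<Rightarrow> 'a set" where "leg_piece j = leg ` reachable \<inter> S j"

lemma leg_piece_sheet: "leg_piece j \<in> one_sheeted G"
  unfolding leg_piece_def using legs_sets one_sheeted_sets[OF S(1)] by (intro one_sheeted_subset[OF S(1)]) auto

definition rest :: "'a set \<Rightarrow> 'a set" where
  "rest E = {e \<in> E. src G e \<in> reachable \<and> \<not> tree_edge (E, e)}"

lemma rest_sheet: "E \<in> \<E> \<Longrightarrow> rest E \<in> one_sheeted G"
proof -
  assume E: "E \<in> \<E>"
  have "{e \<in> {e \<in> E. src G e \<in> reachable - chosen (E, True)}. rng G e \<in> A - chosen (E, False)} \<in> one_sheeted G"
    using E by (intro one_sheeted_src_vimage one_sheeted_rng_vimage family_sheet sets.Diff reachable_sets chosen_sets) auto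
  also have "{e \<in> {e \<in> E. src G e \<in> reachable - chosen (E, True)}. rng G e \<in> A - chosen (E, False)} = rest E"
    using sheets_A[OF E] by (auto simp: rest_def tree_edge_def)
  finally show ?thesis .
qed

definition piece :: "'a set \<times> nat \<times> nat \<Rightarrow> 'a set" where
  "piece k = (case k of (E, i, j) \<Rightarrow> {e \<in> rest E. leg (rng G e) \<in> S i \<and> leg (src G e) \<in> S j})"

definition slid :: "'a set \<times> nat \<times> nat \<Rightarrow> 'a set" where
  "slid k = (case k of (E, i, j) \<Rightarrow>
     set_mult G (leg_piece i) (set_mult G (rest E) (inverse_of G ` leg_piece j)))"

abbreviation "keys \<equiv> \<E> \<times> (UNIV :: (nat \<times> nat) set)"

lemma slid_sheet: "k \<in> keys \<Longrightarrow> slid k \<in> one_sheeted G"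
  unfolding slid_def
  by (auto intro!: one_sheeted_set_mult leg_piece_sheet rest_sheet one_sheeted_inverse)

lemma piece_edge:
  assumes "k \<in> keys" "e \<in> piece k"
  shows "edge \<E> ((fst k, e), b)" "src G (tval G ((fst k, e), b)) \<in> reachable" "e \<in> A" "src G e \<in> reachable" "rng G e \<in> reachable"
    "\<not> tree_edge (fst k, e)"
proof -
  obtain E i j where k: "k = (E, i, j)" by (cases k)
  have e: "e \<in> E" "src G e \<in> reachable" "\<not> tree_edge (E, e)" and E: "E \<in> \<E>"
    using assms by (auto simp: piece_def rest_def k)
  then show 1: "edge \<E> ((fst k, e), b)" for b by (simp add: edge_def k)
  show eA: "e \<in> A" using sheets_A[OF E] e by blast
  show "src G e \<in> reachable" "\<not> tree_edge (fst k, e)" using e by (auto simp: k)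
  have "rng G e \<in> reachable" using reachable_closed[OF 1[of True]] e by (simp add: tval_def)
  then show "rng G e \<in> reachable" "src G (tval G ((fst k, e), b)) \<in> reachable" using e eA by (auto simp: tval_def)
qed

lemma slid_eq: "k \<in> keys \<Longrightarrow> slid k = (\<lambda>e. slide ((fst k, e), True)) ` piece k"
proof -
  assume kk: "k \<in> keys"
  obtain E i j where k: "k = (E, i, j)" by (cases k)
  have E: "E \<in> \<E>" using kk k by simp
  have r: "e \<in> A \<and> src G e \<in> reachable \<and> rng G e \<in> reachable" if "e \<in> rest E" for e
  proof -
    have e: "edge \<E> ((E, e), True)" using that E by (auto simp: rest_def edge_def)
    then show ?thesis using reachable_closed[OF e] that edge_A[OF e] by (simp add: tval_def rest_def)
  qed
  show ?thesis
  proof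
    show "slid k \<subseteq> (\<lambda>e. slide ((fst k, e), True)) ` piece k"
    proof
      fix f assume "f \<in> slid k"
      then obtain p h where f: "p \<in> leg_piece i" "h \<in> set_mult G (rest E) (inverse_of G ` leg_piece j)"
        "src G p = rng G h" "f = mult G p h"
        unfolding slid_def k prod.case set_mult_def[of G "leg_piece i"] composable_def by blast
      from f(2) obtain e q where h: "e \<in> rest E" "q \<in> leg_piece j" "src G e = rng G (inverse_of G q)"
        "h = mult G e (inverse_of G q)"
        unfolding set_mult_def composable_def by blast
      from f(1) h(2) obtain x y where xy: "x \<in> reachable" "p = leg x" "leg x \<in> S i" "y \<in> reachable" "q = leg y" "leg y \<in> S j"
        unfolding leg_piece_def by blast
      have "src G e = y" "rng G e = x" using r[OF h(1)] h f(3) xy by auto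
      with f h xy have f: "e \<in> rest E" "leg (rng G e) \<in> S i" "leg (src G e) \<in> S j"
        "f = mult G (leg (rng G e)) (mult G e (inverse_of G (leg (src G e))))" by auto
      then show "f \<in> (\<lambda>e. slide ((fst k, e), True)) ` piece k"
        using f by (intro image_eqI[of _ _ e]) (auto simp: slide_def tval_def piece_def k)
    qed
    show "(\<lambda>e. slide ((fst k, e), True)) ` piece k \<subseteq> slid k"
    proof
      fix f assume "f \<in> (\<lambda>e. slide ((fst k, e), True)) ` piece k"
      then obtain e where e: "e \<in> rest E" "leg (rng G e) \<in> S i" "leg (src G e) \<in> S j"
        "f = mult G (leg (rng G e)) (mult G e (inverse_of G (leg (src G e))))"
        by (auto simp: slide_def tval_def piece_def k)
      note r' = r[OF e(1)]
      have "mult G e (inverse_of G (leg (src G e))) \<in> set_mult G (rest E) (inverse_of G ` leg_piece j)"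
      proof -
        have "inverse_of G (leg (src G e)) \<in> inverse_of G ` leg_piece j" using e r' by (auto simp: leg_piece_def)
        moreover have "(e, inverse_of G (leg (src G e))) \<in> composable G" using r' by (simp add: composable_def)
        ultimately show ?thesis unfolding set_mult_def using e(1) by blast
      qed
      moreover have "leg (rng G e) \<in> leg_piece i" using e r' by (auto simp: leg_piece_def)
      moreover have "(leg (rng G e), mult G e (inverse_of G (leg (src G e)))) \<in> composable G"
        using r' by (simp add: composable_def)
      ultimately show "f \<in> slid k" unfolding slid_def k e(4) prod.case set_mult_def[of G "leg_piece i"] by blast
    qed
  qed
qed

definition \<F> :: "'a set set" where "\<F> = slid ` keys"

lemma slid_Y: "k \<in> keys \<Longrightarrow> f \<in> slid k \<Longrightarrow> src G f \<in> Y \<and> rng G f \<in> Y"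
  using slide_facts(5,6) piece_edge(1,2) unfolding slid_eq by blast

lemma family_F: "sheet_family G \<F>"
  unfolding sheet_family_def \<F>_def using countable_family slid_sheet by auto

lemma family_F_restrict: "sheet_family (groupoid_restrict G Y) \<F>"
  unfolding sheet_family_restrict_iff[OF Y] using family_F slid_Y by (auto simp: \<F>_def)

end

context sliding
begin

definition key :: "'a set \<Rightarrow> 'a set \<times> nat \<times> nat" where "key = inv_into keys slid"

lemma key: "F \<in> \<F> \<Longrightarrow> key F \<in> keys" "F \<in> \<F> \<Longrightarrow> slid (key F) = F"
  unfolding key_def \<F>_def by (rule inv_into_into, assumption) (rule f_inv_into_f)

definition base_edge :: "'a set \<times> 'a \<Rightarrow> 'a set \<times> 'a" where
  "base_edge p = (fst (key (fst p)),
     SOME e. e \<in> piece (key (fst p)) \<and> slide ((fst (key (fst p)), e), True) = snd p)"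

definition base_token :: "('a set \<times> 'a) \<times> bool \<Rightarrow> ('a set \<times> 'a) \<times> bool" where
  "base_token s = (base_edge (fst s), snd s)"

lemma base_token_tinv [simp]: "base_token (tinv s) = tinv (base_token s)"
  by (simp add: base_token_def tinv_def)

lemma base_edge:
  assumes "edge \<F> s"
  shows "snd (base_edge (fst s)) \<in> piece (key (fst (fst s))) \<and>
    slide (base_edge (fst s), True) = snd (fst s)"
proof -
  have F: "fst (fst s) \<in> \<F>" "snd (fst s) \<in> fst (fst s)" using assms by (auto simp: edge_def)
  then have "snd (fst s) \<in> slid (key (fst (fst s)))" using key by simp
  then have "\<exists>e. e \<in> piece (key (fst (fst s))) \<and> slide ((fst (key (fst (fst s))), e), True) = snd (fst s)"
    unfolding slid_eq[OF key(1)[OF F(1)]] by (elim imageE) (rule exI, rule conjI, assumption, rule sym)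
  from someI_ex[OF this] show ?thesis unfolding base_edge_def by simp
qed

lemma base_token:
  assumes s: "edge \<F> s"
  shows "edge \<E> (base_token s)" "src G (tval G (base_token s)) \<in> reachable" "\<not> tree_edge (fst (base_token s))"
    "tval G s = slide (base_token s)"
proof -
  have k: "key (fst (fst s)) \<in> keys" using s key by (simp add: edge_def)
  define e where "e = snd (base_edge (fst s))"
  have e: "e \<in> piece (key (fst (fst s)))" "slide (base_edge (fst s), True) = snd (fst s)"
    using base_edge[OF s] by (simp_all add: e_def)
  have be: "base_edge (fst s) = (fst (key (fst (fst s))), e)" by (simp add: e_def base_edge_def)
  note pe = piece_edge[OF k e(1)]
  show 1: "edge \<E> (base_token s)" and "src G (tval G (base_token s)) \<in> reachable" "\<not> tree_edge (fst (base_token s))"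
    using pe by (simp_all add: base_token_def be)
  show "tval G s = slide (base_token s)"
  proof (cases "snd s")
    case True
    then show ?thesis using e(2) by (simp add: tval_def base_token_def)
  next
    case False
    have "slide (tinv (base_edge (fst s), True)) = inverse_of G (slide (base_edge (fst s), True))"
      by (rule slide_facts(4)) (use pe in \<open>simp_all add: be\<close>)
    then show ?thesis using e(2) False by (simp add: tval_def base_token_def tinv_def)
  qed
qed

lemma S_unique: "x \<in> S i \<Longrightarrow> x \<in> S j \<Longrightarrow> i = j"
  using S(3) by (auto simp: disjoint_family_on_def)

lemma piece_key_unique:
  assumes "k \<in> keys" "k' \<in> keys" "e \<in> piece k" "e \<in> piece k'" "fst k = fst k'"
  shows "k = k'"
  using assms S_unique by (cases k; cases k') (auto simp: piece_def)

lemma base_token_inj: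
  assumes s: "edge \<F> s" "edge \<F> s'" and eq: "base_token s = base_token s'"
  shows "s = s'"
proof -
  have F: "fst (fst s) \<in> \<F>" "fst (fst s') \<in> \<F>" using s by (auto simp: edge_def)
  have be: "base_edge (fst s) = base_edge (fst s')" "snd s = snd s'" using eq by (auto simp: base_token_def)
  have "fst (key (fst (fst s))) = fst (key (fst (fst s')))" using be(1) by (simp add: base_edge_def)
  moreover have "snd (base_edge (fst s)) \<in> piece (key (fst (fst s)))" "snd (base_edge (fst s)) \<in> piece (key (fst (fst s')))"
    using base_edge[OF s(1)] base_edge[OF s(2)] be(1) by simp_all
  ultimately have "key (fst (fst s)) = key (fst (fst s'))"
    by (intro piece_key_unique key F)
  then have "slid (key (fst (fst s))) = slid (key (fst (fst s')))" by (rule arg_cong)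
  then have 1: "fst (fst s) = fst (fst s')" unfolding key(2)[OF F(1)] key(2)[OF F(2)] .
  have "snd (fst s) = snd (fst s')" using base_edge[OF s(1)] base_edge[OF s(2)] be(1) by simp
  with 1 be(2) show ?thesis by (intro prod_eqI)
qed

sublocale F: bisheets G \<F>
  by (rule bisheets_family[OF family_F])

lemma slide_word:
  assumes y: "y \<in> Y" and w: "pok G \<E> y w"
  shows "\<exists>v. pok G \<F> y v \<and> pval G y v = mult G (leg (rng G (pval G y w))) (pval G y w)"
  using w
proof (induction w)
  case Nil
  then show ?case using y YU by (intro exI[of _ "[]"]) (auto simp: mult_unit_left subset_iff)
next
  case (Cons t w)
  have t: "edge \<E> t" "pok G \<E> y w" "src G (tval G t) = rng G (pval G y w)" using Cons.prems by auto
  define g where "g = pval G y w"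
  have g: "g \<in> A" "rng G g = src G (tval G t)" "rng G g \<in> reachable"
    using t pok_fin[OF t(2)] y Y_fin by (auto simp: g_def)
  have reachable: "src G (tval G t) \<in> reachable" "rng G (tval G t) \<in> reachable" using g reachable_closed[OF t(1)] by auto
  obtain v where v: "pok G \<F> y v" "pval G y v = mult G (leg (src G (tval G t))) g"
    using Cons.IH[OF t(2)] g by (auto simp: g_def)
  have goal: "mult G (leg (rng G (pval G y (t # w)))) (pval G y (t # w)) =
      mult G (leg (rng G (tval G t))) (mult G (tval G t) g)"
    using t g by (simp add: g_def)
  show ?case
  proof (cases "tree_edge (fst t)")
    case True
    have "mult G (leg (rng G (tval G t))) (mult G (tval G t) g) = mult G (leg (src G (tval G t))) g"
      using tree_edge_leg[OF t(1) True reachable(1)] reachable g t(1) by (simp flip: assoc')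
    then show ?thesis using v goal by auto
  next
    case False
    obtain E e b where te: "t = ((E, e), b)" by (cases t) auto
    have E: "E \<in> \<E>" "e \<in> E" "e \<in> A" using t(1) edge_A[OF t(1)] by (auto simp: te edge_def)
    have ef: "src G e \<in> reachable" "rng G e \<in> reachable" using reachable E by (auto simp: te tval_def split: if_splits)
    obtain i where i: "leg (rng G e) \<in> S i" using S(2) leg_A[OF ef(2)] by blast
    obtain j where j: "leg (src G e) \<in> S j" using S(2) leg_A[OF ef(1)] by blast
    define k where "k = (E, i, j)"
    have k: "k \<in> keys" "e \<in> piece k" using E ef i j False by (auto simp: k_def piece_def rest_def te)
    define s where "s = ((slid k, slide ((E, e), True)), b)"
    have "slide ((E, e), True) \<in> slid k" using slid_eq[OF k(1)] k(2) by (auto simp: k_def)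
    then have s: "edge \<F> s" using k(1) by (auto simp: edge_def s_def \<F>_def)
    have tv: "tval G s = slide t"
    proof (cases b)
      case True then show ?thesis by (simp add: s_def te tval_def)
    next
      case False
      have "slide (tinv ((E, e), True)) = inverse_of G (slide ((E, e), True))"
        by (rule slide_facts(4)) (use E ef in \<open>simp_all add: edge_def tval_def\<close>)
      then show ?thesis using False by (simp add: s_def te tval_def tinv_def)
    qed
    have "pok G \<F> y (s # v)"
      using v s tv slide_facts(2)[OF t(1) reachable(1)] reachable g by simp
    moreover have "pval G y (s # v) = mult G (leg (rng G (tval G t))) (mult G (tval G t) g)"
      using v tv slide_facts(7)[OF t(1) reachable(1) g(1,2)] by simp
    ultimately show ?thesis using goal by metis
  qed
qed

lemma graphing_slid:
  assumes "graphing G mu \<E>"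
  shows "graphing (groupoid_restrict G Y) (restrict_space mu Y) \<F>"
  unfolding graphing_restrict_iff[OF Y]
proof (intro conjI family_F_restrict)
  have "AE x in mu. \<forall>g\<in>A. src G g = x \<longrightarrow> (\<exists>w. pok G \<E> x w \<and> pval G x w = g)"
    using assms unfolding graphing_iff by blast
  then show "AE x in mu. \<forall>g\<in>A. src G g = x \<and> x \<in> Y \<and> rng G g \<in> Y \<longrightarrow> (\<exists>w. pok G \<F> x w \<and> pval G x w = g)"
  proof eventually_elim
    case (elim x)
    show ?case
    proof (intro ballI impI)
      fix g assume g: "g \<in> A" "src G g = x \<and> x \<in> Y \<and> rng G g \<in> Y"
      then obtain w where w: "pok G \<E> x w" "pval G x w = g" using elim by blast
      obtain v where v: "pok G \<F> x v" "pval G x v = mult G (leg (rng G g)) g"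
        using slide_word[OF _ w(1)] w(2) g by blast
      have "mult G (leg (rng G g)) g = g" using g by simp
      then show "\<exists>w. pok G \<F> x w \<and> pval G x w = g" using v by auto
    qed
  qed
qed

definition expand :: "('a set \<times> 'a) \<times> bool \<Rightarrow> (('a set \<times> 'a) \<times> bool) list" where
  "expand s = (let t = base_token s in tree_path (rng G (tval G t)) @ t # winv (tree_path (src G (tval G t))))"

lemma pok_expand:
  assumes "y \<in> Y" "pok G \<F> y w"
  shows "pok G \<E> y (concat (map expand w)) \<and> pval G y (concat (map expand w)) = pval G y w"
  using assms(2)
proof (induction w)
  case Nil then show ?case using assms(1) YU by auto
next
  case (Cons s w)
  have s: "edge \<F> s" "pok G \<F> y w" "src G (tval G s) = rng G (pval G y w)" using Cons.prems by auto
  define t where "t = base_token s"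
  note bt = base_token[OF s(1), folded t_def]
  define u where "u = tval G t"
  have u: "u \<in> A" "src G u \<in> reachable" "rng G u \<in> reachable" using bt(1,2) reachable_closed[OF bt(1)] by (auto simp: u_def)
  define W where "W = concat (map expand w)"
  have W: "pok G \<E> y W" "pval G y W = pval G y w" using Cons.IH[OF s(2)] by (auto simp: W_def)
  define g where "g = pval G y w"
  have g: "g \<in> A" using W by (auto simp: g_def simp flip: W(2))
  have r: "rng G g = rng G (leg (src G u))"
    using s(3) bt(4) slide_facts(2)[OF bt(1,2)] by (simp add: g_def u_def)
  have d: "pok G \<E> (src G u) (tree_path (src G u))" "pok G \<E> (rng G u) (tree_path (rng G u))" using tree_path u by auto
  have wi: "pok G \<E> (rng G g) (winv (tree_path (src G u)))"
    "pval G (rng G g) (winv (tree_path (src G u))) = inverse_of G (leg (src G u))"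
    using pok_winv[OF d(1)] r by (simp_all add: leg_def)
  have 1: "pok G \<E> y (winv (tree_path (src G u)) @ W)"
    using W wi by (simp add: pok_append g_def)
  have v1: "pval G y (winv (tree_path (src G u)) @ W) = mult G (inverse_of G (leg (src G u))) g"
    using pval_append[OF 1] wi W by (simp add: g_def)
  have 2: "pok G \<E> y (t # winv (tree_path (src G u)) @ W)"
    using 1 v1 bt(1) u g r by (simp add: u_def)
  have v2: "pval G y (t # winv (tree_path (src G u)) @ W) = mult G u (mult G (inverse_of G (leg (src G u))) g)"
    using v1 by (simp add: u_def)
  have rng2: "rng G (mult G u (mult G (inverse_of G (leg (src G u))) g)) = rng G u"
    using u g r by simp
  have 3: "pok G \<E> y (tree_path (rng G u) @ (t # winv (tree_path (src G u)) @ W))"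
    unfolding pok_append[of y "tree_path (rng G u)"] v2 rng2 using 2 d(2) by simp
  have "pval G y (tree_path (rng G u) @ (t # winv (tree_path (src G u)) @ W)) =
    mult G (leg (rng G u)) (mult G u (mult G (inverse_of G (leg (src G u))) g))"
    unfolding pval_append[OF 3] v2 rng2 by (simp add: leg_def)
  also have "\<dots> = mult G (slide t) g"
    using u g r by (simp add: slide_def assoc' flip: u_def)
  also have "\<dots> = pval G y (s # w)" using bt(4) by (simp add: g_def)
  finally have "pval G y (tree_path (rng G u) @ (t # winv (tree_path (src G u)) @ W)) = pval G y (s # w)" .
  moreover have "concat (map expand (s # w)) = tree_path (rng G u) @ (t # winv (tree_path (src G u)) @ W)"
    by (simp add: expand_def Let_def W_def t_def u_def)
  ultimately show ?case using 3 by simp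
qed

lemma filter_expand:
  assumes "edge \<F> s"
  shows "filter (\<lambda>t. \<not> tree_edge (fst t)) (expand s) = [base_token s]"
proof -
  define t where "t = base_token s"
  note bt = base_token[OF assms, folded t_def]
  have f: "src G (tval G t) \<in> reachable" "rng G (tval G t) \<in> reachable" using bt(1,2) reachable_closed[OF bt(1)] by auto
  have "filter (\<lambda>t. \<not> tree_edge (fst t)) (tree_path x) = []" if "x \<in> reachable" for x
    using tree_path[OF that] by (auto simp: filter_empty_conv)
  moreover have "filter (\<lambda>t. \<not> tree_edge (fst t)) (winv (tree_path x)) = []" if "x \<in> reachable" for x
    using tree_path[OF that] by (auto simp: filter_empty_conv winv_def)
  ultimately show ?thesis using f bt(3) by (simp add: expand_def Let_def flip: t_def)
qed

lemma filter_concat_expand: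
  assumes "\<forall>s\<in>set w. edge \<F> s"
  shows "filter (\<lambda>t. \<not> tree_edge (fst t)) (concat (map expand w)) = map base_token w"
  using assms by (induction w) (auto simp: filter_expand)

lemma freely_reduced_base:
  assumes "\<forall>s\<in>set w. edge \<F> s" "freely_reduced w"
  shows "freely_reduced (map base_token w)"
  unfolding freely_reduced_def successively_map
proof (rule successively_mono[OF assms(2)[unfolded freely_reduced_def]])
  fix s s' assume s: "s \<in> set w" "s' \<in> set w" "s' \<noteq> tinv s"
  show "base_token s' \<noteq> tinv (base_token s)"
  proof
    assume "base_token s' = tinv (base_token s)"
    then have "base_token s' = base_token (tinv s)" by simp
    moreover have "edge \<F> s'" "edge \<F> (tinv s)" using assms(1) s by simp_all
    ultimately show False using base_token_inj s(3) by blast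
  qed
qed

lemma treeing_slid:
  assumes "treeing G mu \<E>"
  shows "treeing (groupoid_restrict G Y) (restrict_space mu Y) \<F>"
  unfolding treeing_restrict_iff[OF Y]
proof (intro conjI family_F_restrict)
  have "AE x in mu. \<not> (\<exists>w. w \<noteq> [] \<and> freely_reduced w \<and> pok G \<E> x w \<and> pval G x w = x)"
    using assms unfolding treeing_iff by blast
  then show "AE x in mu. x \<in> Y \<longrightarrow> \<not> (\<exists>w. w \<noteq> [] \<and> freely_reduced w \<and> pok G \<F> x w \<and> pval G x w = x)"
  proof eventually_elim
    case (elim x)
    show ?case
    proof (intro impI notI)
      assume x: "x \<in> Y" and "\<exists>w. w \<noteq> [] \<and> freely_reduced w \<and> pok G \<F> x w \<and> pval G x w = x"
      then obtain w where w: "w \<noteq> []" "freely_reduced w" "pok G \<F> x w" "pval G x w = x" by blast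
      have e: "\<forall>s\<in>set w. edge \<F> s" using pok_edge[OF w(3)] by blast
      define W where "W = concat (map expand w)"
      have W: "pok G \<E> x W" "pval G x W = x" using pok_expand[OF x w(3)] w(4) by (auto simp: W_def)
      have f: "filter (\<lambda>t. \<not> tree_edge (fst t)) W = map base_token w"
        unfolding W_def by (rule filter_concat_expand[OF e])
      have "reduct W \<noteq> []"
        by (rule reduct_ne_Nil[of "\<lambda>t. \<not> tree_edge (fst t)"])
          (use f freely_reduced_base[OF e w(2)] w(1) in simp_all)
      then show False using elim pok_reduct[OF W(1)] W(2) freely_reduced_reduct[of W] by auto
    qed
  qed
qed

lemma piece_sheet: "k \<in> keys \<Longrightarrow> piece k \<in> one_sheeted G"
proof -
  assume kk: "k \<in> keys"
  obtain E i j where k: "k = (E, i, j)" by (cases k)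
  have E: "E \<in> \<E>" using kk k by simp
  have r: "e \<in> A \<and> src G e \<in> reachable \<and> rng G e \<in> reachable" if "e \<in> rest E" for e
  proof -
    have e: "edge \<E> ((E, e), True)" using that E by (auto simp: rest_def edge_def)
    then show ?thesis using reachable_closed[OF e] that edge_A[OF e] by (simp add: tval_def rest_def)
  qed
  have "piece k = {e \<in> {e \<in> rest E. src G e \<in> src G ` leg_piece j}. rng G e \<in> src G ` leg_piece i}"
  proof (intro set_eqI iffI)
    fix e assume "e \<in> piece k"
    then have e: "e \<in> rest E" "leg (rng G e) \<in> S i" "leg (src G e) \<in> S j" by (auto simp: k piece_def)
    then show "e \<in> {e \<in> {e \<in> rest E. src G e \<in> src G ` leg_piece j}. rng G e \<in> src G ` leg_piece i}"
      using r[OF e(1)] by (auto simp: leg_piece_def intro: rev_image_eqI[where x="leg _"])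
  next
    fix e assume "e \<in> {e \<in> {e \<in> rest E. src G e \<in> src G ` leg_piece j}. rng G e \<in> src G ` leg_piece i}"
    then show "e \<in> piece k" by (auto simp: k piece_def leg_piece_def)
  qed
  also have "\<dots> \<in> one_sheeted G"
    by (intro one_sheeted_rng_vimage one_sheeted_src_vimage rest_sheet E src_image_sets
        one_sheeted_sets[OF leg_piece_sheet])
  finally show ?thesis .
qed

lemma emeasure_slid:
  assumes k: "k \<in> keys"
  shows "emeasure mu (src G ` slid k) = emeasure mu (src G ` piece k)"
proof -
  obtain E i j where kE: "k = (E, i, j)" by (cases k)
  define Q where "Q = {p \<in> leg_piece j. src G p \<in> src G ` piece k}"
  have Q: "Q \<in> one_sheeted G"
    unfolding Q_def by (intro one_sheeted_src_vimage leg_piece_sheet src_image_sets one_sheeted_sets piece_sheet k)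
  have "Q = (\<lambda>e. leg (src G e)) ` piece k"
  proof (intro set_eqI iffI)
    fix p assume "p \<in> Q"
    then show "p \<in> (\<lambda>e. leg (src G e)) ` piece k" by (auto simp: Q_def leg_piece_def)
  next
    fix p assume "p \<in> (\<lambda>e. leg (src G e)) ` piece k"
    then obtain e where e: "e \<in> piece k" "p = leg (src G e)" by blast
    moreover have "leg (src G e) \<in> S j" using e by (simp add: kE piece_def)
    ultimately show "p \<in> Q" using piece_edge(4)[OF k e(1)] by (auto simp: Q_def leg_piece_def)
  qed
  then have 1: "src G ` Q = src G ` piece k" "rng G ` Q = (\<lambda>e. rng G (leg (src G e))) ` piece k"
    using piece_edge(4)[OF k] by (auto simp: image_image cong: image_cong)
  have "src G ` slid k = (\<lambda>e. rng G (leg (src G e))) ` piece k"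
    unfolding slid_eq[OF k] image_image
  proof (rule image_cong[OF refl])
    fix e assume "e \<in> piece k"
    from slide_facts(2)[OF piece_edge(1,2)[OF k this]]
    show "src G (slide ((fst k, e), True)) = rng G (leg (src G e))" by (simp add: tval_def)
  qed
  then show ?thesis using emeasure_rng_src[OF Q] 1 by simp
qed

lemma nn_integral_slid:
  "(\<integral>\<^sup>+F. emeasure mu (src G ` F) \<partial>count_space \<F>) \<le> (\<integral>\<^sup>+E. emeasure mu (src G ` rest E) \<partial>count_space \<E>)"
proof -
  have "inj_on key \<F>" using key(2) by (metis inj_onI)
  then have bij: "bij_betw key \<F> (key ` \<F>)" by (rule inj_on_imp_bij_betw)
  have "(\<integral>\<^sup>+F. emeasure mu (src G ` F) \<partial>count_space \<F>) = (\<integral>\<^sup>+F. emeasure mu (src G ` slid (key F)) \<partial>count_space \<F>)"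
    by (rule nn_integral_cong) (simp add: key)
  also have "\<dots> = (\<integral>\<^sup>+k. emeasure mu (src G ` slid k) \<partial>count_space (key ` \<F>))"
    by (rule nn_integral_bij_count_space[OF bij])
  also have "\<dots> = (\<integral>\<^sup>+k. emeasure mu (src G ` slid k) * indicator (key ` \<F>) k \<partial>count_space UNIV)"
    by (simp add: nn_integral_count_space_indicator)
  also have "\<dots> \<le> (\<integral>\<^sup>+k. emeasure mu (src G ` piece k) * indicator keys k \<partial>count_space UNIV)"
  proof (rule nn_integral_mono)
    fix k
    show "emeasure mu (src G ` slid k) * indicator (key ` \<F>) k \<le> emeasure mu (src G ` piece k) * indicator keys k"
    proof (cases "k \<in> key ` \<F>")
      case True
      then have "k \<in> keys" using key(1) by blast
      then show ?thesis using emeasure_slid[of k] by (simp split: split_indicator)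
    qed simp
  qed
  also have "\<dots> = (\<integral>\<^sup>+E. \<integral>\<^sup>+ij. emeasure mu (src G ` piece (E, ij)) * indicator keys (E, ij) \<partial>count_space UNIV \<partial>count_space UNIV)"
    by (rule nn_integral_fst_count_space[symmetric])
  also have "\<dots> \<le> (\<integral>\<^sup>+E. emeasure mu (src G ` rest E) * indicator \<E> E \<partial>count_space UNIV)"
  proof (rule nn_integral_mono)
    fix E :: "'a set"
    show "(\<integral>\<^sup>+ij. emeasure mu (src G ` piece (E, ij)) * indicator keys (E, ij) \<partial>count_space UNIV)
        \<le> emeasure mu (src G ` rest E) * indicator \<E> E"
    proof (cases "E \<in> \<E>")
      case True
      have "(\<integral>\<^sup>+ij. emeasure mu (src G ` piece (E, ij)) * indicator keys (E, ij) \<partial>count_space UNIV) =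
        (\<integral>\<^sup>+ij. emeasure mu (src G ` piece (E, ij)) \<partial>count_space UNIV)"
        using True by (intro nn_integral_cong) auto
      also have "\<dots> = emeasure mu (\<Union>ij. src G ` piece (E, ij))"
      proof (rule emeasure_UN_countable[symmetric])
        show "src G ` piece (E, ij) \<in> sets mu" for ij
          using True by (intro src_image_mu one_sheeted_sets piece_sheet) auto
        show "disjoint_family (\<lambda>ij. src G ` piece (E, ij))"
          unfolding disjoint_family_on_def
        proof (intro ballI impI)
          fix p q :: "nat \<times> nat" assume ne: "p \<noteq> q"
          show "src G ` piece (E, p) \<inter> src G ` piece (E, q) = {}"
          proof (rule ccontr)
            assume "src G ` piece (E, p) \<inter> src G ` piece (E, q) \<noteq> {}"
            then obtain e e' where e: "e \<in> piece (E, p)" "e' \<in> piece (E, q)" "src G e = src G e'" by auto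
            have "piece (E, ij) \<subseteq> E" for ij by (auto simp: piece_def rest_def split: prod.splits)
            then have "e = e'" using e inj_onD[OF one_sheeted_src[OF family_sheet[OF True]]] by blast
            then show False using piece_key_unique[of "(E, p)" "(E, q)" e] e True ne by auto
          qed
        qed
      qed simp
      also have "\<dots> \<le> emeasure mu (src G ` rest E)"
        by (rule emeasure_mono)
          (use src_image_mu[OF one_sheeted_sets[OF rest_sheet[OF True]]] in \<open>auto simp: piece_def split: prod.splits\<close>)
      finally show ?thesis using True by simp
    qed simp
  qed
  also have "\<dots> = (\<integral>\<^sup>+E. emeasure mu (src G ` rest E) \<partial>count_space \<E>)"
    by (simp add: nn_integral_count_space_indicator)
  finally show ?thesis .
qed

lemma chosen_mu: "E \<in> \<E> \<Longrightarrow> chosen (E, b) \<in> sets mu"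
  using chosen_sets[of "(E, b)"] chosen_fin[of "(E, b)"] reachable_units by (auto simp: sets_mu_iff)

lemma emeasure_rest:
  assumes E: "E \<in> \<E>"
  shows "emeasure mu (src G ` rest E) + emeasure mu (chosen (E, True) \<union> chosen (E, False)) \<le> emeasure mu (src G ` E)"
proof -
  note sheet = family_sheet[OF E]
  have EA: "E \<subseteq> A" by (rule sheets_A[OF E])
  define E1 where "E1 = {e \<in> E. src G e \<in> chosen (E, True)}"
  define E2 where "E2 = {e \<in> E. rng G e \<in> chosen (E, False)}"
  have lab: "(E, b) \<in> labels" for b using E by simp
  have sh12: "E1 \<in> one_sheeted G" "E2 \<in> one_sheeted G"
    unfolding E1_def E2_def
    by (intro one_sheeted_src_vimage one_sheeted_rng_vimage sheet chosen_sets lab)+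
  have chosen_src: "chosen l \<subseteq> src G ` sheet_of l" for l by (auto simp: chosen_def closer_def)
  have 1: "src G ` E1 = chosen (E, True)"
    using chosen_src[of "(E, True)"] by (auto simp: E1_def sheet_of_def)
  have 2: "rng G ` E2 = chosen (E, False)"
  proof
    show "chosen (E, False) \<subseteq> rng G ` E2"
    proof
      fix x assume x: "x \<in> chosen (E, False)"
      then obtain e where "e \<in> E" "x = src G (inverse_of G e)" using chosen_src[of "(E, False)"] by (auto simp: sheet_of_def)
      then show "x \<in> rng G ` E2" using x EA by (auto simp: E2_def subset_iff)
    qed
  qed (auto simp: E2_def)
  have E12: "E1 \<inter> E2 = {}"
  proof (rule ccontr)
    assume "E1 \<inter> E2 \<noteq> {}"
    then obtain e where e: "e \<in> E" "src G e \<in> chosen (E, True)" "rng G e \<in> chosen (E, False)" by (auto simp: E1_def E2_def)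
    then have eA: "e \<in> A" using EA by blast
    have "step_token ((E, e), True)" "step_token ((E, e), False)"
      using e E eA by (auto simp: step_token_def edge_def tval_def)
    from step_token_level[OF this(1)] step_token_level[OF this(2)] eA show False by (simp add: tval_def)
  qed
  have R: "rest E \<inter> E1 = {}" "rest E \<inter> E2 = {}" "rest E \<subseteq> E" "E1 \<subseteq> E" "E2 \<subseteq> E"
    by (auto simp: rest_def tree_edge_def E1_def E2_def)
  note inj = one_sheeted_src[OF sheet]
  have disj: "src G ` P \<inter> src G ` Q = {}" if "P \<subseteq> E" "Q \<subseteq> E" "P \<inter> Q = {}" for P Q
    using inj_on_image_Int[OF inj that(1,2)] that(3) by simp
  have m: "src G ` rest E \<in> sets mu" "src G ` E1 \<in> sets mu" "src G ` E2 \<in> sets mu" "src G ` E \<in> sets mu"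
    by (intro src_image_mu one_sheeted_sets rest_sheet E sh12 sheet)+
  have "emeasure mu (chosen (E, True) \<union> chosen (E, False)) \<le> emeasure mu (chosen (E, True)) + emeasure mu (chosen (E, False))"
    by (intro emeasure_subadditive chosen_mu E)
  also have "\<dots> = emeasure mu (src G ` E1) + emeasure mu (src G ` E2)"
    unfolding 1[symmetric] 2[symmetric] emeasure_rng_src[OF sh12(2)] ..
  also have "\<dots> = emeasure mu (src G ` E1 \<union> src G ` E2)"
    using m disj[OF R(4,5) E12] by (intro plus_emeasure) auto
  finally have "emeasure mu (src G ` rest E) + emeasure mu (chosen (E, True) \<union> chosen (E, False)) \<le>
    emeasure mu (src G ` rest E) + emeasure mu (src G ` E1 \<union> src G ` E2)" by (rule add_left_mono)
  also have "\<dots> = emeasure mu (src G ` rest E \<union> (src G ` E1 \<union> src G ` E2))"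
    using m disj[OF R(3,4,1)] disj[OF R(3,5,2)] by (intro plus_emeasure) auto
  also have "\<dots> \<le> emeasure mu (src G ` E)"
    using m R by (intro emeasure_mono) auto
  finally show ?thesis .
qed

lemma emeasure_chosen:
  assumes G: "graphing G mu \<E>" and meets: "AE x in mu. \<exists>g\<in>A. src G g = x \<and> rng G g \<in> Y"
  shows "(\<integral>\<^sup>+E. emeasure mu (chosen (E, True) \<union> chosen (E, False)) \<partial>count_space \<E>) = emeasure mu (units G - Y)"
proof -
  have "(\<integral>\<^sup>+E. emeasure mu (chosen (E, True) \<union> chosen (E, False)) \<partial>count_space \<E>) =
    emeasure mu (\<Union>E\<in>\<E>. chosen (E, True) \<union> chosen (E, False))"
  proof (rule emeasure_UN_countable[symmetric])
    show "chosen (E, True) \<union> chosen (E, False) \<in> sets mu" if "E \<in> \<E>" for E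
      using chosen_mu[OF that] by auto
    show "disjoint_family_on (\<lambda>E. chosen (E, True) \<union> chosen (E, False)) \<E>"
      unfolding disjoint_family_on_def
    proof (intro ballI impI, rule ccontr)
      fix E E' assume E: "E \<in> \<E>" "E' \<in> \<E>" "E \<noteq> E'"
        "(chosen (E, True) \<union> chosen (E, False)) \<inter> (chosen (E', True) \<union> chosen (E', False)) \<noteq> {}"
      then obtain x b b' where x: "x \<in> chosen (E, b)" "x \<in> chosen (E', b')" by blast
      have "(E, b) = (E', b')" by (rule chosen_unique[OF _ _ x]) (use E in auto)
      then show False using E(3) by simp
    qed
  qed (rule countable_family)
  also have "(\<Union>E\<in>\<E>. chosen (E, True) \<union> chosen (E, False)) = reachable - Y"
  proof
    show "(\<Union>E\<in>\<E>. chosen (E, True) \<union> chosen (E, False)) \<subseteq> reachable - Y"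
      using chosen_fin by blast
    show "reachable - Y \<subseteq> (\<Union>E\<in>\<E>. chosen (E, True) \<union> chosen (E, False))"
    proof
      fix x assume "x \<in> reachable - Y"
      then obtain E b where "E \<in> \<E>" "x \<in> chosen (E, b)" using chosen_cover by blast
      then show "x \<in> (\<Union>E\<in>\<E>. chosen (E, True) \<union> chosen (E, False))" by (cases b) auto
    qed
  qed
  also have "emeasure mu (reachable - Y) = emeasure mu (units G - Y)"
  proof (rule emeasure_eq_AE)
    have "AE x in mu. \<forall>g\<in>A. src G g = x \<longrightarrow> (\<exists>w. pok G \<E> x w \<and> pval G x w = g)"
      using G unfolding graphing_iff by blast
    with meets show "AE x in mu. x \<in> reachable - Y \<longleftrightarrow> x \<in> units G - Y"
    proof eventually_elim
      case (elim x)
      then obtain g where g: "g \<in> A" "src G g = x" "rng G g \<in> Y" by blast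
      then obtain w where "pok G \<E> x w" "pval G x w = g" using elim by blast
      then have "x \<in> reachable" using pok_fin g Y_fin by blast
      then show ?case using reachable_units by blast
    qed
    show "reachable - Y \<in> sets mu" "units G - Y \<in> sets mu"
      using reachable_sets reachable_units Y units_mu by (auto simp: sets_mu_iff)
  qed
  finally show ?thesis .
qed

lemma cost_slid:
  assumes G: "graphing G mu \<E>" and meets: "AE x in mu. \<exists>g\<in>A. src G g = x \<and> rng G g \<in> Y"
  shows "family_cost (groupoid_restrict G Y) (restrict_space mu Y) \<F> + emeasure mu (units G - Y)
    \<le> family_cost G mu \<E>"
proof -
  have "family_cost (groupoid_restrict G Y) (restrict_space mu Y) \<F> + emeasure mu (units G - Y) \<le>
    (\<integral>\<^sup>+E. emeasure mu (src G ` rest E) \<partial>count_space \<E>) +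
    (\<integral>\<^sup>+E. emeasure mu (chosen (E, True) \<union> chosen (E, False)) \<partial>count_space \<E>)"
    unfolding family_cost_restrict[OF Y family_F_restrict] emeasure_chosen[OF G meets]
    by (intro add_right_mono nn_integral_slid)
  also have "\<dots> = (\<integral>\<^sup>+E. emeasure mu (src G ` rest E) + emeasure mu (chosen (E, True) \<union> chosen (E, False)) \<partial>count_space \<E>)"
    by (rule nn_integral_add[symmetric]) auto
  also have "\<dots> \<le> (\<integral>\<^sup>+E. emeasure mu (src G ` E) \<partial>count_space \<E>)"
    by (intro nn_integral_mono) (use emeasure_rest in simp)
  also have "\<dots> = family_cost G mu \<E>" by (rule family_cost_eq[OF family, symmetric])
  finally show ?thesis .
qed

end

lemma (in pmp_discrete_groupoid) graphing_slide:
  assumes Y: "Y \<in> sets mu" and meets: "AE x in mu. \<exists>g\<in>A. src G g = x \<and> rng G g \<in> Y"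
    and E: "graphing G mu \<E>"
  obtains \<F> where "graphing (groupoid_restrict G Y) (restrict_space mu Y) \<F>"
    "family_cost (groupoid_restrict G Y) (restrict_space mu Y) \<F> + emeasure mu (units G - Y) \<le> family_cost G mu \<E>"
    "treeing G mu \<E> \<Longrightarrow> treeing (groupoid_restrict G Y) (restrict_space mu Y) \<F>"
proof -
  obtain S :: "nat \<Rightarrow> 'a set" where S: "\<And>n. S n \<in> one_sheeted G" "A = (\<Union>n. S n)" "disjoint_family S"
    using sheet_cover by metis
  interpret sliding G mu Y \<E> S
    by unfold_locales (use Y E S in \<open>auto simp: graphing_def\<close>)
  show ?thesis
    by (rule that[OF graphing_slid[OF E] cost_slid[OF E meets] treeing_slid])
qed

theorem proposition4p4:
  fixes G :: "'a groupoid_data" and mu :: "'a measure" and Y :: "'a set"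
  assumes "pmp_discrete_groupoid G mu"
    and "Y \<in> sets mu"
    and "AE x in mu. \<exists>g \<in> space (arrows G). src G g = x \<and> rng G g \<in> Y"
  shows "enn2ereal (cost G mu) - 1 =
           enn2ereal (cost (groupoid_restrict G Y) (restrict_space mu Y))
             - enn2ereal (emeasure mu Y) \<and>
         (treeable G mu \<longleftrightarrow> treeable (groupoid_restrict G Y) (restrict_space mu Y))"
proof -
  interpret pmp_discrete_groupoid G mu by fact
  note Y = assms(2) and meets = assms(3)
  let ?H = "groupoid_restrict G Y" and ?nu = "restrict_space mu Y"
  define m where "m = emeasure mu (units G - Y)"
  have m: "emeasure mu Y + m = 1"
    using plus_emeasure[of Y mu "units G - Y"] Y units_mu sets.sets_into_space[OF Y] emeasure_space_1
    by (simp add: m_def Un_absorb1)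
  have m_fin: "m \<noteq> top" by (simp add: m_def)
  have up: "cost G mu \<le> family_cost ?H ?nu \<F> + m" if F: "graphing ?H ?nu \<F>" for \<F>
  proof -
    obtain \<E> where "graphing G mu \<E>" "family_cost G mu \<E> \<le> family_cost ?H ?nu \<F> + m"
      using graphing_extend[OF Y meets F] unfolding m_def by blast
    then show ?thesis unfolding cost_def by (intro Inf_lower2[of "family_cost G mu \<E>"]) auto
  qed
  have "cost G mu - m \<le> cost ?H ?nu"
    unfolding cost_def[of ?H ?nu]
  proof (rule Inf_greatest)
    fix c assume "c \<in> {family_cost ?H ?nu \<F> |\<F>. graphing ?H ?nu \<F>}"
    then obtain \<F> where F: "graphing ?H ?nu \<F>" "c = family_cost ?H ?nu \<F>" by blast
    show "cost G mu - m \<le> c"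
      using up[OF F(1)] m_fin unfolding F(2) by (simp add: ennreal_minus_le_iff add.commute)
  qed
  then have 1: "cost G mu \<le> cost ?H ?nu + m"
    using m_fin by (simp add: ennreal_minus_le_iff add.commute)
  have 2: "cost ?H ?nu + m \<le> cost G mu"
    unfolding cost_def[of G mu]
  proof (rule Inf_greatest)
    fix c assume "c \<in> {family_cost G mu \<E> |\<E>. graphing G mu \<E>}"
    then obtain \<E> where E: "graphing G mu \<E>" "c = family_cost G mu \<E>" by blast
    obtain \<F> where F: "graphing ?H ?nu \<F>" "family_cost ?H ?nu \<F> + m \<le> family_cost G mu \<E>"
      using graphing_slide[OF Y meets E(1)] unfolding m_def by blast
    have "cost ?H ?nu \<le> family_cost ?H ?nu \<F>" unfolding cost_def by (rule Inf_lower) (use F in auto)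
    then have "cost ?H ?nu + m \<le> family_cost ?H ?nu \<F> + m" by (rule add_right_mono)
    with F(2) show "cost ?H ?nu + m \<le> c" unfolding E(2) by (rule order_trans[rotated])
  qed
  have c: "enn2ereal (cost G mu) = enn2ereal (cost ?H ?nu) + enn2ereal m"
    using antisym[OF 1 2] by (simp add: plus_ennreal.rep_eq)
  have one: "enn2ereal (emeasure mu Y) + enn2ereal m = 1"
    using arg_cong[OF m, of enn2ereal] by (simp add: plus_ennreal.rep_eq one_ennreal.rep_eq)
  have "enn2ereal (cost G mu) - 1 = enn2ereal (cost ?H ?nu) - enn2ereal (emeasure mu Y)"
    unfolding c one[symmetric] using one
    by (cases "enn2ereal (cost ?H ?nu)"; cases "enn2ereal m"; cases "enn2ereal (emeasure mu Y)") auto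
  moreover have "treeable G mu \<longleftrightarrow> treeable ?H ?nu"
  proof
    assume "treeable G mu"
    then obtain \<E> where "treeing G mu \<E>" "graphing G mu \<E>" unfolding treeable_def by blast
    then show "treeable ?H ?nu" using graphing_slide[OF Y meets] unfolding treeable_def by blast
  next
    assume "treeable ?H ?nu"
    then obtain \<F> where "treeing ?H ?nu \<F>" "graphing ?H ?nu \<F>" unfolding treeable_def by blast
    then show "treeable G mu" using graphing_extend[OF Y meets] unfolding treeable_def by blast
  qed
  ultimately show ?thesis ..
qed


end
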